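(* Let $(\mathcal A,m_{\mathcal A})$ and $(\mathcal B,m_{\mathcal B})$ be $A_\infty$-categories and $\Phi_0:\mathcal O_{\mathcal A}\to\mathcal O_{\mathcal B}$ a map. Then $(C_{\Phi_0}(\mathcal A,\mathcal B),\bar\ell)$, with $\bar\ell$ as defined in the context, is a graded $L_\infty$-algebra whose Maurer-Cartan elements $s_{-1}F$ are in bijection with $A_\infty$-morphisms $(\Phi_0,F):(\mathcal A,m_{\mathcal A})\to(\mathcal B,m_{\mathcal B})$.
   Context: Conventions. $\Bbbk$ is a field of characteristic different from $2$ and $3$. Graded spaces are $\mathbb Z$-graded, $V[n]^i=V^{n+i}$, $s_n:V\to V[n]$ (degree $-n$) is the identity on underlying sets. $\mathcal Hom$ is the graded space of maps of all degrees, products are graded products, and the Koszul sign rule is used. A graded quiver $\mathcal A$ with object set $\mathcal O_{\mathcal A}$ is a family of graded spaces ${}_x\mathcal A_y$; for $\bar x=(x_1,\dots,x_p)$, $\mathcal A[1]^{\otimes\bar x}={}_{x_1}\mathcal A_{x_2}[1]\otimes\cdots\otimes{}_{x_{p-1}}\mathcal A_{x_p}[1]$. For $\Phi_0:\mathcal O_{\mathcal A}\to\mathcal O_{\mathcal B}$ let $C_{\Phi_0}(\mathcal A,\mathcal B)=\prod_{p\ge2}\prod_{\bar x\in\mathcal O_{\mathcal A}^p}\mathcal Hom(\mathcal A[1]^{\otimes\bar x},{}_{\Phi_0(x_1)}\mathcal B_{\Phi_0(x_p)})$ and $C(\mathcal A)=C_{\mathrm{id}}(\mathcal A,\mathcal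 A)$. Elements $F$ of $C_{\Phi_0}(\mathcal A,\mathcal B)[1]$ are families of maps $\mathcal A[1]^{\otimes\bar x}\to{}_{\Phi_0(x_1)}\mathcal B_{\Phi_0(x_p)}[1]$, and every element of $C_{\Phi_0}(\mathcal A,\mathcal B)$ is $s_{-1}F$, of degree $|F|+1$. For $F\in C_{\Phi_0}(\mathcal A,\mathcal B)[1]$, $m\in C(\mathcal A)[1]$, $(F\circ_Gm)^{\bar x}=\sum F(\mathrm{id}^{\otimes}\otimes m\otimes\mathrm{id}^{\otimes})$ (all insertions). For $m\in C(\mathcal B)[1]$ and $F_j\in C_{\Phi_0}(\mathcal A,\mathcal B)[1]$, $m(F_1,\dots,F_r)^{\bar x}=\sum m\circ(F_1\otimes\cdots\otimes F_r)$ over all decompositions of $\bar x$ into $r$ consecutive pieces, using the component of $m$ with $r$ inputs. An $A_\infty$-structure on $\mathcal A$ is $m_{\mathcal A}\in C(\mathcal A)[1]$ of degree $1$ with $m_{\mathcal A}\circ_Gm_{\mathcal A}=0$; an $A_\infty$-category is a graded quiver with such a structure. An $A_\infty$-morphism $(\Phi_0,F)$ is $F\in C_{\Phi_0}(\mathcal A,\mathcal B)[1]$ of degree $0$ with $F\circ_Gm_{\mathcal A}=\sum_{r\ge1}m_{\mathcal B}(F,\dots,F)$. The bracket: $\bar\ell^1(s_{-1}F)=s_{-1}\big(m_{\mathcal B}(F)-(-1)^{|F|}F\circ_Gm_{\mathcal A}\big)$, and for $n\ge2$ $$\bar\ell^n(s_{-1}F_n,\dots,s_{-1}F_1)=(-1)^{\sum_{j=1}^n(j-1)|F_j|}\sum_{\sigma\in\mathfrak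 S_n}(-1)^{\delta^\sigma}s_{-1}\,m_{\mathcal B}(F_{\sigma(n)},\dots,F_{\sigma(1)}),\quad\delta^\sigma=\sum_{i>j,\ \sigma(i)<\sigma(j)}|F_{\sigma(i)}||F_{\sigma(j)}|.$$ $L_\infty$-algebras. A graded $L_\infty$-algebra is a graded space $L$ with maps $\ell^n:L^{\otimes n}\to L$ ($n\ge1$) of degree $2-n$, antisymmetric (exchanging adjacent arguments $l,l'$ multiplies by $-(-1)^{|l||l'|}$), such that for all $n$ and homogeneous $l_1,\dots,l_n$: $\sum_{k=1}^n(-1)^k\sum(-1)^\Delta\ell^{n-k+1}(\ell^k(l_{i_k},\dots,l_{i_1}),l_{j_{n-k}},\dots,l_{j_1})=0$, the inner sum over partitions $\{i_1<\dots<i_k\}\sqcup\{j_1<\dots<j_{n-k}\}=\{1,\dots,n\}$, $\Delta=\sum_{r=1}^k\sum_{s=i_r+1}^n(|l_{i_r}||l_s|+1)+\sum_{1\le r<s\le k}(|l_{i_r}||l_{i_s}|+1)$. A Maurer-Cartan element is a degree $1$ element $f$ such that, for every $\bar x$, the $\bar x$-component of $\sum_{n\ge1}\frac1{n!}\ell^n(f,\dots,f)$, which is a finite sum, vanishes. (For the bracket $\bar\ell$ the factor $\frac1{n!}$ cancels against the $n!$ equal terms of the sum over $\mathfrak S_n$, i.e. $\frac1{n!}\bar\ell^n(s_{-1}F,\dots,s_{-1}F)$ stands for $s_{-1}m_{\mathcal B}(F,\dots,F)$ when $n\ge2$ and $|F|=0$.) *)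

theory Defs
  imports
    Complex_Main
    "HOL-Library.FuncSet"
    "HOL-Library.Function_Algebras"
    "HOL-Combinatorics.Permutations"
begin

section \<open>Graded spaces\<close>

text \<open>
  A \<open>\<int>\<close>-graded space is a family \<open>V\<close> of subspaces \<open>V i\<close> of an ambient vector space, read as
  the external direct sum of the \<open>V i\<close>: the \<open>V i\<close> need not be independent in the ambient space,
  which therefore only serves as a carrier. Accordingly a homogeneous element is a pair
  \<open>(d, v)\<close> of its degree \<open>d\<close> and a vector \<open>v \<in> V d\<close>.
\<close>

type_synonym 'v helem = "int \<times> 'v"

definition graded_space ::
  "('k::field \<Rightarrow> 'v::ab_group_add \<Rightarrow> 'v) \<Rightarrow> (int \<Rightarrow> 'v set) \<Rightarrow> bool" where
  "graded_space scale V \<longleftrightarrow> vector_space scale \<and> (\<forall>i. module.subspace scale (V i))"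

definition shift :: "int \<Rightarrow> (int \<Rightarrow> 'v set) \<Rightarrow> int \<Rightarrow> 'v set" where
  "shift n V = (\<lambda>i. V (n + i))"

text \<open>The map \<open>s\<^sub>n : V \<rightarrow> V[n]\<close> of degree \<open>-n\<close>; it is the identity on underlying vectors.\<close>

definition susp :: "int \<Rightarrow> 'v helem \<Rightarrow> 'v helem" where
  "susp n v = (fst v - n, snd v)"

abbreviation deg_sum :: "'v helem list \<Rightarrow> int" where
  "deg_sum vs \<equiv> sum_list (map fst vs)"

definition htuples :: "(int \<Rightarrow> 'v set) list \<Rightarrow> 'v helem list set" where
  "htuples Vs = {vs. list_all2 (\<lambda>V v. snd v \<in> V (fst v)) Vs vs}"

text \<open>
  A degree \<open>d\<close> map \<open>V\<^sub>1 \<otimes> \<dots> \<otimes> V\<^sub>n \<rightarrow> W\<close> is given by its values on the tensors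
  \<open>v\<^sub>1 \<otimes> \<dots> \<otimes> v\<^sub>n\<close> of homogeneous elements, that is, by one multilinear map
  \<open>V\<^sub>1\<^bsup>d1\<^esup> \<times> \<dots> \<times> V\<^sub>n\<^bsup>dn\<^esup> \<rightarrow> W\<^bsup>d1+\<dots>+dn+d\<^esup>\<close> for every tuple of degrees.
\<close>

definition graded_multilinear ::
  "('k::field \<Rightarrow> 'v::ab_group_add \<Rightarrow> 'v) \<Rightarrow> ('k \<Rightarrow> 'w::ab_group_add \<Rightarrow> 'w) \<Rightarrow>
   (int \<Rightarrow> 'v set) list \<Rightarrow> (int \<Rightarrow> 'w set) \<Rightarrow> int \<Rightarrow> ('v helem list \<Rightarrow> 'w) \<Rightarrow> bool" where
  "graded_multilinear sV sW Vs W d f \<longleftrightarrow>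
     (\<forall>vs\<in>htuples Vs. f vs \<in> W (deg_sum vs + d)) \<and>
     (\<forall>us e v w ws. us @ (e, v) # ws \<in> htuples Vs \<longrightarrow> us @ (e, w) # ws \<in> htuples Vs \<longrightarrow>
        f (us @ (e, v + w) # ws) = f (us @ (e, v) # ws) + f (us @ (e, w) # ws)) \<and>
     (\<forall>us e v ws c. us @ (e, v) # ws \<in> htuples Vs \<longrightarrow>
        f (us @ (e, sV c v) # ws) = sW c (f (us @ (e, v) # ws)))"

text \<open>The graded space \<open>Hom(V\<^sub>1 \<otimes> \<dots> \<otimes> V\<^sub>n, W)\<close>; maps take the value \<open>0\<close> outside their domain.\<close>

definition graded_hom ::
  "('k::field \<Rightarrow> 'v::ab_group_add \<Rightarrow> 'v) \<Rightarrow> ('k \<Rightarrow> 'w::ab_group_add \<Rightarrow> 'w) \<Rightarrow>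
   (int \<Rightarrow> 'v set) list \<Rightarrow> (int \<Rightarrow> 'w set) \<Rightarrow> int \<Rightarrow> ('v helem list \<Rightarrow> 'w) set" where
  "graded_hom sV sW Vs W d =
     {f. graded_multilinear sV sW Vs W d f \<and> (\<forall>vs. vs \<notin> htuples Vs \<longrightarrow> f vs = 0)}"


section \<open>Graded quivers and the space \<open>C\<^bsub>\<Phi>\<^esub>(A,B)\<close>\<close>

text \<open>All morphism spaces of a quiver are carried by one ambient vector space.\<close>

record ('k, 'o, 'v) quiver =
  Obj :: "'o set"
  Scale :: "'k \<Rightarrow> 'v \<Rightarrow> 'v"
  Hom :: "'o \<Rightarrow> 'o \<Rightarrow> int \<Rightarrow> 'v set"

definition graded_quiver :: "('k::field, 'o, 'v::ab_group_add) quiver \<Rightarrow> bool" where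
  "graded_quiver A \<longleftrightarrow> vector_space (Scale A) \<and>
     (\<forall>x\<in>Obj A. \<forall>y\<in>Obj A. graded_space (Scale A) (Hom A x y))"

definition obj_seqs :: "('k, 'o, 'v) quiver \<Rightarrow> 'o list set" where
  "obj_seqs A = {xs. 2 \<le> length xs \<and> set xs \<subseteq> Obj A}"

text \<open>The tensor factors of \<open>A[1]\<^bsup>\<otimes>xs\<^esup>\<close>; there are \<open>length xs - 1\<close> of them.\<close>

definition factors :: "('k, 'o, 'v) quiver \<Rightarrow> 'o list \<Rightarrow> (int \<Rightarrow> 'v set) list" where
  "factors A xs = map (\<lambda>i. shift 1 (Hom A (xs ! i) (xs ! Suc i))) [0..<length xs - 1]"

definition composable :: "('k, 'o, 'v) quiver \<Rightarrow> 'o list \<Rightarrow> 'v helem list \<Rightarrow> bool" where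
  "composable A xs vs \<longleftrightarrow> xs \<in> obj_seqs A \<and> vs \<in> htuples (factors A xs)"

text \<open>An element is the family of its components, indexed by sequences of objects.\<close>

type_synonym ('o, 'v, 'w) family = "'o list \<Rightarrow> 'v helem list \<Rightarrow> 'w"

definition Cspace ::
  "('k::field, 'o, 'v::ab_group_add) quiver \<Rightarrow> ('k, 'p, 'w::ab_group_add) quiver \<Rightarrow> ('o \<Rightarrow> 'p) \<Rightarrow>
   int \<Rightarrow> ('o, 'v, 'w) family set" where
  "Cspace A B \<Phi> d =
     {F. (\<forall>xs\<in>obj_seqs A.
            F xs \<in> graded_hom (Scale A) (Scale B) (factors A xs) (Hom B (\<Phi> (hd xs)) (\<Phi> (last xs))) d) \<and>
         (\<forall>xs. xs \<notin> obj_seqs A \<longrightarrow> F xs = 0)}"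

definition Cscale :: "('k, 'p, 'w) quiver \<Rightarrow> 'k \<Rightarrow> ('o, 'v, 'w) family \<Rightarrow> ('o, 'v, 'w) family" where
  "Cscale B c F = (\<lambda>xs vs. Scale B c (F xs vs))"

text \<open>
  \<open>F \<circ>\<^sub>G m\<close>, where \<open>m\<close> is a homogeneous element of \<open>C(A)[1]\<close>. The sign is the Koszul sign of
  \<open>id\<^bsup>\<otimes>i\<^esup> \<otimes> m \<otimes> id\<^bsup>\<otimes>j\<^esup>\<close> evaluated on \<open>vs\<close>; \<open>k\<close> is the number of inputs of \<open>m\<close>. All degrees are
  degrees in \<open>A[1]\<close>.
\<close>

definition gerstenhaber ::
  "('k::field, 'o, 'v::ab_group_add) quiver \<Rightarrow> ('k, 'p, 'w::ab_group_add) quiver \<Rightarrow>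
   ('o, 'v, 'w) family \<Rightarrow> ('o, 'v, 'v) family helem \<Rightarrow> ('o, 'v, 'w) family" where
  "gerstenhaber A B F m = (\<lambda>xs vs.
     if composable A xs vs then
       (\<Sum>(i, k)\<in>{(i, k). 1 \<le> k \<and> i + k \<le> length vs}.
          Scale B ((-1) powi (fst m * deg_sum (take i vs)))
            (F (take (i + 1) xs @ drop (i + k) xs)
               (take i vs @
                (fst m + deg_sum (take k (drop i vs)),
                 snd m (take (k + 1) (drop i xs)) (take k (drop i vs))) #
                drop (i + k) vs)))
     else 0)"

definition compositions :: "nat \<Rightarrow> nat \<Rightarrow> nat list set" where
  "compositions n r = {ns. length ns = r \<and> sum_list ns = n \<and> 0 \<notin> set ns}"

definition cut :: "nat list \<Rightarrow> nat \<Rightarrow> nat" where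
  "cut ns j = sum_list (take j ns)"

text \<open>
  \<open>m(F\<^sub>1,\<dots>,F\<^sub>r)\<close> for \<open>m \<in> C(B)[1]\<close> and the list \<open>Fs\<close> of homogeneous elements \<open>F\<^sub>1,\<dots>,F\<^sub>r\<close> of
  \<open>C\<^bsub>\<Phi>\<^esub>(A,B)[1]\<close>. The \<open>j\<close>-th piece has \<open>ns ! j \<ge> 1\<close> inputs, starting at position \<open>cut ns j\<close>, and
  neighbouring pieces share an object. The sign is the Koszul sign of \<open>F\<^sub>1 \<otimes> \<dots> \<otimes> F\<^sub>r\<close> evaluated
  on \<open>vs\<close>.
\<close>

definition multi_comp ::
  "('k::field, 'o, 'v::ab_group_add) quiver \<Rightarrow> ('k, 'p, 'w::ab_group_add) quiver \<Rightarrow> ('o \<Rightarrow> 'p) \<Rightarrow>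
   ('p, 'w, 'w) family \<Rightarrow> ('o, 'v, 'w) family helem list \<Rightarrow> ('o, 'v, 'w) family" where
  "multi_comp A B \<Phi> m Fs = (\<lambda>xs vs.
     if composable A xs vs then
       (\<Sum>ns\<in>compositions (length vs) (length Fs).
          Scale B ((-1) powi (\<Sum>j<length Fs. fst (Fs ! j) * deg_sum (take (cut ns j) vs)))
            (m (map (\<lambda>j. \<Phi> (xs ! cut ns j)) [0..<length Fs + 1])
               (map (\<lambda>j. let us = take (ns ! j) (drop (cut ns j) vs);
                             ys = take (ns ! j + 1) (drop (cut ns j) xs)
                         in (fst (Fs ! j) + deg_sum us, snd (Fs ! j) ys us))
                    [0..<length Fs])))
     else 0)"


section \<open>\<open>A\<^sub>\<infinity>\<close>-categories and \<open>A\<^sub>\<infinity>\<close>-morphisms\<close>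

definition A_inf_category ::
  "('k::field, 'o, 'v::ab_group_add) quiver \<Rightarrow> ('o, 'v, 'v) family \<Rightarrow> bool" where
  "A_inf_category A m \<longleftrightarrow>
     graded_quiver A \<and> m \<in> shift 1 (Cspace A A id) 1 \<and> gerstenhaber A A m (1, m) = 0"

text \<open>
  A component indexed by \<open>xs\<close> has \<open>length xs - 1\<close> inputs, so that it has no decomposition into
  \<open>r \<ge> length xs\<close> pieces; hence the range of the sum over \<open>r\<close>.
\<close>

definition A_inf_morphism ::
  "('k::field, 'o, 'v::ab_group_add) quiver \<Rightarrow> ('o, 'v, 'v) family \<Rightarrow>
   ('k, 'p, 'w::ab_group_add) quiver \<Rightarrow> ('p, 'w, 'w) family \<Rightarrow>
   ('o \<Rightarrow> 'p) \<Rightarrow> ('o, 'v, 'w) family \<Rightarrow> bool" where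
  "A_inf_morphism A mA B mB \<Phi> F \<longleftrightarrow>
     F \<in> shift 1 (Cspace A B \<Phi>) 0 \<and>
     (\<forall>xs\<in>obj_seqs A. gerstenhaber A B F (1, mA) xs =
        (\<Sum>r\<in>{1..<length xs}. multi_comp A B \<Phi> mB (replicate r (0, F)) xs))"


section \<open>\<open>L\<^sub>\<infinity>\<close>-algebras\<close>

text \<open>
  Argument lists are in written order: \<open>br n [l\<^sub>n, \<dots>, l\<^sub>1]\<close> is the \<open>n\<close>-ary bracket of \<open>l\<^sub>n \<otimes> \<dots> \<otimes> l\<^sub>1\<close>. For
  \<open>I = {i\<^sub>1 < \<dots> < i\<^sub>k}\<close> and \<open>l\<close> sending \<open>i\<close> to \<open>l\<^sub>i\<close>, \<open>args_desc l I\<close> is \<open>[l\<^bsub>ik\<^esub>, \<dots>, l\<^bsub>i1\<^esub>]\<close>.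
\<close>

definition args_desc :: "(nat \<Rightarrow> 'l helem) \<Rightarrow> nat set \<Rightarrow> 'l helem list" where
  "args_desc l I = map l (rev (sorted_list_of_set I))"

definition jacobi_sign :: "(nat \<Rightarrow> 'l helem) \<Rightarrow> nat \<Rightarrow> nat set \<Rightarrow> int" where
  "jacobi_sign l n I =
     (\<Sum>i\<in>I. \<Sum>s\<in>{i+1..n}. fst (l i) * fst (l s) + 1) +
     (\<Sum>(i, i')\<in>{(i, i'). i \<in> I \<and> i' \<in> I \<and> i < i'}. fst (l i) * fst (l i') + 1)"

definition L_inf_algebra ::
  "('k::field \<Rightarrow> 'l::ab_group_add \<Rightarrow> 'l) \<Rightarrow> (int \<Rightarrow> 'l set) \<Rightarrow> (nat \<Rightarrow> 'l helem list \<Rightarrow> 'l) \<Rightarrow> bool" where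
  "L_inf_algebra scale L br \<longleftrightarrow>
     graded_space scale L \<and>
     (\<forall>n\<ge>1. graded_multilinear scale scale (replicate n L) L (2 - int n) (br n)) \<and>
     (\<forall>n\<ge>1. \<forall>us l l' ws. us @ l # l' # ws \<in> htuples (replicate n L) \<longrightarrow>
        br n (us @ l' # l # ws) = scale (- ((-1) powi (fst l * fst l'))) (br n (us @ l # l' # ws))) \<and>
     (\<forall>n\<ge>1. \<forall>l. (\<forall>i\<in>{1..n}. snd (l i) \<in> L (fst (l i))) \<longrightarrow>
        (\<Sum>k=1..n. scale ((-1) powi int k)
           (\<Sum>I | I \<subseteq> {1..n} \<and> card I = k. scale ((-1) powi jacobi_sign l n I)
              (br (n - k + 1)
                 (((\<Sum>i\<in>I. fst (l i)) + 2 - int k, br k (args_desc l I)) # args_desc l ({1..n} - I))))) = 0)"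

text \<open>
  Maurer--Cartan elements of an \<open>L\<^sub>\<infinity>\<close>-algebra \<open>L\<close> whose elements are families with components
  indexed by \<open>S\<close>. The argument \<open>D n f\<close> is \<open>(1/n!) br n (f,\<dots>,f)\<close>; it is a parameter because \<open>n!\<close>
  may vanish in the base field.
\<close>

definition maurer_cartan ::
  "(int \<Rightarrow> ('x \<Rightarrow> 'e::ab_group_add) set) \<Rightarrow> (nat \<Rightarrow> ('x \<Rightarrow> 'e) \<Rightarrow> 'x \<Rightarrow> 'e) \<Rightarrow> 'x set \<Rightarrow> ('x \<Rightarrow> 'e) \<Rightarrow> bool" where
  "maurer_cartan L D S f \<longleftrightarrow> f \<in> L 1 \<and>
     (\<forall>x\<in>S. finite {n. 1 \<le> n \<and> D n f x \<noteq> 0} \<and> (\<Sum>n | 1 \<le> n \<and> D n f x \<noteq> 0. D n f x) = 0)"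


section \<open>The bracket on \<open>C\<^bsub>\<Phi>\<^esub>(A,B)\<close>\<close>

definition perm_sign :: "(nat \<Rightarrow> 'l helem) \<Rightarrow> nat \<Rightarrow> (nat \<Rightarrow> nat) \<Rightarrow> int" where
  "perm_sign F n \<sigma> =
     (\<Sum>(i, j)\<in>{(i, j). i \<in> {1..n} \<and> j \<in> {1..n} \<and> i > j \<and> \<sigma> i < \<sigma> j}. fst (F (\<sigma> i)) * fst (F (\<sigma> j)))"

text \<open>
  In \<open>ls = [s\<^bsub>-1\<^esub>F\<^sub>n, \<dots>, s\<^bsub>-1\<^esub>F\<^sub>1]\<close> the element \<open>s\<^bsub>-1\<^esub>F\<^sub>j\<close> has list index \<open>n - j\<close>, and \<open>F\<^sub>j\<close> is
  recovered from it by \<open>s\<^sub>1\<close>.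
\<close>

definition lbar ::
  "('k::field, 'o, 'v::ab_group_add) quiver \<Rightarrow> ('o, 'v, 'v) family \<Rightarrow>
   ('k, 'p, 'w::ab_group_add) quiver \<Rightarrow> ('p, 'w, 'w) family \<Rightarrow> ('o \<Rightarrow> 'p) \<Rightarrow>
   nat \<Rightarrow> ('o, 'v, 'w) family helem list \<Rightarrow> ('o, 'v, 'w) family" where
  "lbar A mA B mB \<Phi> n ls =
     (let F = (\<lambda>j. susp 1 (ls ! (n - j))) in
      if n = 1 then
        multi_comp A B \<Phi> mB [F 1] - Cscale B ((-1) powi fst (F 1)) (gerstenhaber A B (snd (F 1)) (1, mA))
      else
        Cscale B ((-1) powi (\<Sum>j=1..n. (int j - 1) * fst (F j)))
          (\<Sum>\<sigma> | \<sigma> permutes {1..n}. Cscale B ((-1) powi perm_sign F n \<sigma>)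
             (multi_comp A B \<Phi> mB (map (\<lambda>i. F (\<sigma> i)) (rev [1..<n+1])))))"

text \<open>
  \<open>(1/n!) lbar n (f,\<dots>,f)\<close> for \<open>f = s\<^bsub>-1\<^esub>F\<close> of degree \<open>1\<close>. If \<open>n! = 0\<close> in the base field (which forces
  \<open>n \<ge> 2\<close>), it stands for \<open>s\<^bsub>-1\<^esub> m\<^sub>B(F,\<dots>,F)\<close>; by \<open>lbar_replicate\<close> below this is what it equals
  for all \<open>n \<ge> 2\<close> with \<open>n! \<noteq> 0\<close>.
\<close>

definition lbar_divided ::
  "('k::field, 'o, 'v::ab_group_add) quiver \<Rightarrow> ('o, 'v, 'v) family \<Rightarrow>
   ('k, 'p, 'w::ab_group_add) quiver \<Rightarrow> ('p, 'w, 'w) family \<Rightarrow> ('o \<Rightarrow> 'p) \<Rightarrow>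
   nat \<Rightarrow> ('o, 'v, 'w) family \<Rightarrow> ('o, 'v, 'w) family" where
  "lbar_divided A mA B mB \<Phi> n f =
     (if (of_nat (fact n) :: 'k) \<noteq> 0
      then Cscale B (1 / of_nat (fact n)) (lbar A mA B mB \<Phi> n (replicate n (1, f)))
      else multi_comp A B \<Phi> mB (replicate n (susp 1 (1, f))))"

lemma lbar_replicate:
  fixes B :: "('k::field, 'p, 'w::ab_group_add) quiver"
  assumes B: "vector_space (Scale B)" and n: "n \<ge> 2"
  shows "lbar A mA B mB \<Phi> n (replicate n (1, f)) =
         Cscale B (of_nat (fact n)) (multi_comp A B \<Phi> mB (replicate n (susp 1 (1, f))))"
proof -
  interpret vector_space "Scale B" by (fact B)
  let ?F = "\<lambda>j. susp 1 (replicate n (1::int, f) ! (n - j))"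
  let ?M = "multi_comp A B \<Phi> mB (replicate n (susp 1 (1, f)))"
  have F: "?F j = susp 1 (1, f)" if "j \<ge> 1" for j
    using that n by (subst nth_replicate) auto
  have pos: "\<sigma> i \<ge> 1" if "\<sigma> permutes {1..n}" "i \<in> {1..n}" for \<sigma> i
    using permutes_in_image[OF that(1), of i] that(2) by auto
  have one: "Cscale B 1 G = G" for G :: "('o, 'v, 'w) family"
    by (simp add: Cscale_def)
  have sgn: "perm_sign ?F n \<sigma> = 0" if "\<sigma> permutes {1..n}" for \<sigma>
    unfolding perm_sign_def
  proof (intro sum.neutral ballI, clarify)
    fix i j assume "i \<in> {1..n}" "j \<in> {1..n}"
    then show "fst (?F (\<sigma> i)) * fst (?F (\<sigma> j)) = 0"
      using F[OF pos[OF that]] by (simp add: susp_def)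
  qed
  have args: "map (\<lambda>i. ?F (\<sigma> i)) (rev [1..<n+1]) = replicate n (susp 1 (1, f))"
    if "\<sigma> permutes {1..n}" for \<sigma>
  proof (rule nth_equalityI, simp)
    fix i assume "i < length (map (\<lambda>i. ?F (\<sigma> i)) (rev [1..<n+1]))"
    then have i: "i < n" by (simp del: upt_Suc)
    then have "rev [1..<n+1] ! i = n - i" by (simp add: rev_nth nth_append del: upt_Suc)
    moreover have "n - i \<in> {1..n}" using i by auto
    ultimately show "map (\<lambda>i. ?F (\<sigma> i)) (rev [1..<n+1]) ! i = replicate n (susp 1 (1, f)) ! i"
      using i F[OF pos[OF that]] by (simp del: upt_Suc)
  qed
  have pre: "(\<Sum>j=1..n. (int j - 1) * fst (?F j)) = 0"
    by (intro sum.neutral ballI) (use F in \<open>auto simp: susp_def\<close>)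
  have lhs: "lbar A mA B mB \<Phi> n (replicate n (1, f)) = (\<Sum>\<sigma> | \<sigma> permutes {1..n}. ?M)"
  proof -
    have "lbar A mA B mB \<Phi> n (replicate n (1, f)) =
        (\<Sum>\<sigma> | \<sigma> permutes {1..n}. Cscale B ((-1) powi perm_sign ?F n \<sigma>)
             (multi_comp A B \<Phi> mB (map (\<lambda>i. ?F (\<sigma> i)) (rev [1..<n+1]))))"
      unfolding lbar_def Let_def pre using n by (simp add: one del: upt_Suc)
    also have "\<dots> = (\<Sum>\<sigma> | \<sigma> permutes {1..n}. ?M)"
    proof (rule sum.cong[OF refl])
      fix \<sigma> assume "\<sigma> \<in> {\<sigma>. \<sigma> permutes {1..n}}"
      then have p: "\<sigma> permutes {1..n}" by simp
      show "Cscale B ((-1) powi perm_sign ?F n \<sigma>)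
             (multi_comp A B \<Phi> mB (map (\<lambda>i. ?F (\<sigma> i)) (rev [1..<n+1]))) = ?M"
        unfolding sgn[OF p] args[OF p] by (simp add: one)
    qed
    finally show ?thesis .
  qed
  have const: "(\<Sum>s\<in>T. ?M) = Cscale B (of_nat (card T)) ?M" if "finite T" for T :: "(nat \<Rightarrow> nat) set"
    using that
    by (induction T rule: finite_induct)
       (auto simp: Cscale_def fun_eq_iff scale_left_distrib plus_fun_def zero_fun_def)
  have "card {\<sigma>. \<sigma> permutes {1..n}} = fact n"
    by (rule card_permutations) auto
  with const[OF finite_permutations[of "{1..n}"]] show ?thesis
    unfolding lhs by simp
qed

end

theory Submission
  imports Defs "HOL-Combinatorics.Multiset_Permutations"
begin

text \<open>
  Write \<open>|F|\<close> for the degree of \<open>F\<close> in \<open>C\<^bsub>\<Phi>\<^esub>(A,B)[1]\<close> and let \<open>X(F\<^sub>1,\<dots>,F\<^sub>r)\<close> be \<open>m\<^sub>B(F\<^sub>1,\<dots>,F\<^sub>r)\<close>, except that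
  \<open>X(F) = m\<^sub>B(F) - (-1)\<^bsup>|F|\<^esup> F \<circ>\<^sub>G m\<^sub>A\<close>. Evaluating on composable sequences, the relations
  \<open>m\<^sub>B \<circ>\<^sub>G m\<^sub>B = 0\<close> and \<open>m\<^sub>A \<circ>\<^sub>G m\<^sub>A = 0\<close> give, for every word \<open>F\<^sub>1,\<dots>,F\<^sub>r\<close>,
  the relation \<open>\<Sum> \<plusminus> X(F\<^sub>1,\<dots>,X(F\<^bsub>i+1\<^esub>,\<dots>,F\<^bsub>i+k\<^esub>),\<dots>,F\<^sub>r) = 0\<close> of an \<open>A\<^sub>\<infinity>\<close>-algebra. The bracket is, up to
  the shift of degrees, the signed sum of \<open>X\<close> over all orderings of its arguments, and choosing
  an ordering, a subset of the arguments and an ordering of the subset is the same as choosing an ordering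
  of everything together with a nonempty consecutive part of it. So the \<open>L\<^sub>\<infinity>\<close>-relation is the signed
  sum over all orderings of the relation for \<open>X\<close>; no division by factorials occurs.
\<close>

section \<open>Cutting lists into pieces\<close>

text \<open>The definitions address inputs by positions in two parallel lists, of objects and of
  vectors, whereas the structure equations regroup inputs. Once a composable pair is a single list
  of edges, each composition sum ranges over factorisations of a list, and each identity becomes a
  bijection between factorisations together with a parity check. The correction in
  \<open>X(F)\<close> is compatible with the higher operations because \<open>m_A\<close> inserted
  into \<open>m_B(F_1,...,F_r)\<close> meets exactly one piece, so precomposition is a signed
  derivation. The corrections made inside and outside therefore cancel, and
  \<open>m_A o m_A = 0\<close> removes the twofold one. The bracket counts signs with
  \<open>|F|\<close>, the Jacobi identity with \<open>|F| + 1\<close>. The whole discrepancy is an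
  exponent that can be compared term by term, which is why no sum has to be rearranged for the sake
  of signs. Families are total functions that vanish off composable input. Linearity is thus
  available only along valid paths, and every use of it must first show that the contracted sequence
  is again a path and that the new value lies in the right morphism space.\<close>

lemma ksign_if: "((-1::'k::field) powi d) = (if even d then 1 else -1)"
  by (simp add: power_int_minus_left)

lemma ksign_cong: "even (a - b) \<Longrightarrow> (-1::'k::field) powi a = (-1) powi b"
  by (auto simp: ksign_if)

lemma ksign_add: "(-1::'k::field) powi (a + b) = (-1) powi a * (-1) powi b"
  by (simp add: ksign_if)

text \<open>A cut marks the consecutive inputs consumed by an inserted operation; the middle part is
  nonempty because every operation has at least one input.\<close>

definition cuts :: "'e list \<Rightarrow> ('e list \<times> 'e list \<times> 'e list) set" where
  "cuts w = {(u, p, v). w = u @ p @ v \<and> p \<noteq> []}"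

definition pieces :: "'e list \<Rightarrow> nat \<Rightarrow> 'e list list set" where
  "pieces w r = {ps. concat ps = w \<and> [] \<notin> set ps \<and> length ps = r}"

text \<open>
  The divisions of \<open>u @ x # v\<close> into pieces, with the letter \<open>x\<close> removed from the piece containing it.
  They do not depend on \<open>x\<close>, which allows linearity in \<open>x\<close> to be read off termwise.
\<close>

definition interior_pieces ::
  "'e list \<Rightarrow> 'e list \<Rightarrow> nat \<Rightarrow> ('e list list \<times> 'e list \<times> 'e list \<times> 'e list list) set" where
  "interior_pieces u v r = {(ps, a, b, qs). concat ps @ a = u \<and> b @ concat qs = v \<and>
     [] \<notin> set ps \<and> [] \<notin> set qs \<and> length ps + 1 + length qs = r}"

lemma take_drop_split: "take i w @ take k (drop i w) @ drop (i + k) w = w"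
  by (metis add.commute append_take_drop_id drop_drop)

lemma sum_cuts:
  "(\<Sum>(u, p, v)\<in>cuts w. h u p v) =
   (\<Sum>(i, k)\<in>{(i, k). 1 \<le> k \<and> i + k \<le> length w}. h (take i w) (take k (drop i w)) (drop (i + k) w))"
  by (rule sum.reindex_bij_witness
      [where j = "\<lambda>(u, p, v). (length u, length p)"
         and i = "\<lambda>(i, k). (take i w, take k (drop i w), drop (i + k) w)"])
     (auto simp: cuts_def Suc_le_eq take_drop_split)

lemma finite_cuts [simp]: "finite (cuts w)"
proof -
  have "cuts w \<subseteq> (\<lambda>(i, k). (take i w, take k (drop i w), drop (i + k) w)) ` ({..length w} \<times> {..length w})"
  proof clarify
    fix u p v assume "(u, p, v) \<in> cuts w"
    then have "w = u @ p @ v" by (simp add: cuts_def)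
    then show "(u, p, v) \<in> (\<lambda>(i, k). (take i w, take k (drop i w), drop (i + k) w)) ` ({..length w} \<times> {..length w})"
      by (intro image_eqI[of _ _ "(length u, length p)"]) auto
  qed
  then show ?thesis by (rule finite_subset) auto
qed

lemma finite_compositions: "finite (compositions n r)"
proof -
  have "compositions n r \<subseteq> {ns. set ns \<subseteq> {..n} \<and> length ns = r}"
    using member_le_sum_list by (fastforce simp: compositions_def)
  then show ?thesis by (rule finite_subset) (rule finite_lists_length_eq, simp)
qed

text \<open>Positive lengths with the right sum cut \<open>w\<close> greedily from the left.
  Together with \<open>inj_on_pieces\<close> this turns sums over \<open>compositions\<close> into
  sums over \<open>pieces\<close>.\<close>

lemma compositions_eq: "compositions (length w) r = map length ` pieces w r"
proof (intro set_eqI iffI)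
  fix ns assume "ns \<in> map length ` pieces w r"
  then show "ns \<in> compositions (length w) r"
    by (auto simp: compositions_def pieces_def length_concat)
next
  fix ns assume "ns \<in> compositions (length w) r"
  then have "sum_list ns = length w" "0 \<notin> set ns" "length ns = r"
    by (auto simp: compositions_def)
  then show "ns \<in> map length ` pieces w r"
  proof (induction ns arbitrary: w r)
    case Nil
    then show ?case by (auto simp: pieces_def)
  next
    case (Cons n ns)
    have "ns \<in> map length ` pieces (drop n w) (r - 1)"
      using Cons.prems by (intro Cons.IH) auto
    then obtain ps where ps: "ps \<in> pieces (drop n w) (r - 1)" "ns = map length ps" by auto
    have len: "length (take n w) = n" using Cons.prems by auto
    have "take n w # ps \<in> pieces w r"
      using ps Cons.prems len by (auto simp: pieces_def)
    moreover have "n # ns = map length (take n w # ps)" using ps len by simp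
    ultimately show ?case by (rule image_eqI[rotated])
  qed
qed

lemma inj_on_pieces: "inj_on (map length) (pieces w r)"
proof (rule inj_onI)
  fix ps qs assume *: "ps \<in> pieces w r" "qs \<in> pieces w r" "map length ps = map length qs"
  have "length ps = length qs" using arg_cong[OF *(3), of length] by simp
  have "length (ps ! n) = length (qs ! n)" if "n < length ps" for n
    using arg_cong[OF *(3), of "\<lambda>ns. ns ! n"] that \<open>length ps = length qs\<close> by simp
  then have "\<forall>(x, y)\<in>set (zip ps qs). length x = length y"
    by (auto simp: in_set_zip)
  with * show "ps = qs"
    using concat_eq_concat_iff[of ps qs] by (auto simp: pieces_def)
qed

lemma finite_pieces [simp]: "finite (pieces w r)"
  by (metis compositions_eq finite_compositions finite_imageD inj_on_pieces)

text \<open>The prefix \<open>u\<close> fixes the position of \<open>x\<close>. Comparing the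
  lengths of \<open>p\<close> and \<open>u\<close> decides whether it falls into the first piece; if
  not, that piece is stripped off.\<close>

lemma concat_eq_append_Cons:
  assumes "concat ps = u @ x # v"
  shows "\<exists>qs a b rs. ps = qs @ (a @ x # b) # rs \<and> concat qs @ a = u \<and> b @ concat rs = v"
  using assms
proof (induction ps arbitrary: u)
  case Nil
  then show ?case by simp
next
  case (Cons p ps)
  show ?case
  proof (cases "length p \<le> length u")
    case True
    then have "p = take (length p) u" "concat ps = drop (length p) u @ x # v"
      using Cons.prems by (auto simp: append_eq_append_conv_if)
    with Cons.IH[of "drop (length p) u"] obtain qs a b rs where
      "ps = qs @ (a @ x # b) # rs" "concat qs @ a = drop (length p) u" "b @ concat rs = v"
      by blast
    moreover have "p @ drop (length p) u = u"
      using \<open>p = take (length p) u\<close> append_take_drop_id[of "length p" u] by simp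
    ultimately show ?thesis
      by (intro exI[of _ "p # qs"] exI[of _ a] exI[of _ b] exI[of _ rs]) simp
  next
    case False
    then obtain c where c: "p = u @ c" "c @ concat ps = x # v" 
      using Cons.prems by (auto simp: append_eq_append_conv2)
    with False obtain b where "c = x # b" by (cases c) auto
    with c show ?thesis
      by (intro exI[of _ "[]"] exI[of _ u] exI[of _ b] exI[of _ ps]) simp
  qed
qed

text \<open>The letter \<open>x\<close> may occur repeatedly, so equality of the lists alone does
  not determine the factorisation; the second assumption pins down the marked occurrence.\<close>

lemma append_Cons_inject:
  assumes "qs @ (a @ x # b) # rs = qs' @ (a' @ x # b') # rs'"
    and "length (concat qs @ a) = length (concat qs' @ a')"
  shows "qs = qs' \<and> a = a' \<and> b = b' \<and> rs = rs'"
  using assms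
proof (induction qs arbitrary: qs')
  case Nil
  have "qs' = []"
  proof (rule ccontr)
    assume "qs' \<noteq> []"
    then obtain q qs'' where q: "qs' = q # qs''" by (cases qs') auto
    with Nil.prems(1) have "q = a @ x # b" by simp
    with Nil.prems(2) q show False by simp
  qed
  with Nil.prems show ?case by simp
next
  case (Cons q qs)
  have "qs' \<noteq> []"
  proof
    assume "qs' = []"
    with Cons.prems(1) have "q = a' @ x # b'" by simp
    with Cons.prems(2) \<open>qs' = []\<close> show False by simp
  qed
  then obtain q' qs'' where q: "qs' = q' # qs''" by (cases qs') auto
  with Cons.prems have "q' = q" by simp
  with Cons.prems Cons.IH[of qs''] q show ?case by simp
qed

lemma sum_pieces_interior:
  "(\<Sum>ps\<in>pieces (u @ x # v) r. f ps) =
   (\<Sum>(ps, a, b, qs)\<in>interior_pieces u v r. f (ps @ (a @ x # b) # qs))"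
proof -
  let ?g = "\<lambda>(ps, a, b, qs). ps @ (a @ x # b) # qs"
  have "bij_betw ?g (interior_pieces u v r) (pieces (u @ x # v) r)"
    unfolding bij_betw_def
  proof
    show "inj_on ?g (interior_pieces u v r)"
    proof (rule inj_onI, simp only: split_paired_all prod.case)
      fix ps a b qs ps' a' b' qs'
      assume "(ps, a, b, qs) \<in> interior_pieces u v r" "(ps', a', b', qs') \<in> interior_pieces u v r"
        and eq: "ps @ (a @ x # b) # qs = ps' @ (a' @ x # b') # qs'"
      then have "concat ps @ a = concat ps' @ a'" by (simp add: interior_pieces_def)
      then have "length (concat ps @ a) = length (concat ps' @ a')" by (rule arg_cong)
      from append_Cons_inject[OF eq this]
      show "(ps, a, b, qs) = (ps', a', b', qs')" by simp
    qed
    show "?g ` interior_pieces u v r = pieces (u @ x # v) r"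
    proof (intro set_eqI iffI)
      fix ps assume "ps \<in> pieces (u @ x # v) r"
      then have ps: "concat ps = u @ x # v" "[] \<notin> set ps" "length ps = r"
        by (auto simp: pieces_def)
      from concat_eq_append_Cons[OF this(1)] obtain qs a b rs where
        "ps = qs @ (a @ x # b) # rs" "concat qs @ a = u" "b @ concat rs = v" by blast
      with ps show "ps \<in> ?g ` interior_pieces u v r"
        by (intro image_eqI[of _ _ "(qs, a, b, rs)"]) (auto simp: interior_pieces_def)
    qed (auto simp: interior_pieces_def pieces_def)
  qed
  from sum.reindex_bij_betw[OF this, of f] show ?thesis
    by (simp add: case_prod_unfold)
qed

lemma finite_interior_pieces [simp]: "finite (interior_pieces u v r)"
proof -
  \<comment> \<open>Any letter can fill the gap; \<open>undefined\<close> merely serves to embed the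
    quadruples into a finite set of pieces.\<close>
  have "inj_on (\<lambda>(ps, a, b, qs). ps @ (a @ undefined # b) # qs) (interior_pieces u v r)"
  proof (rule inj_onI, simp only: split_paired_all prod.case)
    fix ps a b qs ps' a' b' qs'
    assume "(ps, a, b, qs) \<in> interior_pieces u v r" "(ps', a', b', qs') \<in> interior_pieces u v r"
      and eq: "ps @ (a @ undefined # b) # qs = ps' @ (a' @ undefined # b') # qs'"
    then have "concat ps @ a = concat ps' @ a'" by (simp add: interior_pieces_def)
    then have "length (concat ps @ a) = length (concat ps' @ a')" by (rule arg_cong)
    from append_Cons_inject[OF eq this]
    show "(ps, a, b, qs) = (ps', a', b', qs')" by simp
  qed
  moreover have "(\<lambda>(ps, a, b, qs). ps @ (a @ undefined # b) # qs) ` interior_pieces u v r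
    \<subseteq> pieces (u @ undefined # v) r"
    by (auto simp: interior_pieces_def pieces_def)
  ultimately show ?thesis
    by (metis finite_imageD finite_pieces finite_subset)
qed

lemma finite_append_splits [simp]: "finite {(s, a). s @ a = w}"
proof -
  have "{(s, a). s @ a = w} \<subseteq> (\<lambda>i. (take i w, drop i w)) ` {..length w}"
  proof clarify
    fix s a assume "w = s @ a"
    show "(s, a) \<in> (\<lambda>i. (take i (s @ a), drop i (s @ a))) ` {..length (s @ a)}"
      by (rule image_eqI[of _ _ "length s"]) auto
  qed
  then show ?thesis by (rule finite_subset) simp
qed

text \<open>The selected part contains the marked letter, lies after it, or lies before it. When
  \<open>x\<close> is the result of a first insertion and the selected part is the place of a second
  one, these are the nested and the two disjoint configurations.\<close>

lemma sum_cuts_insert: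
  fixes u v :: "'e list"
  shows "(\<Sum>(s, p, t)\<in>cuts (u @ x # v). h s p t) =
   (\<Sum>(s, a)\<in>{(s, a). s @ a = u}. \<Sum>(b, t)\<in>{(b, t). b @ t = v}. h s (a @ x # b) t) +
   (\<Sum>(b, p, t)\<in>cuts v. h (u @ x # b) p t) +
   (\<Sum>(s, p, a)\<in>cuts u. h s p (a @ x # v))"
proof -
  let ?S1 = "{(s, a, b, t). s @ a = u \<and> b @ t = v}"
  let ?H = "\<lambda>(s, p, t). h s p t"
  let ?f1 = "\<lambda>(s, a, b, t). (s, a @ x # b, t)"
  let ?f2 = "\<lambda>(b, p, t). (u @ x # b, p, t)"
  let ?f3 = "\<lambda>(s, p, a). (s, p, a @ x # v)"
  have S1: "?S1 = (\<lambda>((s, a), (b, t)). (s, a, b, t)) ` ({(s, a). s @ a = u} \<times> {(b, t). b @ t = v})"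
    by (auto simp: image_iff)
  have finS1: "finite ?S1" unfolding S1 by (intro finite_imageI finite_cartesian_product finite_append_splits)
  have cuts: "cuts (u @ x # v) = (?f1 ` ?S1 \<union> ?f2 ` cuts v) \<union> ?f3 ` cuts u"
  proof (intro set_eqI iffI)
    fix z assume z: "z \<in> cuts (u @ x # v)"
    obtain s p t where [simp]: "z = (s, p, t)" by (cases z) auto
    \<comment> \<open>Reading the cut as three pieces lets \<open>concat_eq_append_Cons\<close>
      locate \<open>x\<close>; the length of \<open>qs\<close> tells which of the three contains
      it.\<close>
    from z have eq: "concat [s, p, t] = u @ x # v" and p: "p \<noteq> []" by (auto simp: cuts_def)
    from concat_eq_append_Cons[OF eq] obtain qs a b rs where
      q: "[s, p, t] = qs @ (a @ x # b) # rs" "concat qs @ a = u" "b @ concat rs = v" by blast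
    then consider "qs = []" | "qs = [s]" | "qs = [s, p]"
      by (cases qs; cases "tl qs"; cases "tl (tl qs)"; auto)
    then show "z \<in> (?f1 ` ?S1 \<union> ?f2 ` cuts v) \<union> ?f3 ` cuts u"
    proof cases
      case 1
      with q p have "z = ?f2 (b, p, t)" "(b, p, t) \<in> cuts v" by (auto simp: cuts_def)
      then show ?thesis by blast
    next
      case 2
      with q have "z = ?f1 (s, a, b, t)" "(s, a, b, t) \<in> ?S1" by auto
      then show ?thesis by blast
    next
      case 3
      with q p have "z = ?f3 (s, p, a)" "(s, p, a) \<in> cuts u" by (auto simp: cuts_def)
      then show ?thesis by blast
    qed
  qed (auto simp: cuts_def)
  have d1: "?f1 ` ?S1 \<inter> ?f2 ` cuts v = {}"
    by auto
  have d2: "(?f1 ` ?S1 \<union> ?f2 ` cuts v) \<inter> ?f3 ` cuts u = {}"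
  proof -
    \<comment> \<open>A part lying before \<open>x\<close> ends within \<open>u\<close>; the two
      other kinds end beyond it.\<close>
    have "length s + length p \<le> length u" if "(s, p, t) \<in> ?f3 ` cuts u" for s p t
      using that by (auto simp: cuts_def)
    moreover have "length s + length p > length u" if "(s, p, t) \<in> ?f1 ` ?S1 \<union> ?f2 ` cuts v" for s p t
      using that by (auto simp: cuts_def)
    ultimately show ?thesis
      by (intro equals0I, elim IntE) (metis not_less prod_cases3)
  qed
  have i1: "inj_on ?f1 ?S1" by (auto simp: inj_on_def)
  have i2: "inj_on ?f2 (cuts v)" by (auto simp: inj_on_def)
  have i3: "inj_on ?f3 (cuts u)" by (auto simp: inj_on_def)
  have "(\<Sum>(s, p, t)\<in>cuts (u @ x # v). h s p t) =
      (\<Sum>(s, a, b, t)\<in>?S1. h s (a @ x # b) t) + (\<Sum>(b, p, t)\<in>cuts v. h (u @ x # b) p t) +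
      (\<Sum>(s, p, a)\<in>cuts u. h s p (a @ x # v))"
  proof -
    have "sum ?H (cuts (u @ x # v)) = sum ?H (?f1 ` ?S1) + sum ?H (?f2 ` cuts v) + sum ?H (?f3 ` cuts u)"
      unfolding cuts by (subst sum.union_disjoint[OF _ _ d2], use finS1 in simp, simp,
        subst sum.union_disjoint[OF _ _ d1], use finS1 in simp, simp, rule refl)
    also have "sum ?H (?f1 ` ?S1) = (\<Sum>(s, a, b, t)\<in>?S1. h s (a @ x # b) t)"
      by (subst sum.reindex[OF i1]) (simp add: case_prod_unfold o_def)
    also have "sum ?H (?f2 ` cuts v) = (\<Sum>(b, p, t)\<in>cuts v. h (u @ x # b) p t)"
      by (subst sum.reindex[OF i2]) (simp add: case_prod_unfold o_def)
    also have "sum ?H (?f3 ` cuts u) = (\<Sum>(s, p, a)\<in>cuts u. h s p (a @ x # v))"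
      by (subst sum.reindex[OF i3]) (simp add: case_prod_unfold o_def)
    finally show ?thesis .
  qed
  also have "(\<Sum>(s, a, b, t)\<in>?S1. h s (a @ x # b) t) =
     (\<Sum>(s, a)\<in>{(s, a). s @ a = u}. \<Sum>(b, t)\<in>{(b, t). b @ t = v}. h s (a @ x # b) t)"
  proof -
    have "(\<Sum>(s, a, b, t)\<in>?S1. h s (a @ x # b) t) =
        (\<Sum>((s, a), (b, t))\<in>{(s, a). s @ a = u} \<times> {(b, t). b @ t = v}. h s (a @ x # b) t)"
      by (rule sum.reindex_bij_witness[where i = "\<lambda>((s, a), (b, t)). (s, a, b, t)"
          and j = "\<lambda>(s, a, b, t). ((s, a), (b, t))"]) auto
    then show ?thesis by (simp add: sum.cartesian_product case_prod_unfold)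
  qed
  finally show ?thesis .
qed

section \<open>Composable sequences as paths\<close>

text \<open>
  A composable pair \<open>(xs, vs)\<close> of objects and vectors is stored as a list of edges (source, target, vector),
  so that splitting \<open>xs\<close> and \<open>vs\<close> at shared objects becomes splitting one list.
\<close>

type_synonym ('o, 'v) edge = "'o \<times> 'o \<times> 'v helem"

abbreviation src :: "('o, 'v) edge \<Rightarrow> 'o" where "src e \<equiv> fst e"
abbreviation tgt :: "('o, 'v) edge \<Rightarrow> 'o" where "tgt e \<equiv> fst (snd e)"

text \<open>Only the last target is read. Along a \<open>chained\<close> list every other target is
  the next source, so no object is lost.\<close>

definition objs :: "('o, 'v) edge list \<Rightarrow> 'o list" where
  "objs w = map fst w @ [tgt (last w)]"

definition vals :: "('o, 'v) edge list \<Rightarrow> 'v helem list" where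
  "vals w = map (\<lambda>e. snd (snd e)) w"

definition wdeg :: "('o, 'v) edge list \<Rightarrow> int" where
  "wdeg w = deg_sum (vals w)"

definition chained :: "('o, 'v) edge list \<Rightarrow> bool" where
  "chained w \<longleftrightarrow> w \<noteq> [] \<and> successively (\<lambda>e f. tgt e = src f) w"

text \<open>The stored degree \<open>d\<close> is the one in \<open>A[1]\<close>, whose degree
  \<open>d\<close> part is the degree \<open>1 + d\<close> part of the morphism space.\<close>

definition edges :: "('k, 'o, 'v) quiver \<Rightarrow> ('o, 'v) edge set" where
  "edges A = {(x, y, d, v). x \<in> Obj A \<and> y \<in> Obj A \<and> v \<in> Hom A x y (1 + d)}"

definition path :: "('k, 'o, 'v) quiver \<Rightarrow> ('o, 'v) edge list \<Rightarrow> bool" where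
  "path A w \<longleftrightarrow> chained w \<and> set w \<subseteq> edges A"

definition ev :: "('o, 'v, 'w) family \<Rightarrow> ('o, 'v) edge list \<Rightarrow> 'w" where
  "ev F w = F (objs w) (vals w)"

text \<open>Contracts a piece of a path to the single edge carrying the value of \<open>F\<close> on
  it. With \<open>id\<close> for the object map this is the insertion of an operation of the quiver
  itself.\<close>

definition app :: "('o \<Rightarrow> 'p) \<Rightarrow> ('o, 'v, 'w) family helem \<Rightarrow> ('o, 'v) edge list \<Rightarrow> ('p, 'w) edge" where
  "app \<Phi> F p = (\<Phi> (src (hd p)), \<Phi> (tgt (last p)), fst F + wdeg p, ev (snd F) p)"

lemma vals_simps [simp]:
  "vals [] = []" "vals (e # w) = snd (snd e) # vals w" "vals (u @ w) = vals u @ vals w"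
  "length (vals w) = length w"
  by (simp_all add: vals_def)

lemma vals_take: "vals (take n w) = take n (vals w)" and vals_drop: "vals (drop n w) = drop n (vals w)"
  by (simp_all add: vals_def take_map drop_map)

lemma wdeg_simps [simp]:
  "wdeg [] = 0" "wdeg (e # w) = fst (snd (snd e)) + wdeg w" "wdeg (u @ w) = wdeg u + wdeg w"
  by (simp_all add: wdeg_def)

lemma app_simps [simp]:
  "src (app \<Phi> F p) = \<Phi> (src (hd p))" "tgt (app \<Phi> F p) = \<Phi> (tgt (last p))"
  "snd (snd (app \<Phi> F p)) = (fst F + wdeg p, ev (snd F) p)"
  by (simp_all add: app_def)

lemma length_objs [simp]: "length (objs w) = Suc (length w)"
  by (simp add: objs_def)

lemma hd_objs: "w \<noteq> [] \<Longrightarrow> hd (objs w) = src (hd w)" and last_objs: "last (objs w) = tgt (last w)"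
  by (simp_all add: objs_def hd_append hd_map)

lemma chained_append:
  "u \<noteq> [] \<Longrightarrow> w \<noteq> [] \<Longrightarrow> chained (u @ w) \<longleftrightarrow> chained u \<and> chained w \<and> tgt (last u) = src (hd w)"
  by (auto simp: chained_def successively_append_iff)

lemma path_append:
  "u \<noteq> [] \<Longrightarrow> w \<noteq> [] \<Longrightarrow> path A (u @ w) \<longleftrightarrow> path A u \<and> path A w \<and> tgt (last u) = src (hd w)"
  by (auto simp: path_def chained_append)

lemma path_nonempty: "path A w \<Longrightarrow> w \<noteq> []"
  by (auto simp: path_def chained_def)

lemma path_middle: "path A (u @ p @ v) \<Longrightarrow> p \<noteq> [] \<Longrightarrow> path A p"
  by (cases "u = []"; cases "v = []") (auto simp: path_append)

lemma path_single: "path A [e] \<longleftrightarrow> e \<in> edges A"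
  by (simp add: path_def chained_def)

lemma path_replace:
  assumes "path A (u @ p @ v)" "p \<noteq> []" "path A q"
    and "src (hd q) = src (hd p)" "tgt (last q) = tgt (last p)"
  shows "path A (u @ q @ v)"
  using assms path_nonempty[OF assms(3)]
  by (cases "u = []"; cases "v = []") (auto simp: path_append)

lemma objs_replace:
  assumes "chained (u @ p @ v)" "p \<noteq> []" "src e = src (hd p)" "tgt e = tgt (last p)"
  shows "objs (u @ e # v) = take (length u + 1) (objs (u @ p @ v)) @ drop (length u + length p) (objs (u @ p @ v))"
proof -
  have "map fst p ! 0 = src e" using assms by (simp add: hd_conv_nth)
  then have "take (Suc 0) (map fst p) = [src e]"
    using assms(2) by (cases p) auto
  then show ?thesis
    using assms by (cases p; cases "v = []") (auto simp: objs_def)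
qed

text \<open>A piece has one object more than edges. In the whole list its final object is stored as
  the source of the following edge, whence the chaining assumption.\<close>

lemma objs_middle:
  assumes "chained (u @ p @ v)" "p \<noteq> []"
  shows "take (length p + 1) (drop (length u) (objs (u @ p @ v))) = objs p"
proof (cases v)
  case (Cons e v')
  with assms have "tgt (last p) = src e"
    by (cases "u = []") (auto simp: chained_append)
  with Cons show ?thesis by (simp add: objs_def)
qed (use assms in \<open>simp add: objs_def\<close>)

lemma objs_nth: "i < length w \<Longrightarrow> objs w ! i = src (w ! i)"
  by (simp add: objs_def nth_append)

lemma objs_nth_Suc:
  assumes "chained w" "i < length w"
  shows "objs w ! Suc i = tgt (w ! i)"
proof (cases "Suc i = length w")
  case True
  then have "last w = w ! i" using assms by (metis chained_def diff_Suc_1 last_conv_nth)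
  with True show ?thesis by (simp add: objs_def nth_append)
next
  case False
  then show ?thesis
    using assms by (auto simp: objs_nth chained_def successively_conv_nth)
qed

lemma path_iff_composable: "chained w \<Longrightarrow> path A w \<longleftrightarrow> composable A (objs w) (vals w)"
proof
  assume c: "chained w" and "path A w"
  then have *: "set w \<subseteq> edges A" by (simp add: path_def)
  have ne: "w \<noteq> []" using c by (simp add: chained_def)
  then have "last w \<in> edges A" using * by auto
  then have "set (objs w) \<subseteq> Obj A" using * by (auto simp: objs_def edges_def)
  moreover have "length (objs w) \<ge> 2" using ne by (cases w) auto
  moreover have "list_all2 (\<lambda>V v. snd v \<in> V (fst v)) (factors A (objs w)) (vals w)"
  proof (rule list_all2_all_nthI)
    fix i assume "i < length (factors A (objs w))"
    then have i: "i < length w" by (simp add: factors_def)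
    then have "w ! i \<in> edges A" using * nth_mem by blast
    then show "snd (vals w ! i) \<in> (factors A (objs w) ! i) (fst (vals w ! i))"
      using i by (auto simp: factors_def shift_def objs_nth objs_nth_Suc[OF c] vals_def edges_def)
  qed (simp add: factors_def)
  ultimately show "composable A (objs w) (vals w)"
    by (simp add: composable_def obj_seqs_def htuples_def)
next
  assume c: "chained w" and comp: "composable A (objs w) (vals w)"
  have "set w \<subseteq> edges A"
  proof
    fix e assume "e \<in> set w"
    then obtain i where i: "i < length w" "w ! i = e" by (auto simp: in_set_conv_nth)
    from comp have "snd (vals w ! i) \<in> (factors A (objs w) ! i) (fst (vals w ! i))"
      using i by (auto simp: composable_def htuples_def list_all2_conv_all_nth)
    then have "snd (snd (snd e)) \<in> Hom A (src e) (tgt e) (1 + fst (snd (snd e)))"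
      using i by (auto simp: factors_def shift_def objs_nth objs_nth_Suc[OF c] vals_def)
    moreover have "set (objs w) \<subseteq> Obj A" using comp by (simp add: composable_def obj_seqs_def)
    then have "objs w ! i \<in> Obj A" "objs w ! Suc i \<in> Obj A"
      using nth_mem[of i "objs w"] nth_mem[of "Suc i" "objs w"] i by auto
    ultimately show "e \<in> edges A"
      using i by (auto simp: objs_nth objs_nth_Suc[OF c] edges_def)
  qed
  with c show "path A w" by (simp add: path_def)
qed

lemma composable_chained:
  assumes "composable A xs vs"
  obtains w where "chained w" "objs w = xs" "vals w = vs"
proof -
  from assms have len: "length xs = Suc (length vs)" "vs \<noteq> []"
    by (auto simp: composable_def obj_seqs_def htuples_def factors_def dest: list_all2_lengthD)
  have "\<exists>w. chained w \<and> objs w = xs \<and> vals w = vs"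
    using len(2,1)
  proof (induction vs arbitrary: xs rule: list_nonempty_induct)
    case (single v)
    then obtain x y where "xs = [x, y]" by (auto simp: length_Suc_conv)
    then show ?case by (intro exI[of _ "[(x, y, v)]"]) (simp add: chained_def objs_def)
  next
    case (cons v vs)
    then obtain x xs' where xs: "xs = x # xs'" "length xs' = Suc (length vs)"
      by (auto simp: length_Suc_conv)
    with cons.IH obtain w where w: "chained w" "objs w = xs'" "vals w = vs" by blast
    then have "w \<noteq> []" by (simp add: chained_def)
    then have "chained ([(x, hd xs', v)] @ w)"
      using w by (subst chained_append) (auto simp: chained_def hd_objs)
    moreover have "objs ([(x, hd xs', v)] @ w) = xs" "vals ([(x, hd xs', v)] @ w) = v # vs"
      using w xs \<open>w \<noteq> []\<close> by (auto simp: objs_def)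
    ultimately show ?case by blast
  qed
  then show ?thesis using that by blast
qed

lemma composable_path:
  assumes "composable A xs vs"
  obtains w where "path A w" "objs w = xs" "vals w = vs"
  using assms by (metis composable_chained path_iff_composable)

lemma path_composable: "path A w \<Longrightarrow> composable A (objs w) (vals w)"
  using path_iff_composable path_def by blast

text \<open>Every composable pair comes from a path, so \<open>ev\<close> sees all relevant values;
  on all other arguments both functions have to be pinned to \<open>0\<close>.\<close>

lemma family_eqI:
  assumes "\<And>w. path A w \<Longrightarrow> ev F w = ev G w"
    and "\<And>xs vs. \<not> composable A xs vs \<Longrightarrow> F xs vs = 0"
    and "\<And>xs vs. \<not> composable A xs vs \<Longrightarrow> G xs vs = 0"
  shows "F = G"
proof (intro ext)
  fix xs vs
  show "F xs vs = G xs vs"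
  proof (cases "composable A xs vs")
    case True
    then obtain w where "path A w" "objs w = xs" "vals w = vs" by (rule composable_path)
    then show ?thesis using assms(1)[of w] by (simp add: ev_def)
  qed (use assms in simp)
qed

text \<open>The index pair \<open>(i, k)\<close> becomes the cut at these positions:
  \<open>objs_replace\<close> identifies the objects seen by the outer map,
  \<open>objs_middle\<close> those seen by \<open>m\<close>.\<close>

lemma gerstenhaber_path:
  assumes "path A w"
  shows "ev (gerstenhaber A B F m) w =
    (\<Sum>(u, p, v)\<in>cuts w. Scale B ((-1) powi (fst m * wdeg u)) (ev F (u @ app id m p # v)))"
proof -
  have "Scale B ((-1) powi (fst m * deg_sum (take i (vals w))))
            (F (take (i + 1) (objs w) @ drop (i + k) (objs w))
               (take i (vals w) @
                (fst m + deg_sum (take k (drop i (vals w))),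
                 snd m (take (k + 1) (drop i (objs w))) (take k (drop i (vals w)))) #
                drop (i + k) (vals w))) =
     Scale B ((-1) powi (fst m * wdeg (take i w)))
       (ev F (take i w @ app id m (take k (drop i w)) # drop (i + k) w))"
    if "1 \<le> k" "i + k \<le> length w" for i k
  proof -
    let ?u = "take i w" and ?p = "take k (drop i w)" and ?v = "drop (i + k) w"
    have w: "?u @ ?p @ ?v = w" by (rule take_drop_split)
    have c: "chained (?u @ ?p @ ?v)" using assms w by (simp add: path_def)
    have p: "?p \<noteq> []" using that by auto
    have lens: "length ?u = i" "length ?p = k" using that by auto
    have "objs (?u @ app id m ?p # ?v) = take (i + 1) (objs w) @ drop (i + k) (objs w)"
      using objs_replace[OF c p, of "app id m ?p"] w lens by simp
    moreover have "objs ?p = take (k + 1) (drop i (objs w))"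
      using objs_middle[OF c p] w lens by simp
    ultimately show ?thesis
      by (simp add: ev_def vals_take vals_drop wdeg_def)
  qed
  then show ?thesis
    unfolding sum_cuts using path_composable[OF assms]
    by (subst ev_def) (auto simp: gerstenhaber_def intro!: sum.cong)
qed

text \<open>The exponent of the Koszul sign of \<open>F\<^sub>1 \<otimes> \<dots> \<otimes> F\<^sub>r\<close> evaluated on the pieces \<open>p\<^sub>1, \<dots>, p\<^sub>r\<close>.\<close>

fun eval_sign :: "'l helem list \<Rightarrow> ('o, 'v) edge list list \<Rightarrow> int" where
  "eval_sign (F # Fs) (p # ps) = wdeg p * deg_sum Fs + eval_sign Fs ps"
| "eval_sign _ _ = 0"

text \<open>Double counting: the right side charges each operation with the inputs before its piece,
  the recursion charges each piece with the operations after its own.\<close>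

lemma eval_sign_eq: "length Fs = length ps \<Longrightarrow>
  eval_sign Fs ps = (\<Sum>j<length Fs. fst (Fs ! j) * wdeg (concat (take j ps)))"
proof (induction Fs ps rule: list_induct2)
  case (Cons F Fs p ps)
  have "(\<Sum>j<length (F # Fs). fst ((F # Fs) ! j) * wdeg (concat (take j (p # ps)))) =
      (\<Sum>j<length Fs. fst (Fs ! j) * (wdeg p + wdeg (concat (take j ps))))"
    by (simp add: sum.lessThan_Suc_shift del: sum.lessThan_Suc)
  also have "\<dots> = wdeg p * (\<Sum>j<length Fs. fst (Fs ! j)) + (\<Sum>j<length Fs. fst (Fs ! j) * wdeg (concat (take j ps)))"
    by (simp add: algebra_simps sum.distrib sum_distrib_left)
  also have "(\<Sum>j<length Fs. fst (Fs ! j)) = deg_sum Fs"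
    by (simp add: sum_list_sum_nth atLeast0LessThan)
  finally show ?case using Cons by simp
qed simp

lemma eval_sign_append: "length Fs = length ps \<Longrightarrow>
  eval_sign (Fs @ Gs) (ps @ qs) = eval_sign Fs ps + eval_sign Gs qs + wdeg (concat ps) * deg_sum Gs"
  by (induction Fs ps rule: list_induct2) (auto simp: algebra_simps)

lemma multi_comp_path:
  assumes w: "path A w"
  shows "ev (multi_comp A B \<Phi> m Fs) w =
    (\<Sum>ps\<in>pieces w (length Fs). Scale B ((-1) powi eval_sign Fs ps) (ev m (map2 (app \<Phi>) Fs ps)))"
proof -
  let ?r = "length Fs"
  let ?t = "\<lambda>ns. Scale B ((-1) powi (\<Sum>j<?r. fst (Fs ! j) * deg_sum (take (cut ns j) (vals w))))
            (m (map (\<lambda>j. \<Phi> (objs w ! cut ns j)) [0..<?r + 1])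
               (map (\<lambda>j. let us = take (ns ! j) (drop (cut ns j) (vals w));
                             ys = take (ns ! j + 1) (drop (cut ns j) (objs w))
                         in (fst (Fs ! j) + deg_sum us, snd (Fs ! j) ys us))
                    [0..<?r]))"
  have "?t (map length ps) = Scale B ((-1) powi eval_sign Fs ps) (ev m (map2 (app \<Phi>) Fs ps))"
    if "ps \<in> pieces w ?r" for ps
  proof -
    have ps: "concat ps = w" "[] \<notin> set ps" "length ps = ?r" using that by (auto simp: pieces_def)
    have ne: "ps \<noteq> []" using ps(1) w path_nonempty by fastforce
    have cut: "cut (map length ps) j = length (concat (take j ps))" for j
      by (simp add: cut_def length_concat take_map)
    have split: "w = concat (take j ps) @ ps ! j @ concat (drop (Suc j) ps)" "ps ! j \<noteq> []" if "j < ?r" for j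
      using that ps by (metis id_take_nth_drop concat.simps(2) concat_append, metis nth_mem)
    have c: "chained w" using w by (simp add: path_def)
    have o: "take (length (ps ! j) + 1) (drop (length (concat (take j ps))) (objs w)) = objs (ps ! j)"
      if "j < ?r" for j
      using objs_middle[of "concat (take j ps)" "ps ! j" "concat (drop (Suc j) ps)"] split[OF that] c
      by simp
    have v: "take (length (ps ! j)) (drop (length (concat (take j ps))) (vals w)) = vals (ps ! j)"
      if "j < ?r" for j
      by (subst split(1)[OF that]) simp
    have d: "deg_sum (take (length (concat (take j ps))) (vals w)) = wdeg (concat (take j ps))"
      if "j < ?r" for j
      by (subst split(1)[OF that]) (simp add: wdeg_def)
    have s: "objs w ! length (concat (take j ps)) = src (hd (ps ! j))" if "j < ?r" for j
      by (subst split(1)[OF that]) (use split(2)[OF that] in \<open>cases "ps ! j"; simp add: objs_def nth_append\<close>)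
    have m2: "map2 (app \<Phi>) Fs ps = map (\<lambda>j. app \<Phi> (Fs ! j) (ps ! j)) [0..<?r]"
      using ps by (intro nth_equalityI) auto
    have "last ps \<noteq> []" using ps ne by (metis last_in_set)
    then have l: "last w = last (last ps)"
      using ps(1) ne by (metis append_butlast_last_id concat_append concat.simps last_appendR append_Nil2)
    have objs: "map (\<lambda>j. \<Phi> (objs w ! cut (map length ps) j)) [0..<?r + 1] = objs (map2 (app \<Phi>) Fs ps)"
    proof (rule nth_equalityI)
      fix j assume "j < length (map (\<lambda>j. \<Phi> (objs w ! cut (map length ps) j)) [0..<?r + 1])"
      then consider "j < ?r" | "j = ?r" by fastforce
      then show "map (\<lambda>j. \<Phi> (objs w ! cut (map length ps) j)) [0..<?r + 1] ! j = objs (map2 (app \<Phi>) Fs ps) ! j"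
      proof cases
        case 1
        then show ?thesis using s[OF 1]
          by (simp add: m2 objs_nth cut nth_append del: upt_Suc)
      next
        case 2
        \<comment> \<open>The final object is not the source of any piece; it is the target of the
          last one.\<close>
        have r: "?r \<noteq> 0" using ps ne by auto
        have "objs w ! length w = tgt (last w)" by (simp add: objs_def nth_append)
        moreover have "ps ! (?r - 1) = last ps" using ps ne by (simp add: last_conv_nth)
        moreover have "last (map2 (app \<Phi>) Fs ps) = app \<Phi> (Fs ! (?r - 1)) (ps ! (?r - 1))"
          unfolding m2 using r by (simp add: last_map)
        ultimately show ?thesis using 2 ps l
          by (simp add: cut objs_def nth_append del: upt_Suc)
      qed
    qed (use ps in simp)
    have vals: "(map (\<lambda>j. let us = take (map length ps ! j) (drop (cut (map length ps) j) (vals w));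
                             ys = take (map length ps ! j + 1) (drop (cut (map length ps) j) (objs w))
                         in (fst (Fs ! j) + deg_sum us, snd (Fs ! j) ys us))
                    [0..<?r]) = vals (map2 (app \<Phi>) Fs ps)"
      unfolding m2 using ps o v by (auto simp: vals_def cut Let_def ev_def wdeg_def)
    have "(\<Sum>j<?r. fst (Fs ! j) * deg_sum (take (cut (map length ps) j) (vals w))) = eval_sign Fs ps"
      using ps d by (simp add: eval_sign_eq cut)
    then show ?thesis unfolding objs vals ev_def by simp
  qed
  then have "(\<Sum>ps\<in>pieces w ?r. ?t (map length ps)) =
      (\<Sum>ps\<in>pieces w ?r. Scale B ((-1) powi eval_sign Fs ps) (ev m (map2 (app \<Phi>) Fs ps)))"
    by (rule sum.cong[OF refl])
  moreover have "ev (multi_comp A B \<Phi> m Fs) w = sum ?t (compositions (length w) ?r)"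
    using path_composable[OF w] by (subst ev_def) (simp add: multi_comp_def)
  ultimately show ?thesis
    by (simp only: compositions_eq sum.reindex[OF inj_on_pieces] o_def)
qed

section \<open>Multilinearity along paths\<close>

text \<open>One law covers additivity, with both scalars \<open>1\<close>, and homogeneity, with
  second scalar \<open>0\<close>.\<close>

definition slot_linear ::
  "('k::field, 'o, 'v::ab_group_add) quiver \<Rightarrow> ('k, 'p, 'w::ab_group_add) quiver \<Rightarrow> ('o, 'v, 'w) family \<Rightarrow> bool" where
  "slot_linear A B F \<longleftrightarrow> (\<forall>u x y d v v' w c c'.
     path A (u @ (x, y, d, v) # w) \<longrightarrow> path A (u @ (x, y, d, v') # w) \<longrightarrow>
     ev F (u @ (x, y, d, Scale A c v + Scale A c' v') # w) =
     Scale B c (ev F (u @ (x, y, d, v) # w)) + Scale B c' (ev F (u @ (x, y, d, v') # w)))"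

lemma objs_change_val: "objs (u @ (x, y, h) # w) = objs (u @ (x, y, h') # w)"
  by (cases w) (simp_all add: objs_def)

lemma chained_change_val: "chained (u @ (x, y, h) # w) \<longleftrightarrow> chained (u @ (x, y, h') # w)"
  unfolding chained_def by (cases w; simp add: successively_append_iff)

lemma path_change_val:
  assumes "path A (u @ (x, y, d, v) # w)" "v' \<in> Hom A x y (1 + d)"
  shows "path A (u @ (x, y, d, v') # w)"
  using assms chained_change_val[of u x y "(d, v)" w "(d, v')"]
  by (auto simp: path_def edges_def)

lemma path_slot_mem: "path A (u @ (x, y, d, v) # w) \<Longrightarrow> v \<in> Hom A x y (1 + d)"
  by (auto simp: path_def edges_def)

lemma chained_slot:
  assumes "chained w" "vals w = us @ h # ws"
  obtains u x y w' where "w = u @ (x, y, h) # w'" "vals u = us" "vals w' = ws"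
proof -
  from assms(2) obtain u r where *: "w = u @ r" "vals u = us" "vals r = h # ws"
    unfolding vals_def by (auto simp: map_eq_append_conv)
  from *(3) obtain e w' where "r = e # w'" "snd (snd e) = h" "vals w' = ws"
    by (cases r) auto
  with * that[of u "fst e" "fst (snd e)" w'] show ?thesis by (metis prod.collapse)
qed

text \<open>It is also interpreted with a single quiver and the identity map, so that the facts
  about families apply to \<open>mA\<close> and \<open>mB\<close> themselves.\<close>

locale quiver_map =
  fixes A :: "('k::field, 'o, 'v::ab_group_add) quiver"
    and B :: "('k, 'p, 'w::ab_group_add) quiver"
    and \<Phi> :: "'o \<Rightarrow> 'p"
  assumes quiver_A: "graded_quiver A" and quiver_B: "graded_quiver B"
    and obj_map: "\<Phi> \<in> Obj A \<rightarrow> Obj B"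
begin

sublocale SA: vector_space "Scale A"
  using quiver_A by (simp add: graded_quiver_def)

sublocale SB: vector_space "Scale B"
  using quiver_B by (simp add: graded_quiver_def)

lemma subspace_A: "x \<in> Obj A \<Longrightarrow> y \<in> Obj A \<Longrightarrow> SA.subspace (Hom A x y i)"
  using quiver_A by (simp add: graded_quiver_def graded_space_def)

lemma subspace_B: "x \<in> Obj B \<Longrightarrow> y \<in> Obj B \<Longrightarrow> SB.subspace (Hom B x y i)"
  using quiver_B by (simp add: graded_quiver_def graded_space_def)

lemma path_slot_subspace: "path A (u @ (x, y, d, v) # w) \<Longrightarrow> SA.subspace (Hom A x y (1 + d))"
  by (rule subspace_A) (auto simp: path_def edges_def)

lemma path_ends: "path A w \<Longrightarrow> src (hd w) \<in> Obj A \<and> tgt (last w) \<in> Obj A"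
proof -
  assume "path A w"
  then have "hd w \<in> edges A" "last w \<in> edges A"
    using path_nonempty[of A w] hd_in_set[of w] last_in_set[of w] by (auto simp: path_def)
  then show ?thesis by (auto simp: edges_def)
qed

lemma path_subspace: "path A w \<Longrightarrow> SB.subspace (Hom B (\<Phi> (src (hd w))) (\<Phi> (tgt (last w))) i)"
  using path_ends obj_map by (intro subspace_B) auto

text \<open>The homogeneous inputs over a fixed object sequence are exactly the paths with these
  objects, and changing one vector inside its morphism space leaves the objects alone. So
  multilinearity of all components is linearity in each slot along paths.\<close>

lemma Cspace_iff:
  "F \<in> Cspace A B \<Phi> d \<longleftrightarrow>
    (\<forall>w. path A w \<longrightarrow> ev F w \<in> Hom B (\<Phi> (src (hd w))) (\<Phi> (tgt (last w))) (wdeg w + d)) \<and>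
    slot_linear A B F \<and> (\<forall>xs vs. \<not> composable A xs vs \<longrightarrow> F xs vs = 0)"
proof (intro iffI conjI allI impI)
  assume F: "F \<in> Cspace A B \<Phi> d"
  then have ml: "graded_multilinear (Scale A) (Scale B) (factors A xs) (Hom B (\<Phi> (hd xs)) (\<Phi> (last xs))) d (F xs)"
    if "xs \<in> obj_seqs A" for xs
    using that by (simp add: Cspace_def graded_hom_def)
  show "ev F w \<in> Hom B (\<Phi> (src (hd w))) (\<Phi> (tgt (last w))) (wdeg w + d)" if "path A w" for w
    using path_composable[OF that] ml[of "objs w"] path_nonempty[OF that]
    by (simp add: composable_def graded_multilinear_def ev_def hd_objs last_objs wdeg_def)
  show "F xs vs = 0" if "\<not> composable A xs vs" for xs vs
    using F that by (cases "xs \<in> obj_seqs A") (auto simp: Cspace_def graded_hom_def composable_def)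
  show "slot_linear A B F"
    unfolding slot_linear_def
  proof (intro allI impI)
    fix u x y e v v' w c c'
    assume p: "path A (u @ (x, y, e, v) # w)" and p': "path A (u @ (x, y, e, v') # w)"
    let ?xs = "objs (u @ (x, y, e, v) # w)"
    have ht: "vals u @ (e, v'') # vals w \<in> htuples (factors A ?xs)" if "path A (u @ (x, y, e, v'') # w)" for v''
      using path_composable[OF that] objs_change_val[of u x y "(e, v)" w "(e, v'')"]
      by (simp add: composable_def)
    have xs: "?xs \<in> obj_seqs A" using path_composable[OF p] by (simp add: composable_def)
    have S: "SA.subspace (Hom A x y (1 + e))" using p by (rule path_slot_subspace)
    have cp: "path A (u @ (x, y, e, Scale A c v) # w)" "path A (u @ (x, y, e, Scale A c' v') # w)"
      using SA.subspace_scale[OF S] path_slot_mem[OF p] path_slot_mem[OF p'] path_change_val[OF p]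
      by auto
    have evx: "ev F (u @ (x, y, e, v'') # w) = F ?xs (vals u @ (e, v'') # vals w)" for v''
      using objs_change_val[of u x y "(e, v)" w "(e, v'')"] by (simp add: ev_def)
    show "ev F (u @ (x, y, e, Scale A c v + Scale A c' v') # w) =
      Scale B c (ev F (u @ (x, y, e, v) # w)) + Scale B c' (ev F (u @ (x, y, e, v') # w))"
      unfolding evx using ml[OF xs] ht[OF p] ht[OF p'] ht[OF cp(1)] ht[OF cp(2)]
      unfolding graded_multilinear_def by metis
  qed
next
  assume *: "(\<forall>w. path A w \<longrightarrow> ev F w \<in> Hom B (\<Phi> (src (hd w))) (\<Phi> (tgt (last w))) (wdeg w + d)) \<and>
    slot_linear A B F \<and> (\<forall>xs vs. \<not> composable A xs vs \<longrightarrow> F xs vs = 0)"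
  have "graded_multilinear (Scale A) (Scale B) (factors A xs) (Hom B (\<Phi> (hd xs)) (\<Phi> (last xs))) d (F xs)"
    if xs: "xs \<in> obj_seqs A" for xs
    unfolding graded_multilinear_def
  proof (intro conjI ballI allI impI)
    fix vs assume "vs \<in> htuples (factors A xs)"
    then obtain w where w: "path A w" "objs w = xs" "vals w = vs"
      using composable_path[of A xs vs] xs by (auto simp: composable_def)
    then show "F xs vs \<in> Hom B (\<Phi> (hd xs)) (\<Phi> (last xs)) (deg_sum vs + d)"
      using * path_nonempty[OF w(1)] hd_objs[of w] last_objs[of w] by (auto simp: ev_def wdeg_def)
  next
    fix us e v v' ws
    assume ht: "us @ (e, v) # ws \<in> htuples (factors A xs)" "us @ (e, v') # ws \<in> htuples (factors A xs)"
    then obtain w where w: "path A w" "objs w = xs" "vals w = us @ (e, v) # ws"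
      using composable_path[of A xs "us @ (e, v) # ws"] xs by (auto simp: composable_def)
    from w(1) have "chained w" by (simp add: path_def)
    with w(3) obtain u x y w' where u: "w = u @ (x, y, e, v) # w'" "vals u = us" "vals w' = ws"
      by (metis chained_slot)
    have o: "objs (u @ (x, y, e, v'') # w') = xs" for v''
      using w(2) u(1) objs_change_val by metis
    have "composable A (objs (u @ (x, y, e, v') # w')) (vals (u @ (x, y, e, v') # w'))"
      using ht(2) xs u o by (simp add: composable_def)
    then have p': "path A (u @ (x, y, e, v') # w')"
      using path_iff_composable chained_change_val \<open>chained w\<close> u(1) by metis
    have "ev F (u @ (x, y, e, Scale A 1 v + Scale A 1 v') # w') =
      Scale B 1 (ev F (u @ (x, y, e, v) # w')) + Scale B 1 (ev F (u @ (x, y, e, v') # w'))"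
      using * p' w(1) unfolding u(1) slot_linear_def by blast
    then show "F xs (us @ (e, v + v') # ws) = F xs (us @ (e, v) # ws) + F xs (us @ (e, v') # ws)"
      by (simp add: ev_def o u)
  next
    fix us e v ws c
    assume ht: "us @ (e, v) # ws \<in> htuples (factors A xs)"
    then obtain w where w: "path A w" "objs w = xs" "vals w = us @ (e, v) # ws"
      using composable_path[of A xs "us @ (e, v) # ws"] xs by (auto simp: composable_def)
    from w(1) have "chained w" by (simp add: path_def)
    with w(3) obtain u x y w' where u: "w = u @ (x, y, e, v) # w'" "vals u = us" "vals w' = ws"
      by (metis chained_slot)
    have o: "objs (u @ (x, y, e, v'') # w') = xs" for v''
      using w(2) u(1) objs_change_val by metis
    have "ev F (u @ (x, y, e, Scale A c v + Scale A 0 v) # w') =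
      Scale B c (ev F (u @ (x, y, e, v) # w')) + Scale B 0 (ev F (u @ (x, y, e, v) # w'))"
      using * w(1) unfolding u(1) slot_linear_def by blast
    then show "F xs (us @ (e, Scale A c v) # ws) = Scale B c (F xs (us @ (e, v) # ws))"
      by (simp add: ev_def o u)
  qed
  then show "F \<in> Cspace A B \<Phi> d"
    using * by (auto simp: Cspace_def graded_hom_def composable_def fun_eq_iff)
qed

lemma slot_linearD:
  assumes "F \<in> Cspace A B \<Phi> d" "path A (u @ (x, y, e, v) # w)" "path A (u @ (x, y, e, v') # w)"
  shows "ev F (u @ (x, y, e, Scale A c v + Scale A c' v') # w) =
     Scale B c (ev F (u @ (x, y, e, v) # w)) + Scale B c' (ev F (u @ (x, y, e, v') # w))"
  using assms unfolding Cspace_iff slot_linear_def by blast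

lemma slot_zero:
  assumes "F \<in> Cspace A B \<Phi> d" "path A (u @ (x, y, e, v) # w)"
  shows "ev F (u @ (x, y, e, 0) # w) = 0"
  using slot_linearD[OF assms assms(2), of 0 0] by simp

text \<open>Induction on the index set; each partial sum has to stay in the morphism space for the
  two-term law to apply again.\<close>

lemma slot_sum:
  assumes F: "F \<in> Cspace A B \<Phi> d" and p: "path A (u @ (x, y, e, v) # w)"
    and g: "\<And>i. i \<in> I \<Longrightarrow> g i \<in> Hom A x y (1 + e)"
  shows "ev F (u @ (x, y, e, \<Sum>i\<in>I. Scale A (c i) (g i)) # w) =
     (\<Sum>i\<in>I. Scale B (c i) (ev F (u @ (x, y, e, g i) # w)))"
  using g
proof (induction I rule: infinite_finite_induct)
  case (insert i I)
  have S: "SA.subspace (Hom A x y (1 + e))" using p by (rule path_slot_subspace)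
  have "(\<Sum>i\<in>I. Scale A (c i) (g i)) \<in> Hom A x y (1 + e)"
    using insert.prems by (intro SA.subspace_sum[OF S] SA.subspace_scale[OF S]) auto
  with slot_linearD[OF F path_change_val[OF p] path_change_val[OF p], of "g i" _ "c i" 1]
  show ?case using insert by simp
qed (use slot_zero[OF F p] in simp_all)

lemma Cspace_mem: "F \<in> Cspace A B \<Phi> d \<Longrightarrow> path A w \<Longrightarrow>
   ev F w \<in> Hom B (\<Phi> (src (hd w))) (\<Phi> (tgt (last w))) (wdeg w + d)"
  by (simp add: Cspace_iff)

text \<open>The recorded degree is that in the shifted space, hence the underlying family has degree
  one more.\<close>

abbreviation cochain :: "('o, 'v, 'w) family helem \<Rightarrow> bool" where
  "cochain F \<equiv> snd F \<in> Cspace A B \<Phi> (1 + fst F)"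

lemma app_edge: "cochain F \<Longrightarrow> path A p \<Longrightarrow> app \<Phi> F p \<in> edges B"
  using Cspace_mem[of "snd F" "1 + fst F" p] path_ends[of p] obj_map
  by (auto simp: edges_def app_def algebra_simps)

lemma wdeg_map2_app: "length Fs = length ps \<Longrightarrow> wdeg (map2 (app \<Phi>) Fs ps) = deg_sum Fs + wdeg (concat ps)"
  by (induction Fs ps rule: list_induct2) auto

text \<open>Neighbouring pieces share an object, so their contractions are again composable, with
  ends the images of the ends of the whole path.\<close>

lemma map2_app_path_concat:
  assumes "length Fs = length ps" "path A (concat ps)" "[] \<notin> set ps" "\<And>F. F \<in> set Fs \<Longrightarrow> cochain F"
  shows "path B (map2 (app \<Phi>) Fs ps) \<and> src (hd (map2 (app \<Phi>) Fs ps)) = \<Phi> (src (hd (concat ps))) \<and>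
    tgt (last (map2 (app \<Phi>) Fs ps)) = \<Phi> (tgt (last (concat ps)))"
  using assms
proof (induction Fs ps rule: list_induct2)
  case Nil
  then show ?case using path_nonempty by fastforce
next
  case (Cons F Fs p ps)
  show ?case
  proof (cases "ps = []")
    case True
    then show ?thesis using Cons by (simp add: path_single app_edge)
  next
    case False
    then have ne: "concat ps \<noteq> []" "p \<noteq> []" "Fs \<noteq> []" using Cons by (cases ps; auto)+
    then have p: "path A p" "path A (concat ps)" "tgt (last p) = src (hd (concat ps))"
      using Cons.prems(1) by (auto simp: path_append)
    let ?r = "map2 (app \<Phi>) Fs ps"
    have r: "path B ?r" "src (hd ?r) = \<Phi> (src (hd (concat ps)))" "tgt (last ?r) = \<Phi> (tgt (last (concat ps)))"
      using Cons p by auto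
    have "?r \<noteq> []" using path_nonempty[OF r(1)] .
    moreover have "path B ([app \<Phi> F p] @ ?r)"
      using r p Cons.prems \<open>?r \<noteq> []\<close> by (subst path_append) (auto simp: path_single app_edge)
    ultimately show ?thesis using r ne by simp
  qed
qed

lemma map2_app_path:
  assumes "path A w" "ps \<in> pieces w (length Fs)" "\<And>F. F \<in> set Fs \<Longrightarrow> cochain F"
  shows "path B (map2 (app \<Phi>) Fs ps)" "src (hd (map2 (app \<Phi>) Fs ps)) = \<Phi> (src (hd w))"
    "tgt (last (map2 (app \<Phi>) Fs ps)) = \<Phi> (tgt (last w))"
    "wdeg (map2 (app \<Phi>) Fs ps) = deg_sum Fs + wdeg w"
  using map2_app_path_concat[of Fs ps] wdeg_map2_app[of Fs ps] assms by (auto simp: pieces_def)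

lemma multi_comp_zero: "\<not> composable A xs vs \<Longrightarrow> multi_comp A B \<Phi> m Fs xs vs = 0"
  by (simp add: multi_comp_def)

lemma gerstenhaber_zero: "\<not> composable A xs vs \<Longrightarrow> gerstenhaber A B F m xs vs = 0"
  by (simp add: gerstenhaber_def)

lemma map2_split:
  assumes "length us = length ps"
  shows "map2 f (us @ F # vs) (ps @ p # qs) = map2 f us ps @ f F p # map2 f vs qs"
  using assms by simp

lemma eval_sign_split:
  assumes "length us = length ps"
  shows "eval_sign (us @ F # vs) (ps @ p # qs) = eval_sign us ps + wdeg (concat ps) * (fst F + deg_sum vs)
    + wdeg p * deg_sum vs + eval_sign vs qs"
  using assms by (simp add: eval_sign_append)

lemma app_slot:
  assumes "cochain F" "path A (a @ (x, y, e, v) # b)" "path A (a @ (x, y, e, v') # b)"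
  shows "app \<Phi> F (a @ (x, y, e, Scale A c v + Scale A c' v') # b) =
    (\<Phi> (src (hd (a @ (x, y, e, v) # b))), \<Phi> (tgt (last (a @ (x, y, e, v) # b))),
     fst F + wdeg (a @ (x, y, e, v) # b),
     Scale B c (ev (snd F) (a @ (x, y, e, v) # b)) + Scale B c' (ev (snd F) (a @ (x, y, e, v') # b)))"
  unfolding app_def using slot_linearD[OF assms] by (cases a; cases b) auto

text \<open>For linearity in a vector, the divisions are indexed by \<open>interior_pieces\<close>,
  which does not mention that vector. In each term exactly one contracted edge depends on it,
  linearly by the cochain property, and \<open>m\<close> is linear in that edge; the sign sees
  degrees only.\<close>

lemma multi_comp_Cspace:
  assumes m: "m \<in> Cspace B B id (1 + e)" and Fs: "\<And>F. F \<in> set Fs \<Longrightarrow> cochain F"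
  shows "multi_comp A B \<Phi> m Fs \<in> Cspace A B \<Phi> (1 + (deg_sum Fs + e))"
  unfolding Cspace_iff
proof (intro conjI allI impI)
  interpret BB: quiver_map B B id using quiver_B by unfold_locales auto
  fix w assume w: "path A w"
  show "ev (multi_comp A B \<Phi> m Fs) w
      \<in> Hom B (\<Phi> (src (hd w))) (\<Phi> (tgt (last w))) (wdeg w + (1 + (deg_sum Fs + e)))"
    unfolding multi_comp_path[OF w]
  proof (intro SB.subspace_sum SB.subspace_scale path_subspace w)
    fix ps assume ps: "ps \<in> pieces w (length Fs)"
    note * = map2_app_path[OF w ps Fs]
    from BB.Cspace_mem[OF m *(1)]
    show "ev m (map2 (app \<Phi>) Fs ps)
      \<in> Hom B (\<Phi> (src (hd w))) (\<Phi> (tgt (last w))) (wdeg w + (1 + (deg_sum Fs + e)))"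
      by (simp add: *(2-4) algebra_simps)
  qed
next
  interpret BB: quiver_map B B id using quiver_B by unfold_locales auto
  show "slot_linear A B (multi_comp A B \<Phi> m Fs)"
    unfolding slot_linear_def
  proof (intro allI impI)
    fix u x y d v v' w c c'
    assume p: "path A (u @ (x, y, d, v) # w)" and p': "path A (u @ (x, y, d, v') # w)"
    let ?v = "Scale A c v + Scale A c' v'"
    let ?X = "\<lambda>v. (x, y, d, v)"
    have S: "SA.subspace (Hom A x y (1 + d))" using p by (rule path_slot_subspace)
    have pv: "path A (u @ ?X ?v # w)"
      using path_slot_mem[OF p] path_slot_mem[OF p'] path_change_val[OF p] S
      by (simp add: SA.subspace_add SA.subspace_scale)
    let ?T = "\<lambda>v (ps, a, b, qs). Scale B ((-1) powi eval_sign Fs (ps @ (a @ ?X v # b) # qs))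
       (ev m (map2 (app \<Phi>) Fs (ps @ (a @ ?X v # b) # qs)))"
    have "?T ?v z = Scale B c (?T v z) + Scale B c' (?T v' z)"
      if z: "z \<in> interior_pieces u w (length Fs)" for z
    proof -
      obtain ps a b qs where [simp]: "z = (ps, a, b, qs)" by (cases z) auto
      from z have zz: "concat ps @ a = u" "b @ concat qs = w" "[] \<notin> set ps" "[] \<notin> set qs"
        "length ps + 1 + length qs = length Fs" by (auto simp: interior_pieces_def)
      define Fs1 F Fs2 where "Fs1 = take (length ps) Fs" and "F = Fs ! length ps" and "Fs2 = drop (Suc (length ps)) Fs"
      have Fs_eq: "Fs = Fs1 @ F # Fs2" and l1: "length Fs1 = length ps" and l2: "length Fs2 = length qs"
        using zz(5) by (simp_all add: Fs1_def F_def Fs2_def id_take_nth_drop[symmetric])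
      have cF: "cochain F" using Fs Fs_eq by auto
      have pie: "ps @ (a @ ?X v'' # b) # qs \<in> pieces (u @ ?X v'' # w) (length Fs)" for v''
        using zz by (auto simp: pieces_def)
      have mid: "path A (a @ ?X v'' # b)" if "path A (u @ ?X v'' # w)" for v''
        using path_middle[of A "concat ps" "a @ ?X v'' # b" "concat qs"] that
        by (simp flip: zz(1,2))
      have path: "path B (map2 (app \<Phi>) Fs1 ps @ app \<Phi> F (a @ ?X v'' # b) # map2 (app \<Phi>) Fs2 qs)"
        if "path A (u @ ?X v'' # w)" for v''
      proof -
        have "path B (map2 (app \<Phi>) Fs (ps @ (a @ ?X v'' # b) # qs))"
          by (rule map2_app_path(1)[OF that pie Fs])
        then show ?thesis unfolding Fs_eq map2_split[OF l1] .
      qed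
      have app: "app \<Phi> F (a @ ?X v'' # b) = (\<Phi> (src (hd (a @ ?X v # b))), \<Phi> (tgt (last (a @ ?X v # b))),
          fst F + wdeg (a @ ?X v # b), ev (snd F) (a @ ?X v'' # b))" for v''
        unfolding app_def by (cases a; cases b) auto
      have "ev m (map2 (app \<Phi>) Fs1 ps @ app \<Phi> F (a @ ?X ?v # b) # map2 (app \<Phi>) Fs2 qs) =
         Scale B c (ev m (map2 (app \<Phi>) Fs1 ps @ app \<Phi> F (a @ ?X v # b) # map2 (app \<Phi>) Fs2 qs)) +
         Scale B c' (ev m (map2 (app \<Phi>) Fs1 ps @ app \<Phi> F (a @ ?X v' # b) # map2 (app \<Phi>) Fs2 qs))"
        using path[OF p] path[OF p'] unfolding app_slot[OF cF mid[OF p] mid[OF p']] app[of v] app[of v']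
        by (rule BB.slot_linearD[OF m])
      then show ?thesis
        unfolding Fs_eq
        by (simp only: \<open>z = _\<close> prod.case map2_split[OF l1] eval_sign_split[OF l1])
           (simp add: SB.scale_right_distrib mult.commute)
    qed
    then show "ev (multi_comp A B \<Phi> m Fs) (u @ (x, y, d, ?v) # w) =
       Scale B c (ev (multi_comp A B \<Phi> m Fs) (u @ (x, y, d, v) # w)) +
       Scale B c' (ev (multi_comp A B \<Phi> m Fs) (u @ (x, y, d, v') # w))"
      unfolding multi_comp_path[OF p] multi_comp_path[OF p'] multi_comp_path[OF pv]
        sum_pieces_interior SB.scale_sum_right sum.distrib[symmetric]
      by (intro sum.cong refl) (simp add: case_prod_unfold)
  qed
qed (rule multi_comp_zero)

text \<open>Here an operation varies instead of a vector: for each division this changes the value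
  of a single contracted edge, in which \<open>m\<close> is linear.\<close>

lemma multi_comp_slot_linear:
  assumes m: "m \<in> Cspace B B id (1 + e)" and Fs: "\<And>F. F \<in> set Fs \<Longrightarrow> cochain F"
    and Gs: "\<And>F. F \<in> set Gs \<Longrightarrow> cochain F" and G: "cochain (d, G)" and G': "cochain (d, G')"
  shows "multi_comp A B \<Phi> m (Fs @ (d, Cscale B c G + Cscale B c' G') # Gs) =
    Cscale B c (multi_comp A B \<Phi> m (Fs @ (d, G) # Gs)) +
    Cscale B c' (multi_comp A B \<Phi> m (Fs @ (d, G') # Gs))"
proof (rule family_eqI[where A = A])
  interpret BB: quiver_map B B id using quiver_B by unfold_locales auto
  fix w assume w: "path A w"
  let ?G = "Cscale B c G + Cscale B c' G'"
  let ?r = "length Fs + Suc (length Gs)"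
  let ?T = "\<lambda>G ps. Scale B ((-1) powi eval_sign (Fs @ (d, G) # Gs) ps) (ev m (map2 (app \<Phi>) (Fs @ (d, G) # Gs) ps))"
  have "?T ?G ps = Scale B c (?T G ps) + Scale B c' (?T G' ps)" if ps: "ps \<in> pieces w ?r" for ps
  proof -
    define ps1 p ps2 where "ps1 = take (length Fs) ps" and "p = ps ! length Fs" and "ps2 = drop (Suc (length Fs)) ps"
    have lps: "length ps = ?r" using ps by (simp add: pieces_def)
    then have ps_eq: "ps = ps1 @ p # ps2" and l1: "length Fs = length ps1"
      by (simp_all add: ps1_def p_def ps2_def id_take_nth_drop[symmetric])
    have path: "path B (map2 (app \<Phi>) Fs ps1 @ app \<Phi> (d, H) p # map2 (app \<Phi>) Gs ps2)" if "cochain (d, H)" for H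
    proof -
      have "path B (map2 (app \<Phi>) (Fs @ (d, H) # Gs) ps)"
        using ps that Fs Gs by (intro map2_app_path(1)[OF w]) auto
      then show ?thesis unfolding ps_eq map2_split[OF l1] .
    qed
    have app: "app \<Phi> (d, H) p = (\<Phi> (src (hd p)), \<Phi> (tgt (last p)), d + wdeg p, ev H p)" for H
      by (simp add: app_def)
    have "ev ?G p = Scale B c (ev G p) + Scale B c' (ev G' p)"
      by (simp add: ev_def Cscale_def)
    then have "ev m (map2 (app \<Phi>) Fs ps1 @ app \<Phi> (d, ?G) p # map2 (app \<Phi>) Gs ps2) =
       Scale B c (ev m (map2 (app \<Phi>) Fs ps1 @ app \<Phi> (d, G) p # map2 (app \<Phi>) Gs ps2)) +
       Scale B c' (ev m (map2 (app \<Phi>) Fs ps1 @ app \<Phi> (d, G') p # map2 (app \<Phi>) Gs ps2))"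
      using path[OF G] path[OF G'] unfolding app by (simp add: BB.slot_linearD[OF m])
    then show ?thesis
      unfolding ps_eq map2_split[OF l1] eval_sign_split[OF l1]
      by (simp add: SB.scale_right_distrib mult.commute)
  qed
  then show "ev (multi_comp A B \<Phi> m (Fs @ (d, ?G) # Gs)) w =
    ev (Cscale B c (multi_comp A B \<Phi> m (Fs @ (d, G) # Gs)) +
    Cscale B c' (multi_comp A B \<Phi> m (Fs @ (d, G') # Gs))) w"
    using multi_comp_path[OF w, of B \<Phi> m]
    by (subst (2) ev_def) (simp add: Cscale_def SB.scale_sum_right sum.distrib[symmetric] flip: ev_def)
qed (simp_all add: multi_comp_zero Cscale_def)

end

section \<open>Reindexing sums over cuts and pieces\<close>

text \<open>Both sides run over the factorisations \<open>s @ a @ p @ b @ t\<close>; the inner part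
  is chosen first on the left, the enclosing part \<open>a @ p @ b\<close> first on the
  right.\<close>

lemma sum_cuts_nested:
  "(\<Sum>(u, p, v)\<in>cuts w. \<Sum>(s, a)\<in>{(s, a). s @ a = u}. \<Sum>(b, t)\<in>{(b, t). b @ t = v}. g s a p b t) =
   (\<Sum>(s, q, t)\<in>cuts w. \<Sum>(a, p, b)\<in>cuts q. g s a p b t)"
proof -
  have "(\<Sum>(u, p, v)\<in>cuts w. \<Sum>(s, a)\<in>{(s, a). s @ a = u}. \<Sum>(b, t)\<in>{(b, t). b @ t = v}. g s a p b t) =
    (\<Sum>z\<in>cuts w. \<Sum>y\<in>{(s, a). s @ a = fst z} \<times> {(b, t). b @ t = snd (snd z)}.
       g (fst (fst y)) (snd (fst y)) (fst (snd z)) (fst (snd y)) (snd (snd y)))"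
    by (simp add: sum.cartesian_product' case_prod_unfold)
  also have "\<dots> = (\<Sum>(z, y)\<in>(SIGMA z:cuts w. {(s, a). s @ a = fst z} \<times> {(b, t). b @ t = snd (snd z)}).
       g (fst (fst y)) (snd (fst y)) (fst (snd z)) (fst (snd y)) (snd (snd y)))"
    by (rule sum.Sigma) (auto intro!: finite_cartesian_product finite_append_splits)
  also have "\<dots> = (\<Sum>(z, y)\<in>(SIGMA z:cuts w. cuts (fst (snd z))).
       g (fst z) (fst y) (fst (snd y)) (snd (snd y)) (snd (snd z)))"
    by (rule sum.reindex_bij_witness[where i = "\<lambda>((s, q, t), (a, p, b)). ((s @ a, p, b @ t), ((s, a), (b, t)))"
        and j = "\<lambda>((u, p, v), ((s, a), (b, t))). ((s, a @ p @ b, t), (a, p, b))"])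
      (auto simp: cuts_def)
  also have "\<dots> = (\<Sum>z\<in>cuts w. \<Sum>y\<in>cuts (fst (snd z)). g (fst z) (fst y) (fst (snd y)) (snd (snd y)) (snd (snd z)))"
    by (rule sum.Sigma[symmetric]) auto
  finally show ?thesis by (simp add: case_prod_unfold)
qed

text \<open>Both sides run over the factorisations \<open>u @ p @ b @ q @ t\<close> with two
  disjoint parts, choosing the left part first or the right part first.\<close>

lemma sum_cuts_swap:
  "(\<Sum>(u, p, v)\<in>cuts w. \<Sum>(b, q, t)\<in>cuts v. g u p b q t) =
   (\<Sum>(s, q, t)\<in>cuts w. \<Sum>(u, p, b)\<in>cuts s. g u p b q t)"
proof -
  have "(\<Sum>(u, p, v)\<in>cuts w. \<Sum>(b, q, t)\<in>cuts v. g u p b q t) =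
    (\<Sum>(z, y)\<in>(SIGMA z:cuts w. cuts (snd (snd z))). g (fst z) (fst (snd z)) (fst y) (fst (snd y)) (snd (snd y)))"
    by (subst sum.Sigma[symmetric]) (auto simp: case_prod_unfold)
  also have "\<dots> = (\<Sum>(z, y)\<in>(SIGMA z:cuts w. cuts (fst z)). g (fst y) (fst (snd y)) (snd (snd y)) (fst (snd z)) (snd (snd z)))"
    by (rule sum.reindex_bij_witness[where i = "\<lambda>((s, q, t), (u, p, b)). ((u, p, b @ q @ t), (b, q, t))"
        and j = "\<lambda>((u, p, v), (b, q, t)). ((u @ p @ b, q, t), (u, p, b))"])
      (auto simp: cuts_def)
  also have "\<dots> = (\<Sum>(s, q, t)\<in>cuts w. \<Sum>(u, p, b)\<in>cuts s. g u p b q t)"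
    by (subst sum.Sigma[symmetric]) (auto simp: case_prod_unfold)
  finally show ?thesis .
qed

lemma sum_cuts_singleton:
  "(\<Sum>(u, p, v)\<in>cuts w. if length p = 1 then h u (hd p) v else 0) =
   (\<Sum>i<length w. h (take i w) (w ! i) (drop (Suc i) w))"
proof -
  have "(\<Sum>(u, p, v)\<in>cuts w. if length p = 1 then h u (hd p) v else 0) =
     (\<Sum>z\<in>{z \<in> cuts w. length (fst (snd z)) = 1}. h (fst z) (hd (fst (snd z))) (snd (snd z)))"
    by (subst sum.inter_filter) (auto simp: case_prod_unfold)
  also have "\<dots> = (\<Sum>i<length w. h (take i w) (w ! i) (drop (Suc i) w))"
    by (rule sum.reindex_bij_witness[where i = "\<lambda>i. (take i w, [w ! i], drop (Suc i) w)"
        and j = "\<lambda>z. length (fst z)"])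
       (auto simp: cuts_def length_Suc_conv id_take_nth_drop[symmetric])
  finally show ?thesis .
qed

text \<open>Dividing one piece further is the same as regrouping \<open>b\<close> consecutive pieces
  of a finer division. For \<open>b = 0\<close> the regrouped piece would be empty, which a division
  forbids.\<close>

lemma sum_pieces_refine:
  fixes w :: "'a list"
  assumes b: "b \<ge> 1"
  shows "(\<Sum>ps\<in>pieces w (a + 1 + c). \<Sum>qs\<in>pieces (ps ! a) b. g (take a ps) (ps ! a) qs (drop (Suc a) ps)) =
   (\<Sum>rs\<in>pieces w (a + b + c). g (take a rs) (concat (take b (drop a rs))) (take b (drop a rs)) (drop (a + b) rs))"
proof -
  have *: "concat ps = concat (take a ps) @ ps ! a @ concat (drop (Suc a) ps)" if "length ps = a + 1 + c" for ps :: "'a list list"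
    using that id_take_nth_drop[of a ps] by (metis add.commute concat.simps(2) concat_append less_add_Suc1 plus_1_eq_Suc add.left_commute)
  have **: "set ps = set (take a ps) \<union> {ps ! a} \<union> set (drop (Suc a) ps)" if "length ps = a + 1 + c" for ps :: "'a list list"
    using that arg_cong[OF id_take_nth_drop[of a ps], of set] by simp
  have sp: "take a rs @ take b (drop a rs) @ drop (a + b) rs = rs" for rs :: "'a list list"
    by (rule take_drop_split)
  have c1: "concat (take a rs) @ concat (take b (drop a rs)) @ concat (drop (a + b) rs) = concat rs" for rs :: "'a list list"
    using arg_cong[OF sp[of rs], of concat] by simp
  have s1: "set (take a rs) \<union> set (take b (drop a rs)) \<union> set (drop (a + b) rs) = set rs" for rs :: "'a list list"
    using arg_cong[OF sp[of rs], of set] by (simp add: Un_assoc)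
  have "(\<Sum>ps\<in>pieces w (a + 1 + c). \<Sum>qs\<in>pieces (ps ! a) b. g (take a ps) (ps ! a) qs (drop (Suc a) ps)) =
    (\<Sum>(ps, qs)\<in>(SIGMA ps:pieces w (a + 1 + c). pieces (ps ! a) b). g (take a ps) (ps ! a) qs (drop (Suc a) ps))"
    by (rule sum.Sigma) auto
  also have "\<dots> = (\<Sum>rs\<in>pieces w (a + b + c). g (take a rs) (concat (take b (drop a rs))) (take b (drop a rs)) (drop (a + b) rs))"
  proof (rule sum.reindex_bij_witness[where j = "\<lambda>(ps, qs). take a ps @ qs @ drop (Suc a) ps"
        and i = "\<lambda>rs. (take a rs @ concat (take b (drop a rs)) # drop (a + b) rs, take b (drop a rs))"])
    fix z assume "z \<in> (SIGMA ps:pieces w (a + 1 + c). pieces (ps ! a) b)"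
    then obtain ps qs where z: "z = (ps, qs)" "concat ps = w" "[] \<notin> set ps" "length ps = a + 1 + c"
      "concat qs = ps ! a" "[] \<notin> set qs" "length qs = b"
      by (auto simp: pieces_def)
    have r: "take a (take a ps @ qs @ drop (Suc a) ps) = take a ps"
      "take b (drop a (take a ps @ qs @ drop (Suc a) ps)) = qs"
      "drop (a + b) (take a ps @ qs @ drop (Suc a) ps) = drop (Suc a) ps"
      using z by simp_all
    have ps: "take a ps @ ps ! a # drop (Suc a) ps = ps"
      using z(4) by (simp add: id_take_nth_drop[symmetric])
    show "(\<lambda>rs. (take a rs @ concat (take b (drop a rs)) # drop (a + b) rs, take b (drop a rs)))
       ((\<lambda>(ps, qs). take a ps @ qs @ drop (Suc a) ps) z) = z"
      unfolding z(1) prod.case r z(5) ps ..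
    show "(\<lambda>(ps, qs). take a ps @ qs @ drop (Suc a) ps) z \<in> pieces w (a + b + c)"
      using z *[OF z(4)] **[OF z(4)] by (auto simp: pieces_def)
    show "g (take a ((\<lambda>(ps, qs). take a ps @ qs @ drop (Suc a) ps) z))
        (concat (take b (drop a ((\<lambda>(ps, qs). take a ps @ qs @ drop (Suc a) ps) z))))
        (take b (drop a ((\<lambda>(ps, qs). take a ps @ qs @ drop (Suc a) ps) z)))
        (drop (a + b) ((\<lambda>(ps, qs). take a ps @ qs @ drop (Suc a) ps) z)) =
      (case z of (ps, qs) \<Rightarrow> g (take a ps) (ps ! a) qs (drop (Suc a) ps))"
      unfolding z(1) prod.case r z(5) ..
  next
    fix rs assume "rs \<in> pieces w (a + b + c)"
    then have rs: "concat rs = w" "[] \<notin> set rs" "length rs = a + b + c" by (auto simp: pieces_def)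
    then have l: "length (take a rs) = a" "length (take b (drop a rs)) = b" by auto
    let ?ps = "take a rs @ concat (take b (drop a rs)) # drop (a + b) rs"
    have r: "take a ?ps = take a rs" "?ps ! a = concat (take b (drop a rs))" "drop (Suc a) ?ps = drop (a + b) rs"
      using l by (simp_all add: nth_append)
    show "(\<lambda>(ps, qs). take a ps @ qs @ drop (Suc a) ps) (?ps, take b (drop a rs)) = rs"
      unfolding prod.case r by (rule sp)
    have "take b (drop a rs) \<noteq> []" using l b by auto
    moreover have "[] \<notin> set (take b (drop a rs))" using rs(2) s1[of rs] by auto
    ultimately have "concat (take b (drop a rs)) \<noteq> []" by (cases "take b (drop a rs)") auto
    then show "(?ps, take b (drop a rs)) \<in> (SIGMA ps:pieces w (a + 1 + c). pieces (ps ! a) b)"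
      using rs s1[of rs] c1[of rs] l by (auto simp: pieces_def r)
  qed
  finally show ?thesis .
qed

text \<open>Both sides count divisions with a nonempty part marked inside one piece: on the left the
  part is chosen first, on the right the division and the piece number \<open>i\<close>, which is
  the length of \<open>ps\<close>.\<close>

lemma sum_interior_pieces:
  fixes w :: "'a list"
  shows "(\<Sum>(u, p, v)\<in>cuts w. \<Sum>(ps, a, b, qs)\<in>interior_pieces u v n. g ps a p b qs) =
   (\<Sum>i<n. \<Sum>rs\<in>pieces w n. \<Sum>(a, p, b)\<in>cuts (rs ! i). g (take i rs) a p b (drop (Suc i) rs))"
proof -
  have split: "take i rs @ (rs ! i) # drop (Suc i) rs = rs" if "i < length rs" for i and rs :: "'a list list"
    using that by (simp add: id_take_nth_drop[symmetric])
  have c: "concat (take i rs) @ (rs ! i) @ concat (drop (Suc i) rs) = concat rs" if "i < length rs" for i and rs :: "'a list list"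
    using arg_cong[OF split[OF that], of concat] by simp
  have s: "set (take i rs) \<subseteq> set rs" "set (drop (Suc i) rs) \<subseteq> set rs" for i and rs :: "'a list list"
    by (rule set_take_subset, rule set_drop_subset)
  have "(\<Sum>(u, p, v)\<in>cuts w. \<Sum>(ps, a, b, qs)\<in>interior_pieces u v n. g ps a p b qs) =
    (\<Sum>(z, y)\<in>(SIGMA z:cuts w. interior_pieces (fst z) (snd (snd z)) n).
       g (fst y) (fst (snd y)) (fst (snd z)) (fst (snd (snd y))) (snd (snd (snd y))))"
    by (subst sum.Sigma[symmetric]) (auto simp: case_prod_unfold)
  also have "\<dots> = (\<Sum>(x, y)\<in>(SIGMA x:{..<n} \<times> pieces w n. cuts (snd x ! fst x)).
       g (take (fst x) (snd x)) (fst y) (fst (snd y)) (snd (snd y)) (drop (Suc (fst x)) (snd x)))"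
    by (rule sum.reindex_bij_witness[where
          j = "\<lambda>((u, p, v), (ps, a, b, qs)). ((length ps, ps @ (a @ p @ b) # qs), (a, p, b))"
        and i = "\<lambda>((i, rs), (a, p, b)). ((concat (take i rs) @ a, p, b @ concat (drop (Suc i) rs)),
          (take i rs, a, b, drop (Suc i) rs))"])
       (use split c s in \<open>fastforce simp: cuts_def interior_pieces_def pieces_def simp del: drop_Suc\<close>)+
  also have "\<dots> = (\<Sum>i<n. \<Sum>rs\<in>pieces w n. \<Sum>(a, p, b)\<in>cuts (rs ! i). g (take i rs) a p b (drop (Suc i) rs))"
    by (subst sum.Sigma[symmetric]) (auto simp: case_prod_unfold sum.cartesian_product')
  finally show ?thesis .
qed

section \<open>Insertion of an operation into a cochain\<close>

context quiver_map
begin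

sublocale CB: vector_space "Cscale B"
  by unfold_locales (auto simp: Cscale_def fun_eq_iff SB.scale_right_distrib SB.scale_left_distrib)

lemma ev_add: "ev (F + G) w = ev F w + ev G w"
  and ev_zero: "ev 0 w = 0"
  and ev_scale: "ev (Cscale B c F) w = Scale B c (ev F w)"
  by (simp_all add: ev_def Cscale_def)

lemma ev_sum:
  fixes F :: "'i \<Rightarrow> ('o, 'v, 'w) family"
  shows "ev (\<Sum>i\<in>I. F i) w = (\<Sum>i\<in>I. ev (F i) w)"
proof (induction I rule: infinite_finite_induct)
  case (insert i I)
  show ?case by (simp only: sum.insert[OF insert(1,2)] ev_add insert(3))
next
  case (infinite I)
  show ?case by (simp only: sum.infinite[OF infinite] ev_zero)
qed (simp only: sum.empty ev_zero)

lemma Cspace_subspace: "CB.subspace (Cspace A B \<Phi> d)"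
proof (rule CB.subspaceI)
  show "0 \<in> Cspace A B \<Phi> d"
    unfolding Cspace_iff slot_linear_def by (auto simp: ev_zero SB.subspace_0[OF path_subspace])
next
  fix F G assume "F \<in> Cspace A B \<Phi> d" "G \<in> Cspace A B \<Phi> d"
  then show "F + G \<in> Cspace A B \<Phi> d"
    unfolding Cspace_iff slot_linear_def
    by (auto simp: ev_add SB.scale_right_distrib intro: SB.subspace_add[OF path_subspace])
next
  fix c F assume "F \<in> Cspace A B \<Phi> d"
  then show "Cscale B c F \<in> Cspace A B \<Phi> d"
    unfolding Cspace_iff slot_linear_def
    by (auto simp: ev_scale SB.scale_right_distrib mult.commute intro: SB.subspace_scale[OF path_subspace])
       (simp add: Cscale_def)
qed

lemma gerstenhaber_combo:
  "gerstenhaber A B (Cscale B c F + Cscale B c' G) m =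
   Cscale B c (gerstenhaber A B F m) + Cscale B c' (gerstenhaber A B G m)"
  by (rule family_eqI[where A = A])
     (simp add: gerstenhaber_path ev_add ev_scale SB.scale_right_distrib sum.distrib SB.scale_sum_right
        case_prod_unfold mult.commute, simp_all add: gerstenhaber_zero Cscale_def)

lemma gerstenhaber_scale: "gerstenhaber A B (Cscale B c F) m = Cscale B c (gerstenhaber A B F m)"
  using gerstenhaber_combo[of c F 0 0 m] by simp

lemma gerstenhaber_null: "gerstenhaber A B 0 m = 0"
  using gerstenhaber_combo[of 0 0 0 0 m] by simp

lemma gerstenhaber_diff: "gerstenhaber A B (F - G) m = gerstenhaber A B F m - gerstenhaber A B G m"
  using gerstenhaber_combo[of 1 F "-1" G m] by simp

lemma insert_edge:
  assumes "path A (u @ p @ v)" "p \<noteq> []" "snd m \<in> Cspace A A id (1 + fst m)"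
  shows "path A (u @ app id m p # v)" "app id m p \<in> edges A"
proof -
  interpret AA: quiver_map A A id using quiver_A by unfold_locales auto
  have "path A p" using assms(1,2) by (rule path_middle)
  then show e: "app id m p \<in> edges A" using assms(3) by (intro AA.app_edge)
  show "path A (u @ app id m p # v)"
    using path_replace[OF assms(1,2), of "[app id m p]"] e by (simp add: path_single)
qed

text \<open>By \<open>sum_cuts_insert\<close> the varied letter is inside, before or after the
  inserted part. Inside, linearity passes through \<open>m\<close> and then through
  \<open>F\<close>; in the other two cases it is linearity of \<open>F\<close> alone.\<close>

lemma gerstenhaber_Cspace:
  assumes F: "F \<in> Cspace A B \<Phi> d" and m: "snd m \<in> Cspace A A id (1 + fst m)"
  shows "gerstenhaber A B F m \<in> Cspace A B \<Phi> (d + fst m)"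
  unfolding Cspace_iff
proof (intro conjI allI impI)
  fix w assume w: "path A w"
  show "ev (gerstenhaber A B F m) w \<in> Hom B (\<Phi> (src (hd w))) (\<Phi> (tgt (last w))) (wdeg w + (d + fst m))"
    unfolding gerstenhaber_path[OF w]
  proof (intro SB.subspace_sum path_subspace w, clarify, intro SB.subspace_scale path_subspace w)
    fix u p v assume "(u, p, v) \<in> cuts w"
    then have *: "w = u @ p @ v" "p \<noteq> []" by (auto simp: cuts_def)
    have "src (hd (u @ app id m p # v)) = src (hd w)"
      using * by (cases u) auto
    moreover have "tgt (last (u @ app id m p # v)) = tgt (last w)"
      unfolding *(1) using *(2) by (cases v) auto
    moreover have "path A (u @ app id m p # v)" using insert_edge[of u p v m] w m * by simp
    ultimately show "ev F (u @ app id m p # v) \<in> Hom B (\<Phi> (src (hd w))) (\<Phi> (tgt (last w))) (wdeg w + (d + fst m))"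
      using Cspace_mem[OF F, of "u @ app id m p # v"] * by (simp add: algebra_simps)
  qed
next
  interpret AA: quiver_map A A id using quiver_A by unfold_locales auto
  show "slot_linear A B (gerstenhaber A B F m)"
    unfolding slot_linear_def
  proof (intro allI impI)
    fix u x y e v v' w c c'
    assume p: "path A (u @ (x, y, e, v) # w)" and p': "path A (u @ (x, y, e, v') # w)"
    let ?v = "Scale A c v + Scale A c' v'"
    let ?X = "\<lambda>v. (x, y, e, v)"
    have S: "SA.subspace (Hom A x y (1 + e))" using p by (rule path_slot_subspace)
    have pv: "path A (u @ ?X ?v # w)"
      using path_slot_mem[OF p] path_slot_mem[OF p'] path_change_val[OF p] S
      by (simp add: SA.subspace_add SA.subspace_scale)
    let ?E = "app id m"
    have 1: "ev F (s @ ?E (a @ ?X ?v # b) # t) =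
        Scale B c (ev F (s @ ?E (a @ ?X v # b) # t)) + Scale B c' (ev F (s @ ?E (a @ ?X v' # b) # t))"
      if "s @ a = u" "b @ t = w" for s a b t
    proof -
      have q: "path A (a @ ?X v'' # b)" "path A (s @ ?E (a @ ?X v'' # b) # t)" if "path A (u @ ?X v'' # w)" for v''
      proof -
        have *: "path A (s @ (a @ ?X v'' # b) @ t)" using that \<open>s @ a = u\<close> \<open>b @ t = w\<close> by force
        then show "path A (a @ ?X v'' # b)" by (rule path_middle) simp
        show "path A (s @ ?E (a @ ?X v'' # b) # t)" by (rule insert_edge(1)[OF * _ m]) simp
      qed
      have app: "?E (a @ ?X v'' # b) = (src (hd (a @ ?X v # b)), tgt (last (a @ ?X v # b)),
          fst m + wdeg (a @ ?X v # b), ev (snd m) (a @ ?X v'' # b))" for v''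
        unfolding app_def by (cases a; cases b) auto
      have app2: "?E (a @ ?X ?v # b) = (src (hd (a @ ?X v # b)), tgt (last (a @ ?X v # b)),
          fst m + wdeg (a @ ?X v # b),
          Scale A c (ev (snd m) (a @ ?X v # b)) + Scale A c' (ev (snd m) (a @ ?X v' # b)))"
        using AA.app_slot[OF m q(1)[OF p] q(1)[OF p']] by simp
      show ?thesis
        using q(2)[OF p] q(2)[OF p'] unfolding app2 app[of v] app[of v'] by (rule slot_linearD[OF F])
    qed
    have 2: "ev F ((u @ ?X ?v # b) @ ?E p # t) =
        Scale B c (ev F ((u @ ?X v # b) @ ?E p # t)) + Scale B c' (ev F ((u @ ?X v' # b) @ ?E p # t))"
      if "(b, p, t) \<in> cuts w" for b p t
    proof -
      have q: "path A (u @ ?X v'' # b @ ?E p # t)" if "path A (u @ ?X v'' # w)" for v''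
        using insert_edge(1)[of "u @ ?X v'' # b" p t m] that m \<open>(b, p, t) \<in> cuts w\<close> by (auto simp: cuts_def)
      show ?thesis using slot_linearD[OF F q[OF p] q[OF p']] by simp
    qed
    have 3: "ev F (s @ ?E p # a @ ?X ?v # w) =
        Scale B c (ev F (s @ ?E p # a @ ?X v # w)) + Scale B c' (ev F (s @ ?E p # a @ ?X v' # w))"
      if "(s, p, a) \<in> cuts u" for s p a
    proof -
      have q: "path A ((s @ ?E p # a) @ ?X v'' # w)" if "path A (u @ ?X v'' # w)" for v''
        using insert_edge(1)[of s p "a @ ?X v'' # w" m] that m \<open>(s, p, a) \<in> cuts u\<close> by (auto simp: cuts_def)
      show ?thesis using slot_linearD[OF F q[OF p] q[OF p']] by simp
    qed
    have eq: "(\<Sum>z\<in>I. Scale B (r z) (h z)) = Scale B c (\<Sum>z\<in>I. Scale B (r z) (h1 z)) + Scale B c' (\<Sum>z\<in>I. Scale B (r z) (h2 z))"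
      if "\<And>z. z \<in> I \<Longrightarrow> h z = Scale B c (h1 z) + Scale B c' (h2 z)" for I :: "'z set" and r h h1 h2
      using that by (simp add: SB.scale_right_distrib SB.scale_sum_right sum.distrib mult.commute)
    have s: "(\<Sum>(s, a)\<in>{(s, a). s @ a = u}. \<Sum>(b, t)\<in>{(b, t). b @ t = w}. h s a b t) =
      (\<Sum>z\<in>{(s, a). s @ a = u} \<times> {(b, t). b @ t = w}. h (fst (fst z)) (snd (fst z)) (fst (snd z)) (snd (snd z)))"
      for h :: "('o, 'v) edge list \<Rightarrow> ('o, 'v) edge list \<Rightarrow> ('o, 'v) edge list \<Rightarrow> ('o, 'v) edge list \<Rightarrow> 'w"
      by (simp add: sum.cartesian_product' case_prod_unfold)
    let ?G = "\<lambda>v. ev (gerstenhaber A B F m) (u @ ?X v # w)"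
    have "(\<Sum>z\<in>{(s, a). s @ a = u} \<times> {(b, t). b @ t = w}. Scale B ((-1) powi (fst m * wdeg (fst (fst z))))
          (ev F (fst (fst z) @ ?E (snd (fst z) @ ?X ?v # fst (snd z)) # snd (snd z)))) =
      Scale B c (\<Sum>z\<in>{(s, a). s @ a = u} \<times> {(b, t). b @ t = w}. Scale B ((-1) powi (fst m * wdeg (fst (fst z))))
          (ev F (fst (fst z) @ ?E (snd (fst z) @ ?X v # fst (snd z)) # snd (snd z)))) +
      Scale B c' (\<Sum>z\<in>{(s, a). s @ a = u} \<times> {(b, t). b @ t = w}. Scale B ((-1) powi (fst m * wdeg (fst (fst z))))
          (ev F (fst (fst z) @ ?E (snd (fst z) @ ?X v' # fst (snd z)) # snd (snd z))))"
      by (rule eq) (auto intro: 1)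
    moreover have "(\<Sum>z\<in>cuts w. Scale B ((-1) powi (fst m * wdeg (u @ ?X ?v # fst z)))
          (ev F ((u @ ?X ?v # fst z) @ ?E (fst (snd z)) # snd (snd z)))) =
      Scale B c (\<Sum>z\<in>cuts w. Scale B ((-1) powi (fst m * wdeg (u @ ?X ?v # fst z)))
          (ev F ((u @ ?X v # fst z) @ ?E (fst (snd z)) # snd (snd z)))) +
      Scale B c' (\<Sum>z\<in>cuts w. Scale B ((-1) powi (fst m * wdeg (u @ ?X ?v # fst z)))
          (ev F ((u @ ?X v' # fst z) @ ?E (fst (snd z)) # snd (snd z))))"
      by (rule eq) (rule 2, simp)
    moreover have "(\<Sum>z\<in>cuts u. Scale B ((-1) powi (fst m * wdeg (fst z)))
          (ev F (fst z @ ?E (fst (snd z)) # snd (snd z) @ ?X ?v # w))) =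
      Scale B c (\<Sum>z\<in>cuts u. Scale B ((-1) powi (fst m * wdeg (fst z)))
          (ev F (fst z @ ?E (fst (snd z)) # snd (snd z) @ ?X v # w))) +
      Scale B c' (\<Sum>z\<in>cuts u. Scale B ((-1) powi (fst m * wdeg (fst z)))
          (ev F (fst z @ ?E (fst (snd z)) # snd (snd z) @ ?X v' # w)))"
      by (rule eq) (rule 3, simp)
    \<comment> \<open>Signs involve only degrees, so the three instances have the same
      coefficients.\<close>
    moreover have w: "wdeg (u @ ?X v'' # b) = wdeg (u @ ?X ?v # b)" for v'' b by simp
    ultimately show "?G ?v = Scale B c (?G v) + Scale B c' (?G v')"
      unfolding gerstenhaber_path[OF p] gerstenhaber_path[OF p'] gerstenhaber_path[OF pv]
        sum_cuts_insert s w[of v] w[of v'] unfolding case_prod_unfold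
      by (simp only: SB.scale_right_distrib) (simp only: ac_simps)
  qed
qed (rule gerstenhaber_zero)

text \<open>Nested insertions add up to \<open>F\<close> with \<open>m o m\<close> inserted, which
  vanishes. Disjoint insertions occur twice, once in each order, with opposite signs because
  \<open>m\<close> has odd degree.\<close>

lemma gerstenhaber_square:
  assumes F: "F \<in> Cspace A B \<Phi> d" and m: "m \<in> Cspace A A id 2" and mm: "gerstenhaber A A m (1, m) = 0"
  shows "gerstenhaber A B (gerstenhaber A B F (1, m)) (1, m) = 0"
proof (rule family_eqI[where A = A])
  interpret AA: quiver_map A A id using quiver_A by unfold_locales auto
  fix w assume w: "path A w"
  let ?E = "app id (1, m)"
  let ?f = "\<lambda>u v. Scale B ((-1) powi u) (ev F v)"
  have m': "snd (1 :: int, m) \<in> Cspace A A id (1 + fst (1 :: int, m))" using m by simp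
  have "ev (gerstenhaber A B (gerstenhaber A B F (1, m)) (1, m)) w =
     (\<Sum>(u, p, v)\<in>cuts w. \<Sum>(s, q, t)\<in>cuts (u @ ?E p # v). ?f (wdeg u + wdeg s) (s @ ?E q # t))"
    unfolding gerstenhaber_path[OF w]
  proof (rule sum.cong[OF refl], clarify)
    fix u p v assume "(u, p, v) \<in> cuts w"
    then have "path A (u @ ?E p # v)" using insert_edge(1)[OF _ _ m'] w by (auto simp: cuts_def)
    then show "Scale B ((-1) powi (fst (1, m) * wdeg u)) (ev (gerstenhaber A B F (1, m)) (u @ ?E p # v)) =
      (\<Sum>(s, q, t)\<in>cuts (u @ ?E p # v). ?f (wdeg u + wdeg s) (s @ ?E q # t))"
      by (simp add: gerstenhaber_path SB.scale_sum_right case_prod_unfold ksign_add)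
  qed
  \<comment> \<open>The three sums are the nested insertions and the disjoint ones with the second
    insertion to the right or to the left; degrees counted twice are dropped from the
    exponents.\<close>
  also have "\<dots> = (\<Sum>(u, p, v)\<in>cuts w. (\<Sum>(s, a)\<in>{(s, a). s @ a = u}. \<Sum>(b, t)\<in>{(b, t). b @ t = v}.
         ?f (wdeg a) (s @ ?E (a @ ?E p # b) # t))) +
     (\<Sum>(u, p, v)\<in>cuts w. \<Sum>(b, q, t)\<in>cuts v. ?f (1 + wdeg p + wdeg b) (u @ ?E p # b @ ?E q # t)) +
     (\<Sum>(u, p, v)\<in>cuts w. \<Sum>(s, q, a)\<in>cuts u. ?f (wdeg q + wdeg a) (s @ ?E q # a @ ?E p # v))"
    unfolding sum_cuts_insert unfolding case_prod_unfold sum.distrib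
  proof (intro arg_cong2[where f = "(+)"] sum.cong refl)
    fix z :: "('o, 'v) edge list \<times> ('o, 'v) edge list \<times> ('o, 'v) edge list"
      and y y' :: "('o, 'v) edge list \<times> ('o, 'v) edge list"
    assume "y \<in> {p. fst p @ snd p = fst z}"
    then have "wdeg (fst z) = wdeg (fst y) + wdeg (snd y)"
      by (auto simp flip: wdeg_simps(3))
    then show "?f (wdeg (fst z) + wdeg (fst y)) (fst y @ ?E (snd y @ ?E (fst (snd z)) # fst y') # snd y') =
      ?f (wdeg (snd y)) (fst y @ ?E (snd y @ ?E (fst (snd z)) # fst y') # snd y')"
      by (simp add: ksign_if)
  next
    fix z y :: "('o, 'v) edge list \<times> ('o, 'v) edge list \<times> ('o, 'v) edge list"
    show "?f (wdeg (fst z) + wdeg (fst z @ ?E (fst (snd z)) # fst y))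
         ((fst z @ ?E (fst (snd z)) # fst y) @ ?E (fst (snd y)) # snd (snd y)) =
      ?f (1 + wdeg (fst (snd z)) + wdeg (fst y)) (fst z @ ?E (fst (snd z)) # fst y @ ?E (fst (snd y)) # snd (snd y))"
      by (simp add: ksign_if)
  next
    fix z y :: "('o, 'v) edge list \<times> ('o, 'v) edge list \<times> ('o, 'v) edge list"
    assume "y \<in> cuts (fst z)"
    then have "wdeg (fst z) = wdeg (fst y) + wdeg (fst (snd y)) + wdeg (snd (snd y))"
      by (auto simp: cuts_def)
    then show "?f (wdeg (fst z) + wdeg (fst y)) (fst y @ ?E (fst (snd y)) # snd (snd y) @ ?E (fst (snd z)) # snd (snd z)) =
      ?f (wdeg (fst (snd y)) + wdeg (snd (snd y))) (fst y @ ?E (fst (snd y)) # snd (snd y) @ ?E (fst (snd z)) # snd (snd z))"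
      by (simp add: ksign_if)
  qed
  also have "(\<Sum>(u, p, v)\<in>cuts w. (\<Sum>(s, a)\<in>{(s, a). s @ a = u}. \<Sum>(b, t)\<in>{(b, t). b @ t = v}.
         ?f (wdeg a) (s @ ?E (a @ ?E p # b) # t))) =
     (\<Sum>(s, q, t)\<in>cuts w. \<Sum>(a, p, b)\<in>cuts q. ?f (wdeg a) (s @ ?E (a @ ?E p # b) # t))"
    by (rule sum_cuts_nested)
  \<comment> \<open>For a fixed enclosing part \<open>q\<close>, linearity in the slot holding its
    value turns the sum into \<open>F\<close> with the value of \<open>m o m\<close> on
    \<open>q\<close> in that slot.\<close>
  also have "\<dots> = 0"
  proof (rule sum.neutral, clarify)
    fix s q t assume "(s, q, t) \<in> cuts w"
    then have wq: "w = s @ q @ t" "q \<noteq> []" by (auto simp: cuts_def)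
    then have q: "path A q" using w path_middle by blast
    let ?c = "\<lambda>z :: ('o, 'v) edge list \<times> ('o, 'v) edge list \<times> ('o, 'v) edge list. (-1) powi wdeg (fst z) :: 'k"
    let ?g = "\<lambda>z. ev m (fst z @ ?E (fst (snd z)) # snd (snd z))"
    have "ev (gerstenhaber A A m (1, m)) q = 0" by (simp add: mm ev_def)
    then have 0: "(\<Sum>z\<in>cuts q. Scale A (?c z) (?g z)) = 0"
      by (simp add: gerstenhaber_path[OF q] case_prod_unfold)
    have app: "?E (a @ ?E p # b) = (src (hd q), tgt (last q), 2 + wdeg q, ev m (a @ ?E p # b))"
      if "(a, p, b) \<in> cuts q" for a p b
    proof -
      have "q = a @ p @ b" "p \<noteq> []" using that by (auto simp: cuts_def)
      then show ?thesis by (cases a; cases b) (simp_all add: app_def)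
    qed
    have e: "path A (s @ ?E (a @ ?E p # b) # t)" if "(a, p, b) \<in> cuts q" for a p b
    proof -
      have *: "q = a @ p @ b" "p \<noteq> []" using that by (auto simp: cuts_def)
      then have "path A ((s @ a) @ p @ (b @ t))" using w wq by simp
      then have "path A (s @ (a @ ?E p # b) @ t)" using insert_edge(1)[OF _ *(2) m'] by fastforce
      then show ?thesis by (rule insert_edge(1)) (use m in simp_all)
    qed
    have q_cut: "([], q, []) \<in> cuts q" using wq(2) by (simp add: cuts_def)
    from e[OF q_cut] have path: "path A (s @ (src (hd q), tgt (last q), 2 + wdeg q, ev m ([] @ ?E q # [])) # t)"
      unfolding app[OF q_cut] .
    have "(\<Sum>(a, p, b)\<in>cuts q. ?f (wdeg a) (s @ ?E (a @ ?E p # b) # t)) =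
      (\<Sum>z\<in>cuts q. Scale B (?c z) (ev F (s @ (src (hd q), tgt (last q), 2 + wdeg q, ?g z) # t)))"
      by (rule sum.cong) (auto simp: app)
    also have "\<dots> = ev F (s @ (src (hd q), tgt (last q), 2 + wdeg q, \<Sum>z\<in>cuts q. Scale A (?c z) (?g z)) # t)"
    proof (rule slot_sum[OF F path, symmetric])
      fix z assume "z \<in> cuts q"
      then have "path A (s @ ?E (fst z @ ?E (fst (snd z)) # snd (snd z)) # t)" using e by (cases z) auto
      moreover have "?E (fst z @ ?E (fst (snd z)) # snd (snd z)) = (src (hd q), tgt (last q), 2 + wdeg q, ?g z)"
        using app \<open>z \<in> cuts q\<close> by (cases z) auto
      ultimately show "?g z \<in> Hom A (src (hd q)) (tgt (last q)) (1 + (2 + wdeg q))"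
        by (simp only:) (erule path_slot_mem)
    qed
    also have "\<dots> = 0" unfolding 0 by (rule slot_zero[OF F path])
    finally show "(\<Sum>(a, p, b)\<in>cuts q. ?f (wdeg a) (s @ ?E (a @ ?E p # b) # t)) = 0" .
  qed
  \<comment> \<open>After exchanging the two parts, the exponents of the two disjoint sums differ
    exactly by the degree \<open>1\<close> of the result edge that one insertion has to
    pass.\<close>
  also have "(\<Sum>(u, p, v)\<in>cuts w. \<Sum>(s, q, a)\<in>cuts u. ?f (wdeg q + wdeg a) (s @ ?E q # a @ ?E p # v)) =
     (\<Sum>(u, p, v)\<in>cuts w. \<Sum>(b, q, t)\<in>cuts v. ?f (wdeg p + wdeg b) (u @ ?E p # b @ ?E q # t))"
    by (rule sum_cuts_swap[symmetric])
  also have "0 + (\<Sum>(u, p, v)\<in>cuts w. \<Sum>(b, q, t)\<in>cuts v. ?f (1 + wdeg p + wdeg b) (u @ ?E p # b @ ?E q # t)) + \<dots> = 0"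
    by (simp add: case_prod_unfold ksign_if sum.distrib[symmetric] flip: sum.distrib) (auto intro!: sum.neutral)
  finally show "ev (gerstenhaber A B (gerstenhaber A B F (1, m)) (1, m)) w = ev 0 w"
    by (simp add: ev_def)
qed (simp_all add: gerstenhaber_zero)

end

section \<open>The two composition identities\<close>

lemma sum_family_apply: "(\<Sum>i\<in>I. F i) xs vs = (\<Sum>i\<in>I. F i xs vs)"
  by (induction I rule: infinite_finite_induct) auto

lemma Cscale_apply: "Cscale B c F xs vs = Scale B c (F xs vs)"
  by (simp add: Cscale_def)

context quiver_map
begin

text \<open>A division for the outer word and a division of the piece belonging to \<open>ws\<close>
  combine to a division \<open>rs\<close> of \<open>w\<close> into one piece for each letter of
  \<open>Fs\<close>. For fixed \<open>rs\<close>, the sum over cuts is \<open>m o m\<close> on the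
  contracted path in \<open>B\<close>, hence zero.\<close>

lemma multi_comp_relation:
  assumes m: "m \<in> Cspace B B id 2" and mm: "gerstenhaber B B m (1, m) = 0"
    and Fs: "\<And>F. F \<in> set Fs \<Longrightarrow> cochain F"
  shows "(\<Sum>(us, ws, vs)\<in>cuts Fs. Cscale B ((-1) powi deg_sum us)
     (multi_comp A B \<Phi> m (us @ (1 + deg_sum ws, multi_comp A B \<Phi> m ws) # vs))) = 0"
    (is "?L = 0")
proof (rule family_eqI[where A = A])
  interpret BB: quiver_map B B id using quiver_B by unfold_locales auto
  fix w assume w: "path A w"
  let ?M = "multi_comp A B \<Phi> m"
  let ?E = "app id (1, m)"
  let ?n = "length Fs"
  let ?C = "{(i, k). 1 \<le> k \<and> i + k \<le> ?n}"
  have m': "m \<in> Cspace B B id (1 + 1)" using m by simp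
  have M: "cochain (1 + deg_sum ws, ?M ws)" if "set ws \<subseteq> set Fs" for ws
    using multi_comp_Cspace[OF m', of ws] Fs that by (auto simp: algebra_simps)
  have key: "Scale B ((-1) powi deg_sum us) (ev (?M (us @ (1 + deg_sum ws, ?M ws) # vs)) w) =
    (\<Sum>rs\<in>pieces w ?n. Scale B ((-1) powi eval_sign Fs rs)
      (Scale B ((-1) powi wdeg (take (length us) (map2 (app \<Phi>) Fs rs)))
        (ev m (take (length us) (map2 (app \<Phi>) Fs rs) @
          ?E (take (length ws) (drop (length us) (map2 (app \<Phi>) Fs rs))) #
          drop (length us + length ws) (map2 (app \<Phi>) Fs rs)))))"
    if Fs_eq: "Fs = us @ ws @ vs" and ne: "ws \<noteq> []" for us ws vs
  proof -
    let ?a = "length us" and ?b = "length ws" and ?c = "length vs"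
    let ?G = "(1 + deg_sum ws, ?M ws)"
    \<comment> \<open>The summand for an outer division with middle piece \<open>p\<close> and a
      division \<open>qs\<close> of \<open>p\<close>, written in the shape that
      \<open>sum_pieces_refine\<close> regroups.\<close>
    define X where "X = (\<lambda>ps (p :: ('o, 'v) edge list) qs rs.
      Scale B ((-1) powi (deg_sum us + eval_sign us ps + wdeg (concat ps) * (1 + deg_sum ws + deg_sum vs) +
        wdeg p * deg_sum vs + eval_sign vs rs + eval_sign ws qs))
        (ev m (map2 (app \<Phi>) us ps @ ?E (map2 (app \<Phi>) ws qs) # map2 (app \<Phi>) vs rs)))"
    have *: "Scale B ((-1) powi deg_sum us)
        (Scale B ((-1) powi eval_sign (us @ ?G # vs) ps) (ev m (map2 (app \<Phi>) (us @ ?G # vs) ps))) =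
      (\<Sum>qs\<in>pieces (ps ! ?a) ?b. X (take ?a ps) (ps ! ?a) qs (drop (Suc ?a) ps))"
      if ps: "ps \<in> pieces w (?a + 1 + ?c)" for ps
    proof -
      define ps1 p ps2 where "ps1 = take ?a ps" and "p = ps ! ?a" and "ps2 = drop (Suc ?a) ps"
      have lps: "length ps = ?a + 1 + ?c" "concat ps = w" "[] \<notin> set ps" using ps by (auto simp: pieces_def)
      then have ps_eq: "ps = ps1 @ p # ps2" and l1: "?a = length ps1" and l2: "?c = length ps2"
        by (simp_all add: ps1_def p_def ps2_def id_take_nth_drop[symmetric])
      have pne: "p \<noteq> []" using lps(3) ps_eq by auto
      have p: "path A p" using w lps(2) pne path_middle[of A "concat ps1" p "concat ps2"] ps_eq by auto
      have e1: "app \<Phi> ?G p = (\<Phi> (src (hd p)), \<Phi> (tgt (last p)), 1 + deg_sum ws + wdeg p,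
         \<Sum>qs\<in>pieces p ?b. Scale B ((-1) powi eval_sign ws qs) (ev m (map2 (app \<Phi>) ws qs)))"
        by (simp add: app_def multi_comp_path[OF p])
      have e2: "?E (map2 (app \<Phi>) ws qs) = (\<Phi> (src (hd p)), \<Phi> (tgt (last p)), 1 + deg_sum ws + wdeg p,
         ev m (map2 (app \<Phi>) ws qs))" if "qs \<in> pieces p ?b" for qs
        using map2_app_path[OF p that] Fs Fs_eq by (simp add: app_def[of id])
      have pathG: "path B (map2 (app \<Phi>) us ps1 @ app \<Phi> ?G p # map2 (app \<Phi>) vs ps2)"
      proof -
        have "path B (map2 (app \<Phi>) (us @ ?G # vs) ps)"
        proof (rule map2_app_path(1)[OF w])
          show "ps \<in> pieces w (length (us @ ?G # vs))" using ps by simp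
          have "cochain ?G" using Fs_eq by (intro M) auto
          then show "cochain H" if "H \<in> set (us @ ?G # vs)" for H
            using that Fs Fs_eq by auto
        qed
        then show ?thesis unfolding ps_eq map2_split[OF l1] .
      qed
      have mem: "ev m (map2 (app \<Phi>) ws qs) \<in> Hom B (\<Phi> (src (hd p))) (\<Phi> (tgt (last p))) (1 + (1 + deg_sum ws + wdeg p))"
        if qs: "qs \<in> pieces p ?b" for qs
        using BB.Cspace_mem[OF m, of "map2 (app \<Phi>) ws qs"] map2_app_path[OF p qs] Fs Fs_eq
        by (simp add: algebra_simps)
      have "ev m (map2 (app \<Phi>) (us @ ?G # vs) ps) =
        (\<Sum>qs\<in>pieces p ?b. Scale B ((-1) powi eval_sign ws qs)
          (ev m (map2 (app \<Phi>) us ps1 @ (\<Phi> (src (hd p)), \<Phi> (tgt (last p)), 1 + deg_sum ws + wdeg p,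
             ev m (map2 (app \<Phi>) ws qs)) # map2 (app \<Phi>) vs ps2)))"
        unfolding ps_eq map2_split[OF l1] using pathG unfolding e1
        by (rule BB.slot_sum[OF m]) (rule mem)
      also have "\<dots> = (\<Sum>qs\<in>pieces p ?b. Scale B ((-1) powi eval_sign ws qs)
          (ev m (map2 (app \<Phi>) us ps1 @ ?E (map2 (app \<Phi>) ws qs) # map2 (app \<Phi>) vs ps2)))"
        by (rule sum.cong) (simp_all only: e2)
      finally have "ev m (map2 (app \<Phi>) (us @ ?G # vs) ps) = \<dots>" .
      moreover have "take ?a ps = ps1" "ps ! ?a = p" "drop (Suc ?a) ps = ps2"
        by (simp_all add: ps1_def p_def ps2_def)
      moreover have "eval_sign (us @ ?G # vs) ps = eval_sign us ps1 + wdeg (concat ps1) * (1 + deg_sum ws + deg_sum vs)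
           + wdeg p * deg_sum vs + eval_sign vs ps2"
        unfolding ps_eq eval_sign_split[OF l1] by (simp add: algebra_simps)
      ultimately show ?thesis
        by (simp only: X_def SB.scale_sum_right SB.scale_scale ksign_add[symmetric] add.assoc)
    qed
    have "Scale B ((-1) powi deg_sum us) (ev (?M (us @ ?G # vs)) w) =
      (\<Sum>ps\<in>pieces w (?a + 1 + ?c). \<Sum>qs\<in>pieces (ps ! ?a) ?b. X (take ?a ps) (ps ! ?a) qs (drop (Suc ?a) ps))"
      by (simp only: multi_comp_path[OF w] SB.scale_sum_right, rule sum.cong) (use * in simp_all)
    also have "\<dots> = (\<Sum>rs\<in>pieces w (?a + ?b + ?c).
        X (take ?a rs) (concat (take ?b (drop ?a rs))) (take ?b (drop ?a rs)) (drop (?a + ?b) rs))"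
      using ne by (intro sum_pieces_refine) (cases ws; simp)
    also have "?a + ?b + ?c = ?n" using Fs_eq by simp
    also have "(\<Sum>rs\<in>pieces w ?n.
        X (take ?a rs) (concat (take ?b (drop ?a rs))) (take ?b (drop ?a rs)) (drop (?a + ?b) rs)) =
      (\<Sum>rs\<in>pieces w ?n. Scale B ((-1) powi eval_sign Fs rs)
      (Scale B ((-1) powi wdeg (take ?a (map2 (app \<Phi>) Fs rs)))
        (ev m (take ?a (map2 (app \<Phi>) Fs rs) @
          ?E (take ?b (drop ?a (map2 (app \<Phi>) Fs rs))) # drop (?a + ?b) (map2 (app \<Phi>) Fs rs)))))"
    proof (rule sum.cong[OF refl])
      fix rs assume rs: "rs \<in> pieces w ?n"
      define r1 r2 r3 where "r1 = take ?a rs" and "r2 = take ?b (drop ?a rs)" and "r3 = drop (?a + ?b) rs"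
      have rs_eq: "rs = r1 @ r2 @ r3" unfolding r1_def r2_def r3_def by (rule take_drop_split[symmetric])
      have l: "length us = length r1" "length ws = length r2" "length vs = length r3"
        using rs Fs_eq by (auto simp: pieces_def r1_def r2_def r3_def)
      have m2: "map2 (app \<Phi>) Fs rs = map2 (app \<Phi>) us r1 @ map2 (app \<Phi>) ws r2 @ map2 (app \<Phi>) vs r3"
        unfolding Fs_eq rs_eq using l by simp
      have t: "take ?a (map2 (app \<Phi>) Fs rs) = map2 (app \<Phi>) us r1"
        "take ?b (drop ?a (map2 (app \<Phi>) Fs rs)) = map2 (app \<Phi>) ws r2"
        "drop (?a + ?b) (map2 (app \<Phi>) Fs rs) = map2 (app \<Phi>) vs r3"
        unfolding m2 using l by simp_all
      have k: "eval_sign Fs rs = eval_sign us r1 + eval_sign ws r2 + eval_sign vs r3 + wdeg (concat r1) * (deg_sum ws + deg_sum vs)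
           + wdeg (concat r2) * deg_sum vs"
        unfolding Fs_eq rs_eq using l by (simp add: eval_sign_append algebra_simps)
      \<comment> \<open>The contracted edges carry the degrees of the operations as well as those of
        the inputs; this is the source of the sign \<open>deg_sum us\<close> in the
        relation.\<close>
      have d: "wdeg (map2 (app \<Phi>) us r1) = deg_sum us + wdeg (concat r1)"
        using l(1) by (rule wdeg_map2_app)
      show "X (take ?a rs) (concat (take ?b (drop ?a rs))) (take ?b (drop ?a rs)) (drop (?a + ?b) rs) =
        Scale B ((-1) powi eval_sign Fs rs)
      (Scale B ((-1) powi wdeg (take ?a (map2 (app \<Phi>) Fs rs)))
        (ev m (take ?a (map2 (app \<Phi>) Fs rs) @
          ?E (take ?b (drop ?a (map2 (app \<Phi>) Fs rs))) # drop (?a + ?b) (map2 (app \<Phi>) Fs rs))))"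
        unfolding t k d X_def r1_def[symmetric] r2_def[symmetric] r3_def[symmetric] SB.scale_scale ksign_add[symmetric]
        by (simp add: algebra_simps)
    qed
    finally show ?thesis .
  qed
  have "ev ?L w = (\<Sum>(i, k)\<in>?C. \<Sum>rs\<in>pieces w ?n. Scale B ((-1) powi eval_sign Fs rs)
      (Scale B ((-1) powi wdeg (take i (map2 (app \<Phi>) Fs rs)))
        (ev m (take i (map2 (app \<Phi>) Fs rs) @
          ?E (take k (drop i (map2 (app \<Phi>) Fs rs))) # drop (i + k) (map2 (app \<Phi>) Fs rs)))))"
    unfolding ev_sum sum_cuts
  proof (rule sum.cong[OF refl], clarify)
    fix i k assume ik: "1 \<le> k" "i + k \<le> length Fs"
    have "Fs = take i Fs @ take k (drop i Fs) @ drop (i + k) Fs" by (rule take_drop_split[symmetric])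
    moreover have "take k (drop i Fs) \<noteq> []" using ik by auto
    moreover have l: "length (take i Fs) = i" "length (take k (drop i Fs)) = k" using ik by auto
    ultimately show "ev (Cscale B ((-1) powi deg_sum (take i Fs)) (?M (take i Fs @
          (1 + deg_sum (take k (drop i Fs)), ?M (take k (drop i Fs))) # drop (i + k) Fs))) w =
      (\<Sum>rs\<in>pieces w ?n. Scale B ((-1) powi eval_sign Fs rs)
      (Scale B ((-1) powi wdeg (take i (map2 (app \<Phi>) Fs rs)))
        (ev m (take i (map2 (app \<Phi>) Fs rs) @
          ?E (take k (drop i (map2 (app \<Phi>) Fs rs))) # drop (i + k) (map2 (app \<Phi>) Fs rs)))))"
      using key[of "take i Fs" "take k (drop i Fs)" "drop (i + k) Fs"] unfolding ev_scale l by blast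
  qed
  also have "\<dots> = (\<Sum>rs\<in>pieces w ?n. \<Sum>z\<in>?C. Scale B ((-1) powi eval_sign Fs rs)
      (Scale B ((-1) powi wdeg (take (fst z) (map2 (app \<Phi>) Fs rs)))
        (ev m (take (fst z) (map2 (app \<Phi>) Fs rs) @
          ?E (take (snd z) (drop (fst z) (map2 (app \<Phi>) Fs rs))) # drop (fst z + snd z) (map2 (app \<Phi>) Fs rs)))))"
    by (subst sum.swap) (simp only: case_prod_unfold)
  also have "\<dots> = (\<Sum>rs\<in>pieces w ?n. Scale B ((-1) powi eval_sign Fs rs)
     (ev (gerstenhaber B B m (1, m)) (map2 (app \<Phi>) Fs rs)))"
  proof (rule sum.cong[OF refl])
    fix rs assume rs: "rs \<in> pieces w ?n"
    then have len: "length (map2 (app \<Phi>) Fs rs) = ?n" by (simp add: pieces_def)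
    have p: "path B (map2 (app \<Phi>) Fs rs)" by (rule map2_app_path(1)[OF w rs Fs])
    show "(\<Sum>z\<in>?C. Scale B ((-1) powi eval_sign Fs rs)
      (Scale B ((-1) powi wdeg (take (fst z) (map2 (app \<Phi>) Fs rs)))
        (ev m (take (fst z) (map2 (app \<Phi>) Fs rs) @
          ?E (take (snd z) (drop (fst z) (map2 (app \<Phi>) Fs rs))) # drop (fst z + snd z) (map2 (app \<Phi>) Fs rs))))) =
      Scale B ((-1) powi eval_sign Fs rs) (ev (gerstenhaber B B m (1, m)) (map2 (app \<Phi>) Fs rs))"
      unfolding gerstenhaber_path[OF p] sum_cuts len by (simp add: SB.scale_sum_right case_prod_unfold)
  qed
  also have "\<dots> = ev 0 w" unfolding mm by (simp add: ev_def)
  finally show "ev ?L w = ev 0 w" .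
next
  fix xs vs assume "\<not> composable A xs vs"
  then have z: "multi_comp A B \<Phi> m Gs xs vs = 0" for Gs by (rule multi_comp_zero)
  then show "?L xs vs = 0" by (simp add: sum_family_apply Cscale_apply case_prod_unfold)
qed simp

text \<open>The derivation property of precomposition: the part contracted by \<open>mA\<close> lies
  in exactly one piece. To reach the operation on that piece, \<open>mA\<close> moves past all later
  operations, which gives the sign.\<close>

lemma gerstenhaber_multi_comp:
  assumes m: "m \<in> Cspace B B id 2" and mA: "mA \<in> Cspace A A id 2"
    and Fs: "\<And>F. F \<in> set Fs \<Longrightarrow> cochain F"
  shows "gerstenhaber A B (multi_comp A B \<Phi> m Fs) (1, mA) =
    (\<Sum>i<length Fs. Cscale B ((-1) powi deg_sum (drop (Suc i) Fs))
      (multi_comp A B \<Phi> m (take i Fs @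
        (1 + fst (Fs ! i), gerstenhaber A B (snd (Fs ! i)) (1, mA)) # drop (Suc i) Fs)))"
    (is "_ = ?R")
proof (rule family_eqI[where A = A])
  interpret BB: quiver_map B B id using quiver_B by unfold_locales auto
  fix w assume w: "path A w"
  let ?M = "multi_comp A B \<Phi> m"
  let ?E = "app id (1, mA)"
  let ?n = "length Fs"
  have mA': "snd (1 :: int, mA) \<in> Cspace A A id (1 + fst (1 :: int, mA))" using mA by simp
  define X where "X = (\<lambda>ps a p b qs.
      Scale B ((-1) powi (wdeg (concat ps @ a) + eval_sign Fs (ps @ (a @ ?E p # b) # qs)))
        (ev m (map2 (app \<Phi>) Fs (ps @ (a @ ?E p # b) # qs))))"
  have "ev (gerstenhaber A B (?M Fs) (1, mA)) w =
    (\<Sum>(u, p, v)\<in>cuts w. \<Sum>(ps, a, b, qs)\<in>interior_pieces u v ?n. X ps a p b qs)"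
    unfolding gerstenhaber_path[OF w]
  proof (rule sum.cong[OF refl], clarify)
    fix u p v assume "(u, p, v) \<in> cuts w"
    then have e: "path A (u @ ?E p # v)" using insert_edge(1)[OF _ _ mA'] w by (auto simp: cuts_def)
    show "Scale B ((-1) powi (fst (1, mA) * wdeg u)) (ev (?M Fs) (u @ ?E p # v)) =
      (\<Sum>(ps, a, b, qs)\<in>interior_pieces u v ?n. X ps a p b qs)"
      unfolding multi_comp_path[OF e] sum_pieces_interior SB.scale_sum_right
      by (rule sum.cong) (auto simp: X_def interior_pieces_def ksign_add)
  qed
  also have "\<dots> = (\<Sum>i<?n. \<Sum>rs\<in>pieces w ?n. \<Sum>(a, p, b)\<in>cuts (rs ! i). X (take i rs) a p b (drop (Suc i) rs))"
    by (rule sum_interior_pieces)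
  also have "\<dots> = ev ?R w"
    unfolding ev_sum ev_scale
  proof (rule sum.cong[OF refl])
    fix i assume "i \<in> {..<?n}"
    then have i: "i < ?n" by simp
    define us F vs where "us = take i Fs" and "F = Fs ! i" and "vs = drop (Suc i) Fs"
    have Fs_eq: "Fs = us @ F # vs" and li: "length us = i"
      using i by (simp_all add: us_def F_def vs_def id_take_nth_drop[symmetric])
    let ?G = "(1 + fst F, gerstenhaber A B (snd F) (1, mA))"
    have cF: "cochain F" using Fs Fs_eq by auto
    have cG: "cochain ?G"
      using gerstenhaber_Cspace[OF cF mA'] by (simp add: algebra_simps)
    have len: "length (us @ ?G # vs) = ?n" by (simp add: Fs_eq)
    show "(\<Sum>rs\<in>pieces w ?n. \<Sum>(a, p, b)\<in>cuts (rs ! i). X (take i rs) a p b (drop (Suc i) rs)) =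
      Scale B ((-1) powi deg_sum (drop (Suc i) Fs))
       (ev (?M (take i Fs @ (1 + fst (Fs ! i), gerstenhaber A B (snd (Fs ! i)) (1, mA)) # drop (Suc i) Fs)) w)"
      unfolding us_def[symmetric] F_def[symmetric] vs_def[symmetric]
      unfolding multi_comp_path[OF w] len SB.scale_sum_right
    proof (rule sum.cong[OF refl])
      fix rs assume rs: "rs \<in> pieces w ?n"
      define r1 r r2 where "r1 = take i rs" and "r = rs ! i" and "r2 = drop (Suc i) rs"
      have lrs: "length rs = ?n" "concat rs = w" "[] \<notin> set rs" using rs by (auto simp: pieces_def)
      then have rs_eq: "rs = r1 @ r # r2" and l1: "length us = length r1" and l2: "length vs = length r2"
        using i by (simp_all add: r1_def r_def r2_def us_def vs_def id_take_nth_drop[symmetric])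
      have rne: "r \<noteq> []" using lrs(3) rs_eq by auto
      have r: "path A r" using w lrs(2) rne path_middle[of A "concat r1" r "concat r2"] rs_eq by auto
      let ?g = "\<lambda>z. ev (snd F) (fst z @ ?E (fst (snd z)) # snd (snd z))"
      have e1: "app \<Phi> ?G r = (\<Phi> (src (hd r)), \<Phi> (tgt (last r)), 1 + fst F + wdeg r,
         \<Sum>z\<in>cuts r. Scale B ((-1) powi wdeg (fst z)) (?g z))"
        by (simp add: app_def gerstenhaber_path[OF r] case_prod_unfold)
      have e2: "app \<Phi> F (a @ ?E p # b) = (\<Phi> (src (hd r)), \<Phi> (tgt (last r)), 1 + fst F + wdeg r, ?g (a, p, b))"
        if "(a, p, b) \<in> cuts r" for a p b
      proof -
        have "r = a @ p @ b" "p \<noteq> []" using that by (auto simp: cuts_def)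
        then show ?thesis by (cases a; cases b) (simp_all add: app_def)
      qed
      have pathG: "path B (map2 (app \<Phi>) us r1 @ app \<Phi> ?G r # map2 (app \<Phi>) vs r2)"
      proof -
        have "path B (map2 (app \<Phi>) (us @ ?G # vs) rs)"
        proof (rule map2_app_path(1)[OF w])
          show "rs \<in> pieces w (length (us @ ?G # vs))" using rs len by simp
          show "cochain H" if "H \<in> set (us @ ?G # vs)" for H
            using that cG Fs Fs_eq by auto
        qed
        then show ?thesis unfolding rs_eq map2_split[OF l1] .
      qed
      have mem: "?g z \<in> Hom B (\<Phi> (src (hd r))) (\<Phi> (tgt (last r))) (1 + (1 + fst F + wdeg r))"
        if "z \<in> cuts r" for z
      proof -
        obtain a p b where z: "z = (a, p, b)" by (cases z) auto
        with that have *: "r = a @ p @ b" "p \<noteq> []" by (auto simp: cuts_def)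
        then have "path A (a @ ?E p # b)" using insert_edge(1)[OF _ _ mA'] r by blast
        then have "app \<Phi> F (a @ ?E p # b) \<in> edges B" by (rule app_edge[OF cF])
        then show ?thesis using e2[of a p b] that z by (simp add: edges_def)
      qed
      have "ev m (map2 (app \<Phi>) (us @ ?G # vs) rs) =
        (\<Sum>z\<in>cuts r. Scale B ((-1) powi wdeg (fst z))
          (ev m (map2 (app \<Phi>) us r1 @ (\<Phi> (src (hd r)), \<Phi> (tgt (last r)), 1 + fst F + wdeg r, ?g z) # map2 (app \<Phi>) vs r2)))"
        unfolding rs_eq map2_split[OF l1] using pathG unfolding e1
        by (rule BB.slot_sum[OF m]) (rule mem)
      also have "\<dots> = (\<Sum>(a, p, b)\<in>cuts r. Scale B ((-1) powi wdeg a)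
          (ev m (map2 (app \<Phi>) Fs (r1 @ (a @ ?E p # b) # r2))))"
        unfolding Fs_eq map2_split[OF l1] by (rule sum.cong) (auto simp: e2)
      finally have ev_eq: "ev m (map2 (app \<Phi>) (us @ ?G # vs) rs) = \<dots>" .
      have "X r1 a p b r2 = Scale B ((-1) powi (deg_sum vs + eval_sign (us @ ?G # vs) rs))
          (Scale B ((-1) powi wdeg a) (ev m (map2 (app \<Phi>) Fs (r1 @ (a @ ?E p # b) # r2))))"
        if "(a, p, b) \<in> cuts r" for a p b
      proof -
        have "r = a @ p @ b" using that by (auto simp: cuts_def)
        \<comment> \<open>Contraction raises the degree of the piece by one, contributing
          \<open>deg_sum vs\<close>; on the other side the raised degree of the operation
          contributes \<open>wdeg (concat r1)\<close>.\<close>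
        then have "wdeg (concat r1 @ a) + eval_sign Fs (r1 @ (a @ ?E p # b) # r2) =
          deg_sum vs + eval_sign (us @ ?G # vs) rs + wdeg a"
          unfolding rs_eq Fs_eq eval_sign_split[OF l1] by (simp add: algebra_simps)
        then show ?thesis by (simp only: X_def SB.scale_scale ksign_add[symmetric])
      qed
      then have "(\<Sum>(a, p, b)\<in>cuts r. X r1 a p b r2) =
        (\<Sum>(a, p, b)\<in>cuts r. Scale B ((-1) powi (deg_sum vs + eval_sign (us @ ?G # vs) rs))
          (Scale B ((-1) powi wdeg a) (ev m (map2 (app \<Phi>) Fs (r1 @ (a @ ?E p # b) # r2)))))"
        by (intro sum.cong) auto
      also have "\<dots> = Scale B ((-1) powi deg_sum vs) (Scale B ((-1) powi eval_sign (us @ ?G # vs) rs)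
          (ev m (map2 (app \<Phi>) (us @ ?G # vs) rs)))"
        unfolding ev_eq ksign_add by (simp add: SB.scale_sum_right case_prod_unfold mult.assoc)
      finally show "(\<Sum>(a, p, b)\<in>cuts (rs ! i). X (take i rs) a p b (drop (Suc i) rs)) =
        Scale B ((-1) powi deg_sum vs) (Scale B ((-1) powi eval_sign (us @ ?G # vs) rs)
          (ev m (map2 (app \<Phi>) (us @ ?G # vs) rs)))"
        unfolding r1_def r_def r2_def .
    qed
  qed
  finally show "ev (gerstenhaber A B (?M Fs) (1, mA)) w = ev ?R w" .
next
  fix xs vs assume c: "\<not> composable A xs vs"
  then have z: "multi_comp A B \<Phi> m Gs xs vs = 0" for Gs by (rule multi_comp_zero)
  then show "?R xs vs = 0" by (simp add: sum_family_apply Cscale_apply)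
qed (rule gerstenhaber_zero)

end

section \<open>The operations underlying the bracket\<close>

text \<open>Degree \<open>2\<close> is degree \<open>1\<close> in the shifted space, where the
  structure maps live.\<close>

locale A_inf_pair = quiver_map A B \<Phi>
  for A :: "('k::field, 'o, 'v::ab_group_add) quiver"
    and B :: "('k, 'p, 'w::ab_group_add) quiver"
    and \<Phi> :: "'o \<Rightarrow> 'p" +
  fixes mA :: "('o, 'v, 'v) family" and mB :: "('p, 'w, 'w) family"
  assumes mA: "mA \<in> Cspace A A id 2" and mA_square: "gerstenhaber A A mA (1, mA) = 0"
    and mB: "mB \<in> Cspace B B id 2" and mB_square: "gerstenhaber B B mB (1, mB) = 0"
begin

abbreviation mcomp :: "('o, 'v, 'w) family helem list \<Rightarrow> ('o, 'v, 'w) family" where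
  "mcomp Fs \<equiv> multi_comp A B \<Phi> mB Fs"

abbreviation precomp :: "('o, 'v, 'w) family \<Rightarrow> ('o, 'v, 'w) family" where
  "precomp F \<equiv> gerstenhaber A B F (1, mA)"

text \<open>This is \<open>X\<close> of the overview, on words of any length.\<close>

definition operation :: "('o, 'v, 'w) family helem list \<Rightarrow> ('o, 'v, 'w) family" where
  "operation Fs = mcomp Fs -
     (if length Fs = 1 then Cscale B ((-1) powi fst (hd Fs)) (precomp (snd (hd Fs))) else 0)"

lemma comp_Cspace: "(\<And>F. F \<in> set Fs \<Longrightarrow> cochain F) \<Longrightarrow> mcomp Fs \<in> Cspace A B \<Phi> (deg_sum Fs + 2)"
  using multi_comp_Cspace[of mB 1 Fs] mB by (simp add: algebra_simps)

lemma precomp_Cspace: "F \<in> Cspace A B \<Phi> d \<Longrightarrow> precomp F \<in> Cspace A B \<Phi> (d + 1)"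
  using gerstenhaber_Cspace[of F d "(1, mA)"] mA by simp

lemma operation_Cspace:
  assumes "\<And>F. F \<in> set Fs \<Longrightarrow> cochain F"
  shows "operation Fs \<in> Cspace A B \<Phi> (deg_sum Fs + 2)"
proof -
  have comp: "mcomp Fs \<in> Cspace A B \<Phi> (deg_sum Fs + 2)" using assms by (rule comp_Cspace)
  show ?thesis
  proof (cases "length Fs = 1")
    case True
    then obtain F where F: "Fs = [F]" by (auto simp: length_Suc_conv)
    with assms have "precomp (snd F) \<in> Cspace A B \<Phi> (deg_sum Fs + 2)"
      using precomp_Cspace[of "snd F" "1 + fst F"] by (simp add: algebra_simps)
    with F show ?thesis
      using comp CB.subspace_diff[OF Cspace_subspace] CB.subspace_scale[OF Cspace_subspace]
      by (simp add: operation_def)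
  next
    case False
    then show ?thesis using comp by (simp add: operation_def)
  qed
qed

lemma comp_slot_linear:
  assumes "\<And>F. F \<in> set us \<union> set vs \<Longrightarrow> cochain F" "cochain (d, G)" "cochain (d, G')"
  shows "mcomp (us @ (d, Cscale B c G + Cscale B c' G') # vs) =
    Cscale B c (mcomp (us @ (d, G) # vs)) + Cscale B c' (mcomp (us @ (d, G') # vs))"
  using multi_comp_slot_linear[of mB 1 us vs d G G' c c'] assms mB by auto

lemma operation_slot_linear:
  assumes "\<And>F. F \<in> set us \<union> set vs \<Longrightarrow> cochain F" "cochain (d, G)" "cochain (d, G')"
  shows "operation (us @ (d, Cscale B c G + Cscale B c' G') # vs) =
    Cscale B c (operation (us @ (d, G) # vs)) + Cscale B c' (operation (us @ (d, G') # vs))"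
proof (cases "us = [] \<and> vs = []")
  case True
  show ?thesis
    using comp_slot_linear[of us vs d G G' c c', OF assms] True
    by (simp only: operation_def gerstenhaber_combo append.simps list.sel fst_conv snd_conv)
       (simp add: CB.scale_right_distrib CB.scale_right_diff_distrib mult.commute)
next
  case False
  then have "length (us @ x # vs) \<noteq> 1" for x by auto
  then show ?thesis using comp_slot_linear[of us vs d G G' c c', OF assms]
    by (simp only: operation_def if_False diff_zero)
qed

lemma operation_slot_sum:
  assumes us: "\<And>F. F \<in> set us \<union> set vs \<Longrightarrow> cochain F" and G: "\<And>i. i \<in> I \<Longrightarrow> cochain (d, G i)"
  shows "operation (us @ (d, \<Sum>i\<in>I. Cscale B (c i) (G i)) # vs) =
    (\<Sum>i\<in>I. Cscale B (c i) (operation (us @ (d, G i) # vs)))"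
proof -
  have 0: "cochain (d, 0)" using CB.subspace_0[OF Cspace_subspace] by simp
  have zero: "operation (us @ (d, 0) # vs) = 0"
    using operation_slot_linear[of us vs d 0 0 0 0, OF us 0 0] by (simp only: CB.scale_zero_left add_0_left)
  show ?thesis
    using G
  proof (induction I rule: infinite_finite_induct)
    case (insert i I)
    have "cochain (d, \<Sum>i\<in>I. Cscale B (c i) (G i))"
      unfolding snd_conv fst_conv
      by (intro CB.subspace_sum CB.subspace_scale Cspace_subspace) (use insert.prems in simp)
    moreover have "cochain (d, G i)" using insert.prems by simp
    ultimately have "operation (us @ (d, Cscale B (c i) (G i) + Cscale B 1 (\<Sum>i\<in>I. Cscale B (c i) (G i))) # vs) =
      Cscale B (c i) (operation (us @ (d, G i) # vs)) +
      Cscale B 1 (operation (us @ (d, \<Sum>i\<in>I. Cscale B (c i) (G i)) # vs))"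
      using us by (intro operation_slot_linear)
    moreover have "operation (us @ (d, \<Sum>i\<in>I. Cscale B (c i) (G i)) # vs) =
      (\<Sum>i\<in>I. Cscale B (c i) (operation (us @ (d, G i) # vs)))"
      using insert.prems by (intro insert.IH) simp
    ultimately show ?case by (simp only: sum.insert[OF insert.hyps] CB.scale_one)
  next
    case (infinite I)
    show ?case unfolding sum.infinite[OF infinite.hyps] by (rule zero)
  next
    case empty
    show ?case unfolding sum.empty by (rule zero)
  qed
qed

text \<open>The terms with \<open>mcomp\<close> in both places cancel by
  \<open>multi_comp_relation\<close>. Corrections inside arise from one-letter parts and sum up to
  \<open>precomp (mcomp Fs)\<close> by \<open>gerstenhaber_multi_comp\<close>; the correction
  outside arises only when the part is the whole word, and it cancels them.\<close>

lemma operation_relation: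
  assumes Fs: "\<And>F. F \<in> set Fs \<Longrightarrow> cochain F"
  shows "(\<Sum>(us, ws, vs)\<in>cuts Fs. Cscale B ((-1) powi deg_sum us)
     (operation (us @ (1 + deg_sum ws, operation ws) # vs))) = 0"
proof (cases "Fs = []")
  case True
  then have "cuts Fs = {}" by (auto simp: cuts_def)
  then show ?thesis by simp
next
  case ne: False
  let ?c = "\<lambda>d. (-1) powi d :: 'k"
  let ?S = "\<lambda>us G vs. Cscale B (?c (deg_sum us)) (mcomp (us @ G # vs))"
  let ?F' = "\<lambda>F. (1 + fst F, precomp (snd F))"
  have term_eq: "Cscale B (?c (deg_sum us)) (operation (us @ (1 + deg_sum ws, operation ws) # vs)) =
      ?S us (1 + deg_sum ws, mcomp ws) vs
      - (if length ws = 1 then Cscale B (?c (deg_sum us + fst (hd ws))) (mcomp (us @ ?F' (hd ws) # vs)) else 0)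
      + (if (us, ws, vs) = ([], Fs, []) then Cscale B (?c (deg_sum Fs)) (precomp (operation Fs)) else 0)"
    if z: "(us, ws, vs) \<in> cuts Fs" for us ws vs
  proof -
    from z have Fs_eq: "Fs = us @ ws @ vs" and wne: "ws \<noteq> []" by (auto simp: cuts_def)
    have cu: "\<And>F. F \<in> set us \<union> set vs \<Longrightarrow> cochain F" and cw: "\<And>F. F \<in> set ws \<Longrightarrow> cochain F"
      using Fs Fs_eq by auto
    have c1: "cochain (1 + deg_sum ws, mcomp ws)" using comp_Cspace[of ws, OF cw] by (simp add: algebra_simps)
    have a: "mcomp (us @ (1 + deg_sum ws, operation ws) # vs) = mcomp (us @ (1 + deg_sum ws, mcomp ws) # vs) -
       (if length ws = 1 then Cscale B (?c (fst (hd ws))) (mcomp (us @ ?F' (hd ws) # vs)) else 0)"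
    proof (cases "length ws = 1")
      case True
      then obtain F where F: "ws = [F]" by (auto simp: length_Suc_conv)
      have c2: "cochain (1 + deg_sum ws, precomp (snd F))"
        using precomp_Cspace[of "snd F" "1 + fst F"] cw F by (simp add: algebra_simps)
      have "operation ws = Cscale B 1 (mcomp ws) + Cscale B (- ?c (fst F)) (precomp (snd F))"
        unfolding operation_def using F by simp
      then show ?thesis
        using comp_slot_linear[of us vs, OF cu c1 c2, of 1 "- ?c (fst F)"] F by simp
    qed (simp add: operation_def)
    have b: "operation (us @ (1 + deg_sum ws, operation ws) # vs) =
      mcomp (us @ (1 + deg_sum ws, operation ws) # vs) +
      (if (us, ws, vs) = ([], Fs, []) then Cscale B (?c (deg_sum Fs)) (precomp (operation Fs)) else 0)"
    proof (cases "us = [] \<and> vs = []")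
      case True
      then have [simp]: "us = []" "vs = []" "ws = Fs" using Fs_eq by auto
      \<comment> \<open>The inner operation has raised the degree by one, so the correction
        subtracted in \<open>operation\<close> enters with a plus sign.\<close>
      have "?c (1 + deg_sum Fs) = - ?c (deg_sum Fs)" by (simp add: ksign_if)
      then show ?thesis by (simp add: operation_def[of "[_]"])
    next
      case False
      then have "length (us @ x # vs) \<noteq> 1" for x :: "('o, 'v, 'w) family helem" by auto
      moreover have "(us, ws, vs) \<noteq> ([], Fs, [])" using False by auto
      ultimately show ?thesis by (simp only: operation_def[of "us @ _"] if_False diff_zero add_0_right)
    qed
    have u: "us = [] \<Longrightarrow> ?c (deg_sum us) = 1" by simp
    show ?thesis
      unfolding b a using u by (auto simp: CB.scale_right_distrib CB.scale_right_diff_distrib ksign_add)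
  qed
  have single: "(\<Sum>(us, ws, vs)\<in>cuts Fs. if (us, ws, vs) = ([], Fs, []) then Z else 0) = Z" for Z :: "('o, 'v, 'w) family"
  proof -
    have "([], Fs, []) \<in> cuts Fs" using ne by (simp add: cuts_def)
    moreover have "(\<Sum>(us, ws, vs)\<in>cuts Fs. if (us, ws, vs) = ([], Fs, []) then Z else 0) =
      (\<Sum>z\<in>cuts Fs. if ([], Fs, []) = z then Z else 0)"
      by (rule sum.cong) auto
    ultimately show ?thesis by (simp add: sum.delta)
  qed
  have pre: "precomp (mcomp Fs) = (\<Sum>i<length Fs. Cscale B (?c (deg_sum (drop (Suc i) Fs)))
      (mcomp (take i Fs @ ?F' (Fs ! i) # drop (Suc i) Fs)))"
    by (rule gerstenhaber_multi_comp[OF mB mA Fs])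
  \<comment> \<open>Only a one-letter word has an inner correction, and \<open>mA_square\<close>
    makes its second precomposition vanish.\<close>
  have square: "precomp (operation Fs) = precomp (mcomp Fs)"
  proof (cases "length Fs = 1")
    case True
    then obtain F where F: "Fs = [F]" by (auto simp: length_Suc_conv)
    have "precomp (precomp (snd F)) = 0"
      using F Fs by (intro gerstenhaber_square[OF _ mA mA_square]) auto
    with F show ?thesis
      by (simp add: operation_def gerstenhaber_diff gerstenhaber_scale)
  qed (simp add: operation_def)
  have "(\<Sum>(us, ws, vs)\<in>cuts Fs. Cscale B (?c (deg_sum us))
     (operation (us @ (1 + deg_sum ws, operation ws) # vs))) =
    (\<Sum>(us, ws, vs)\<in>cuts Fs. ?S us (1 + deg_sum ws, mcomp ws) vs)
    - (\<Sum>(us, ws, vs)\<in>cuts Fs. if length ws = 1 then Cscale B (?c (deg_sum us + fst (hd ws))) (mcomp (us @ ?F' (hd ws) # vs)) else 0)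
    + (\<Sum>(us, ws, vs)\<in>cuts Fs. if (us, ws, vs) = ([], Fs, []) then Cscale B (?c (deg_sum Fs)) (precomp (operation Fs)) else 0)"
  proof -
    have "(\<Sum>(us, ws, vs)\<in>cuts Fs. Cscale B (?c (deg_sum us))
       (operation (us @ (1 + deg_sum ws, operation ws) # vs))) =
      (\<Sum>z\<in>cuts Fs. (case z of (us, ws, vs) \<Rightarrow> ?S us (1 + deg_sum ws, mcomp ws) vs)
        - (case z of (us, ws, vs) \<Rightarrow> if length ws = 1 then Cscale B (?c (deg_sum us + fst (hd ws))) (mcomp (us @ ?F' (hd ws) # vs)) else 0)
        + (case z of (us, ws, vs) \<Rightarrow> if (us, ws, vs) = ([], Fs, []) then Cscale B (?c (deg_sum Fs)) (precomp (operation Fs)) else 0))"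
      by (rule sum.cong[OF refl], clarify, simp only: prod.case term_eq)
    then show ?thesis by (simp only: sum.distrib sum_subtractf)
  qed
  also have "(\<Sum>(us, ws, vs)\<in>cuts Fs. ?S us (1 + deg_sum ws, mcomp ws) vs) = 0"
    by (rule multi_comp_relation[OF mB mB_square Fs])
  also have "(\<Sum>(us, ws, vs)\<in>cuts Fs. if length ws = 1
      then Cscale B (?c (deg_sum us + fst (hd ws))) (mcomp (us @ ?F' (hd ws) # vs)) else 0) =
    (\<Sum>i<length Fs. Cscale B (?c (deg_sum (take i Fs) + fst (Fs ! i))) (mcomp (take i Fs @ ?F' (Fs ! i) # drop (Suc i) Fs)))"
    by (rule sum_cuts_singleton)
  also have "\<dots> = Cscale B (?c (deg_sum Fs)) (precomp (mcomp Fs))"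
    unfolding pre CB.scale_sum_right
  proof (rule sum.cong[OF refl])
    fix i assume "i \<in> {..<length Fs}"
    then have "take i Fs @ Fs ! i # drop (Suc i) Fs = Fs" by (simp add: id_take_nth_drop[symmetric])
    from arg_cong[OF this, of deg_sum]
    have "deg_sum Fs = deg_sum (take i Fs) + fst (Fs ! i) + deg_sum (drop (Suc i) Fs)"
      unfolding map_append sum_list.append by simp
    then have "?c (deg_sum (take i Fs) + fst (Fs ! i)) = ?c (deg_sum Fs) * ?c (deg_sum (drop (Suc i) Fs))"
      unfolding ksign_add[symmetric] by (intro ksign_cong) simp
    then show "Cscale B (?c (deg_sum (take i Fs) + fst (Fs ! i))) (mcomp (take i Fs @ ?F' (Fs ! i) # drop (Suc i) Fs)) =
      Cscale B (?c (deg_sum Fs)) (Cscale B (?c (deg_sum (drop (Suc i) Fs)))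
        (mcomp (take i Fs @ ?F' (Fs ! i) # drop (Suc i) Fs)))"
      by simp
  qed
  finally show ?thesis by (simp only: single square diff_0 left_minus)
qed

end

section \<open>Koszul signs of permutations\<close>

text \<open>
  The reference order is the descending one, so a pair contributes when it occurs in ascending order.
\<close>

fun koszul_sign :: "(nat \<Rightarrow> int) \<Rightarrow> nat list \<Rightarrow> int" where
  "koszul_sign d [] = 0"
| "koszul_sign d (w # ws) = (\<Sum>u\<leftarrow>ws. if w < u then d w * d u else 0) + koszul_sign d ws"

text \<open>The part of the Koszul exponent due to pairs with one letter in each of two blocks, the
  \<open>U\<close> block standing first.\<close>

definition cross :: "(nat \<Rightarrow> int) \<Rightarrow> nat set \<Rightarrow> nat set \<Rightarrow> int" where
  "cross d U W = (\<Sum>u\<in>U. \<Sum>w\<in>W. if u < w then d u * d w else 0)"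

text \<open>For \<open>I = {1..k}\<close> this is the exponent \<open>\<Sum> (j-1)|F\<^sub>j|\<close> in the definition of the bracket.\<close>

definition rank_sum :: "(nat \<Rightarrow> int) \<Rightarrow> nat set \<Rightarrow> int" where
  "rank_sum d I = (\<Sum>i\<in>I. int (card {j\<in>I. j < i}) * d i)"

lemma sum_list_distinct: "distinct ws \<Longrightarrow> (\<Sum>u\<leftarrow>ws. f u) = (\<Sum>u\<in>set ws. f u)"
  by (simp add: sum_list_distinct_conv_sum_set)

lemma cross_Un_right: "finite U \<Longrightarrow> finite V \<Longrightarrow> U \<inter> V = {} \<Longrightarrow> cross d W (U \<union> V) = cross d W U + cross d W V"
  by (simp add: cross_def sum.union_disjoint sum.distrib)

lemma koszul_sign_append:
  "distinct (us @ ws) \<Longrightarrow> koszul_sign d (us @ ws) = koszul_sign d us + koszul_sign d ws + cross d (set us) (set ws)"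
proof (induction us)
  case Nil
  then show ?case by (simp add: cross_def)
next
  case (Cons u us)
  have "cross d (set (u # us)) (set ws) = (\<Sum>w\<in>set ws. if u < w then d u * d w else 0) + cross d (set us) (set ws)"
    using Cons.prems by (simp add: cross_def)
  with Cons show ?case
    by (simp add: sum_list_distinct[of ws])
qed

text \<open>For disjoint blocks each pair is ascending in exactly one of the two
  arrangements.\<close>

lemma cross_swap:
  assumes "U \<inter> W = {}"
  shows "cross d U W + cross d W U = (\<Sum>u\<in>U. d u) * (\<Sum>w\<in>W. d w)"
proof -
  have "cross d U W + cross d W U = (\<Sum>u\<in>U. \<Sum>w\<in>W. (if u < w then d u * d w else 0) + (if w < u then d w * d u else 0))"
    unfolding cross_def by (subst sum.swap[of _ U W]) (simp only: sum.distrib)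
  also have "\<dots> = (\<Sum>u\<in>U. \<Sum>w\<in>W. d u * d w)"
    using assms by (intro sum.cong refl) (auto simp: mult.commute)
  finally show ?thesis by (simp add: sum_product)
qed

text \<open>The sign compares letters and does nothing else with them, so increasing relabelling
  only moves the degrees along.\<close>

lemma koszul_sign_strict_mono:
  assumes "strict_mono_on I e" "set ws \<subseteq> I"
  shows "koszul_sign d (map e ws) = koszul_sign (d \<circ> e) ws"
  using assms(2)
proof (induction ws)
  case (Cons w ws)
  then have "e w < e u \<longleftrightarrow> w < u" if "u \<in> set ws" for u
    using assms(1) that by (auto simp: strict_mono_on_less)
  then have "(\<Sum>u\<leftarrow>ws. if e w < e u then d (e w) * d (e u) else 0) =
    (\<Sum>u\<leftarrow>ws. if w < u then d (e w) * d (e u) else 0)"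
    by (intro arg_cong[where f = sum_list] map_cong) auto
  with Cons show ?case by (simp add: o_def)
qed simp

text \<open>No label lies between \<open>a\<close> and \<open>Suc a\<close>, so exchanging them
  alters the comparison of that one pair only. The change can be plus or minus the product of
  degrees, hence a statement about parity.\<close>

lemma koszul_sign_transpose:
  assumes "distinct ws"
  shows "even (koszul_sign d (map (transpose a (Suc a)) ws) - koszul_sign (d \<circ> transpose a (Suc a)) ws -
    (if a \<in> set ws \<and> Suc a \<in> set ws then d a * d (Suc a) else 0))"
  using assms
proof (induction ws)
  case (Cons w ws)
  let ?t = "transpose a (Suc a)"
  \<comment> \<open>\<open>p u\<close> is the effect on the pair \<open>(w, u)\<close> of comparing
    transposed instead of original labels; it can be nonzero only if \<open>w\<close> and
    \<open>u\<close> are the two exchanged labels.\<close>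
  define p where "p = (\<lambda>u. (if ?t w < ?t u then d (?t w) * d (?t u) else 0) -
    (if w < u then d (?t w) * d (?t u) else 0))"
  define \<delta> where "\<delta> = (if w = a \<and> Suc a \<in> set ws \<or> w = Suc a \<and> a \<in> set ws then d a * d (Suc a) else 0)"
  have w: "w \<notin> set ws" and dist: "distinct ws" using Cons.prems by auto
  have t: "?t u = (if u = a then Suc a else if u = Suc a then a else u)" for u
    by (simp add: transpose_def)
  consider "w = a" | "w = Suc a" | "w \<noteq> a" "w \<noteq> Suc a" by blast
  then have "even ((\<Sum>u\<in>set ws. p u) - \<delta>)"
  proof cases
    case 1
    have "(\<Sum>u\<in>set ws. p u) = (\<Sum>u\<in>set ws. if u = Suc a then - (d a * d (Suc a)) else 0)"
      unfolding p_def using 1 w by (intro sum.cong refl) (auto simp: t)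
    also have "\<dots> = (if Suc a \<in> set ws then - (d a * d (Suc a)) else 0)" by simp
    finally show ?thesis using 1 by (simp add: \<delta>_def)
  next
    case 2
    have "(\<Sum>u\<in>set ws. p u) = (\<Sum>u\<in>set ws. if u = a then d a * d (Suc a) else 0)"
      unfolding p_def using 2 w by (intro sum.cong refl) (auto simp: t)
    also have "\<dots> = (if a \<in> set ws then d a * d (Suc a) else 0)" by simp
    finally show ?thesis using 2 by (simp add: \<delta>_def)
  next
    case 3
    have "(\<Sum>u\<in>set ws. p u) = 0"
      unfolding p_def using 3 w by (intro sum.neutral) (auto simp: t)
    then show ?thesis using 3 by (simp add: \<delta>_def)
  qed
  moreover have "(\<Sum>u\<in>set ws. p u) = (\<Sum>u\<leftarrow>map ?t ws. if ?t w < u then d (?t w) * d u else 0) -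
      (\<Sum>u\<leftarrow>ws. if w < u then (d \<circ> ?t) w * (d \<circ> ?t) u else 0)"
    unfolding o_def using dist by (simp add: p_def sum_list_distinct sum_subtractf o_def)
  moreover have "(if a \<in> set (w # ws) \<and> Suc a \<in> set (w # ws) then d a * d (Suc a) else 0) =
     \<delta> + (if a \<in> set ws \<and> Suc a \<in> set ws then d a * d (Suc a) else 0)"
    using w by (auto simp: \<delta>_def)
  ultimately have "koszul_sign d (map ?t (w # ws)) - koszul_sign (d \<circ> ?t) (w # ws) -
      (if a \<in> set (w # ws) \<and> Suc a \<in> set (w # ws) then d a * d (Suc a) else 0) =
    ((\<Sum>u\<in>set ws. p u) - \<delta>) + (koszul_sign d (map ?t ws) - koszul_sign (d \<circ> ?t) ws -
      (if a \<in> set ws \<and> Suc a \<in> set ws then d a * d (Suc a) else 0))"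
    by (simp only: list.map koszul_sign.simps)
  then show ?case using \<open>even ((\<Sum>u\<in>set ws. p u) - \<delta>)\<close> Cons.IH[OF dist] by (simp only: even_add)
qed simp

text \<open>Applied to the outer bracket, where \<open>N\<close> stands for the inner one and splits
  each ordering of the other arguments at its place.\<close>

lemma sum_permutations_insert:
  assumes "N \<notin> J" "finite J"
  shows "(\<Sum>ws\<in>permutations_of_set (insert N J). h ws) =
    (\<Sum>(us, vs)\<in>{(us, vs). us @ vs \<in> permutations_of_set J}. h (us @ N # vs))"
proof -
  let ?P = "{(us, vs). us @ vs \<in> permutations_of_set J}"
  let ?g = "\<lambda>(us, vs). us @ N # vs"
  have "bij_betw ?g ?P (permutations_of_set (insert N J))"
    unfolding bij_betw_def
  proof
    show "inj_on ?g ?P"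
    proof (rule inj_onI)
      fix x y assume "x \<in> ?P" "y \<in> ?P" and eq: "?g x = ?g y"
      then have "N \<notin> set (fst x)" "N \<notin> set (snd x)" "N \<notin> set (fst y)" "N \<notin> set (snd y)"
        using assms(1) by (auto simp: permutations_of_set_def)
      with eq show "x = y"
        by (auto simp: case_prod_unfold append_Cons_eq_iff prod_eq_iff)
    qed
    show "?g ` ?P = permutations_of_set (insert N J)"
    proof (intro set_eqI iffI)
      fix ws assume ws: "ws \<in> permutations_of_set (insert N J)"
      then have "N \<in> set ws" by (auto simp: permutations_of_set_def)
      then obtain us vs where "ws = us @ N # vs" by (meson split_list)
      with ws assms(1) have "(us, vs) \<in> ?P" by (auto simp: permutations_of_set_def)
      with \<open>ws = _\<close> show "ws \<in> ?g ` ?P" by (auto intro!: image_eqI[of _ _ "(us, vs)"])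
    qed (use assms(1) in \<open>auto simp: permutations_of_set_def\<close>)
  qed
  from sum.reindex_bij_betw[OF this, of h] show ?thesis by (simp add: case_prod_unfold)
qed

lemma finite_split_permutations: "finite J \<Longrightarrow> finite {(us, vs). us @ vs \<in> permutations_of_set J}"
proof -
  assume "finite J"
  have "{(us, vs). us @ vs \<in> permutations_of_set J} =
    (\<Union>ws\<in>permutations_of_set J. {(us, vs). us @ vs = ws})" by auto
  then show ?thesis using \<open>finite J\<close> by simp
qed

lemma sum_permutations_cuts:
  "(\<Sum>k=1..n. \<Sum>I | I \<subseteq> {1..n} \<and> card I = k.
     \<Sum>(us, vs)\<in>{(us, vs). us @ vs \<in> permutations_of_set ({1..n} - I)}. \<Sum>ws\<in>permutations_of_set I. g us ws vs) =
   (\<Sum>w\<in>permutations_of_set {1..n::nat}. \<Sum>(us, ws, vs)\<in>cuts w. g us ws vs)"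
proof -
  let ?Q = "\<lambda>I. {(us, vs). us @ vs \<in> permutations_of_set ({1..n} - I)} \<times> permutations_of_set I"
  let ?K = "SIGMA k:{1..n}. {I. I \<subseteq> {1..n} \<and> card I = k}"
  have fin: "finite {I. I \<subseteq> {1..n} \<and> card I = k}" for k
    by (rule finite_subset[of _ "Pow {1..n}"]) auto
  have finQ: "finite (?Q I)" if "I \<subseteq> {1..n}" for I
    using that finite_split_permutations[of "{1..n} - I"] by (simp add: finite_subset)
  have "(\<Sum>k=1..n. \<Sum>I | I \<subseteq> {1..n} \<and> card I = k.
     \<Sum>(us, vs)\<in>{(us, vs). us @ vs \<in> permutations_of_set ({1..n} - I)}. \<Sum>ws\<in>permutations_of_set I. g us ws vs) =
    (\<Sum>k=1..n. \<Sum>I | I \<subseteq> {1..n} \<and> card I = k. \<Sum>z\<in>?Q I. g (fst (fst z)) (snd z) (snd (fst z)))"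
    by (simp add: sum.cartesian_product' case_prod_unfold)
  also have "\<dots> = (\<Sum>(k, I)\<in>?K. \<Sum>z\<in>?Q I. g (fst (fst z)) (snd z) (snd (fst z)))"
    by (rule sum.Sigma) (use fin in auto)
  also have "\<dots> = (\<Sum>x\<in>?K. \<Sum>z\<in>?Q (snd x). g (fst (fst z)) (snd z) (snd (fst z)))"
    by (simp add: case_prod_unfold)
  also have "\<dots> = (\<Sum>(x, z)\<in>(SIGMA x:?K. ?Q (snd x)). g (fst (fst z)) (snd z) (snd (fst z)))"
    by (rule sum.Sigma) (use fin finQ in auto)
  also have "\<dots> = (\<Sum>(w, y)\<in>(SIGMA w:permutations_of_set {1..n}. cuts w). g (fst y) (fst (snd y)) (snd (snd y)))"
  \<comment> \<open>The subset is recovered as the set of letters of the marked part, its size as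
    the length of that part.\<close>
  proof (rule sum.reindex_bij_witness[where j = "\<lambda>(x, ((us, vs), ws)). (us @ ws @ vs, (us, ws, vs))"
        and i = "\<lambda>(w, (us, ws, vs)). ((length ws, set ws), ((us, vs), ws))"])
    fix a assume a: "a \<in> (SIGMA x:?K. ?Q (snd x))"
    then obtain k I us vs ws where [simp]: "a = ((k, I), ((us, vs), ws))" by (metis surj_pair)
    from a have *: "1 \<le> k" "I \<subseteq> {1..n}" "card I = k" "set us \<union> set vs = {1..n} - I" "distinct (us @ vs)"
      "set ws = I" "distinct ws" by (auto simp: permutations_of_set_def)
    then show "(\<lambda>(w, (us, ws, vs)). ((length ws, set ws), ((us, vs), ws)))
      ((\<lambda>(x, ((us, vs), ws)). (us @ ws @ vs, (us, ws, vs))) a) = a"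
      by (auto simp: distinct_card)
    have "ws \<noteq> []" using * by auto
    moreover have "set (us @ ws @ vs) = {1..n}" using * by auto
    moreover have "distinct (us @ ws @ vs)" using * by auto
    ultimately show "(\<lambda>(x, ((us, vs), ws)). (us @ ws @ vs, (us, ws, vs))) a \<in> (SIGMA w:permutations_of_set {1..n}. cuts w)"
      by (auto simp: permutations_of_set_def cuts_def)
  next
    fix b assume b: "b \<in> (SIGMA w:permutations_of_set {1..n}. cuts w)"
    then obtain w us ws vs where [simp]: "b = (w, (us, ws, vs))" by (metis surj_pair)
    from b have "w \<in> permutations_of_set {1..n}" "(us, ws, vs) \<in> cuts w" by simp_all
    then have w: "w = us @ ws @ vs" "ws \<noteq> []" "set w = {1..n}" "distinct w"
      unfolding permutations_of_set_def cuts_def by simp_all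
    then have *: "distinct (us @ ws @ vs)" by simp
    then have "length ws = card (set ws)" by (simp add: distinct_card)
    moreover have "set ws \<subseteq> {1..n}" unfolding w(3)[symmetric] using w(1) by auto
    moreover from this have "card (set ws) \<le> card {1..n}" by (intro card_mono) auto
    moreover have "set us \<union> set vs = {1..n} - set ws" unfolding w(3)[symmetric] using w(1) * by auto
    ultimately show "(\<lambda>(w, (us, ws, vs)). ((length ws, set ws), ((us, vs), ws))) b \<in> (SIGMA x:?K. ?Q (snd x))"
      using * w(2) by (simp add: permutations_of_set_def Suc_le_eq card_gt_0_iff Int_Un_distrib)
  qed (auto simp: cuts_def)
  also have "\<dots> = (\<Sum>w\<in>permutations_of_set {1..n}. \<Sum>y\<in>cuts w. g (fst y) (fst (snd y)) (snd (snd y)))"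
    by (rule sum.Sigma[symmetric]) auto
  finally show ?thesis by (simp add: case_prod_unfold)
qed

text \<open>
  The outer bracket has the inner one as its leading argument; it gets the index \<open>n + 1\<close> and has degree \<open>D\<close>.
  The sign remaining after comparison with the ordering \<open>us @ ws @ vs\<close> depends on the ordering only through
  the Koszul signs, hence can be pulled out of the sum over all subsets.
\<close>

lemma jacobi_sign_parity:
  fixes l :: "nat \<Rightarrow> 'l helem"
  assumes part: "us @ ws @ vs \<in> permutations_of_set {1..n}"
  defines "d \<equiv> \<lambda>i. fst (l i) - 1" and "I \<equiv> set ws" and "J \<equiv> {1..n} - set ws"
  assumes D: "D = (\<Sum>i\<in>I. d i) + 1" and d': "\<And>i. i \<in> J \<Longrightarrow> d' i = d i" "d' (Suc n) = D"
    and deg: "deg = (\<Sum>u\<in>set us. d u)"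
  shows "even (int (card I) + jacobi_sign l n I + rank_sum d' (insert (Suc n) J) +
      (koszul_sign d (us @ vs) + D * deg) + rank_sum d I + koszul_sign d ws
      - ((\<Sum>j=1..n. (int j - 1) * d j) + int n + koszul_sign d (us @ ws @ vs) + deg))"
proof -
  let ?U = "set us" and ?V = "set vs"
  have dist: "distinct (us @ ws @ vs)" and un: "?U \<union> I \<union> ?V = {1..n}"
    using part by (auto simp: permutations_of_set_def I_def)
  have J: "J = ?U \<union> ?V" "?U \<inter> ?V = {}" "?U \<inter> I = {}" "I \<inter> ?V = {}" and fin: "finite I" "finite J"
    using dist un by (auto simp: J_def I_def)
  have IJ: "I \<inter> J = {}" "I \<union> J = {1..n}" using un by (auto simp: J_def I_def)
  define P where "P = (\<Sum>(i, i')\<in>{(i, i'). i \<in> I \<and> i' \<in> I \<and> i < i'}. fst (l i) * fst (l i') + 1)"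
  define b where "b = (\<Sum>i\<in>I. int (card {s\<in>J. i < s}) * d i)"
  define b' where "b' = (\<Sum>i\<in>I. int (card {s\<in>J. s < i}) * d i)"
  define c where "c = (\<Sum>s\<in>J. int (card {i\<in>I. i < s}) * d s)"
  define e where "e = (\<Sum>i\<in>I. \<Sum>s\<in>J. if i < s then 1 else 0 :: int)"
  \<comment> \<open>With \<open>fst (l i) = d i + 1\<close> the summand for \<open>i < s\<close> is
    \<open>d i * d s + d i + d s + 2\<close>, giving \<open>cross\<close>, \<open>b\<close>,
    \<open>c\<close> and \<open>2 * e\<close> for \<open>s\<close> in \<open>J\<close>. Pairs inside
    \<open>I\<close> occur in both sums of \<open>jacobi_sign\<close>, hence
    \<open>2 * P\<close>.\<close>
  have jac: "jacobi_sign l n I = 2 * P + (cross d I J + b + c + 2 * e)"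
  proof -
    have Pe: "P = (\<Sum>i\<in>I. \<Sum>s\<in>I. if i < s then fst (l i) * fst (l s) + 1 else 0)"
    proof -
      have "P = (\<Sum>z\<in>I \<times> I. if fst z < snd z then fst (l (fst z)) * fst (l (snd z)) + 1 else 0)"
        unfolding P_def by (rule sum.mono_neutral_cong_left) (use fin in auto)
      then show ?thesis by (simp add: sum.cartesian_product case_prod_unfold)
    qed
    have inner: "(\<Sum>s\<in>{i+1..n}. fst (l i) * fst (l s) + 1) =
      (\<Sum>s\<in>I. if i < s then fst (l i) * fst (l s) + 1 else 0) +
      (\<Sum>s\<in>J. if i < s then fst (l i) * fst (l s) + 1 else 0)" if "i \<in> I" for i
    proof -
      have "i \<ge> 1" using that IJ by auto
      have "(\<Sum>s\<in>{i+1..n}. fst (l i) * fst (l s) + 1) = (\<Sum>s\<in>{1..n}. if i < s then fst (l i) * fst (l s) + 1 else 0)"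
        by (rule sum.mono_neutral_cong_left) auto
      then show ?thesis unfolding IJ(2)[symmetric] using fin IJ(1) by (simp add: sum.union_disjoint)
    qed
    have "(\<Sum>i\<in>I. \<Sum>s\<in>J. if i < s then fst (l i) * fst (l s) + 1 else 0) =
      (\<Sum>i\<in>I. \<Sum>s\<in>J. (if i < s then d i * d s else 0) + (if i < s then d i else 0) +
         (if i < s then d s else 0) + 2 * (if i < s then 1 else 0))"
      by (intro sum.cong refl) (auto simp: d_def algebra_simps)
    also have "\<dots> = cross d I J + (\<Sum>i\<in>I. \<Sum>s\<in>J. if i < s then d i else 0) +
      (\<Sum>i\<in>I. \<Sum>s\<in>J. if i < s then d s else 0) + 2 * e"
      unfolding cross_def e_def by (simp only: sum.distrib sum_distrib_left)
    also have "(\<Sum>i\<in>I. \<Sum>s\<in>J. if i < s then d i else 0) = b"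
      unfolding b_def using fin by (intro sum.cong refl) (simp add: sum.inter_filter[symmetric])
    also have "(\<Sum>i\<in>I. \<Sum>s\<in>J. if i < s then d s else 0) = c"
      unfolding c_def using fin by (subst sum.swap, intro sum.cong refl) (simp add: sum.inter_filter[symmetric])
    finally show ?thesis
      unfolding jacobi_sign_def P_def[symmetric] using inner Pe by (simp add: sum.distrib)
  qed
  \<comment> \<open>The new index exceeds all of \<open>J\<close>: its own rank is
    \<open>card J\<close>, and the other ranks are unchanged.\<close>
  have rk: "rank_sum d' (insert (Suc n) J) = rank_sum d J + int (card J) * D"
  proof -
    have lt: "j < Suc n" if "j \<in> J" for j using that by (auto simp: J_def)
    have N: "Suc n \<notin> J" by (auto simp: J_def)
    have "{j \<in> insert (Suc n) J. j < Suc n} = J" using lt by auto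
    moreover have "{j \<in> insert (Suc n) J. j < i} = {j \<in> J. j < i}" if "i \<in> J" for i using lt[OF that] by auto
    ultimately show ?thesis
      unfolding rank_sum_def sum.insert[OF fin(2) N] using d' by (simp add: algebra_simps)
  qed
  \<comment> \<open>The \<open>j - 1\<close> smaller indices are split into those in
    \<open>I\<close> and those in \<open>J\<close>.\<close>
  have const: "(\<Sum>j=1..n. (int j - 1) * d j) = rank_sum d I + b' + rank_sum d J + c"
  proof -
    have "int j - 1 = int (card {i\<in>I. i < j}) + int (card {s\<in>J. s < j})" if "j \<in> {1..n}" for j
    proof -
      have "{i\<in>I. i < j} \<union> {s\<in>J. s < j} = {1..<j}" using IJ that by fastforce
      moreover have disj: "{i\<in>I. i < j} \<inter> {s\<in>J. s < j} = {}" using IJ(1) by auto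
      ultimately have "card {i\<in>I. i < j} + card {s\<in>J. s < j} = j - 1"
        using card_Un_disjoint[of "{i\<in>I. i < j}" "{s\<in>J. s < j}"] fin disj by simp
      then show ?thesis using that by (metis atLeastAtMost_iff of_nat_1 of_nat_add of_nat_diff)
    qed
    then have "(\<Sum>j=1..n. (int j - 1) * d j) =
      (\<Sum>j\<in>{1..n}. int (card {i\<in>I. i < j}) * d j + int (card {s\<in>J. s < j}) * d j)"
      by (intro sum.cong refl) (simp add: algebra_simps)
    also have "\<dots> = rank_sum d I + b' + (rank_sum d J + c)"
      unfolding IJ(2)[symmetric] sum.union_disjoint[OF fin IJ(1)]
      by (simp add: rank_sum_def b'_def c_def sum.distrib)
    finally show ?thesis by simp
  qed
  have bb': "b + b' = (\<Sum>i\<in>I. d i) * int (card J)"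
  proof -
    have "int (card {s\<in>J. i < s}) + int (card {s\<in>J. s < i}) = int (card J)" if "i \<in> I" for i
    proof -
      have "i \<notin> J" using IJ(1) that by auto
      then have "x \<noteq> i" if "x \<in> J" for x using that by auto
      then have "{s\<in>J. i < s} \<union> {s\<in>J. s < i} = J" by (auto simp: neq_iff)
      moreover have "{s\<in>J. i < s} \<inter> {s\<in>J. s < i} = {}" by auto
      ultimately have "card J = card {s\<in>J. i < s} + card {s\<in>J. s < i}"
        using card_Un_disjoint[of "{s\<in>J. i < s}" "{s\<in>J. s < i}"] fin by simp
      then show ?thesis by simp
    qed
    then show ?thesis
      unfolding b_def b'_def sum.distrib[symmetric] distrib_right[symmetric] by (simp add: sum_distrib_left mult.commute[of _ "int (card J)"])
  qed
  have n: "int n = int (card I) + int (card J)"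
    using card_Un_disjoint[OF fin IJ(1)] IJ(2) by (simp flip: of_nat_add)
  have e1: "koszul_sign d (us @ vs) = koszul_sign d us + koszul_sign d vs + cross d ?U ?V"
    using dist by (intro koszul_sign_append) auto
  have e2: "koszul_sign d (us @ ws @ vs) = koszul_sign d us + (koszul_sign d ws + koszul_sign d vs + cross d I ?V) + (cross d ?U I + cross d ?U ?V)"
    using dist by (subst koszul_sign_append, simp, subst koszul_sign_append) (auto simp: I_def cross_Un_right)
  have cIJ: "cross d I J = cross d I ?U + cross d I ?V"
    unfolding J(1) using J(2) by (intro cross_Un_right) auto
  have sw: "cross d ?U I + cross d I ?U = deg * (\<Sum>i\<in>I. d i)"
    unfolding deg using J(3) by (rule cross_swap)
  \<comment> \<open>Here \<open>b - b'\<close> equals \<open>2 * b\<close> minus the sum in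
    \<open>bb'\<close>, which absorbs the sum in \<open>card J * D\<close>; the leftover
    \<open>card I + card J\<close> cancels \<open>n\<close>. Likewise \<open>sw\<close> absorbs
    \<open>D * deg - deg\<close>, leaving twice an integer.\<close>
  have "int (card I) + jacobi_sign l n I + rank_sum d' (insert (Suc n) J) +
      (koszul_sign d (us @ vs) + D * deg) + rank_sum d I + koszul_sign d ws
      - ((\<Sum>j=1..n. (int j - 1) * d j) + int n + koszul_sign d (us @ ws @ vs) + deg) =
      2 * (P + e + b + cross d I ?U)"
    unfolding jac rk const n e1 e2 cIJ D using bb' sw by (simp add: algebra_simps)
  then show ?thesis by simp
qed

section \<open>The bracket as a signed sum over orderings\<close>

lemma koszul_sign_cong: "(\<And>u. u \<in> set ws \<Longrightarrow> d u = d' u) \<Longrightarrow> koszul_sign d ws = koszul_sign d' ws"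
proof (induction ws)
  case (Cons w ws)
  then have "(\<Sum>u\<leftarrow>ws. if w < u then d w * d u else 0) = (\<Sum>u\<leftarrow>ws. if w < u then d' w * d' u else 0)"
    by (intro arg_cong[where f = sum_list] map_cong) auto
  with Cons show ?case by simp
qed simp

lemma sum_cuts_map:
  "(\<Sum>(u, p, v)\<in>cuts (map f w). h u p v) = (\<Sum>(u, p, v)\<in>cuts w. h (map f u) (map f p) (map f v))"
  by (simp add: sum_cuts take_map drop_map)

text \<open>Values are listed from the argument \<open>n\<close> down to \<open>1\<close>, the
  written order of the bracket. Surjectivity follows from injectivity by counting.\<close>

lemma bij_betw_permutation_lists:
  "bij_betw (\<lambda>\<sigma>. map \<sigma> (rev [1..<n+1])) {\<sigma>. \<sigma> permutes {1..n}} (permutations_of_set {1..n})"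
proof -
  let ?f = "\<lambda>\<sigma> :: nat \<Rightarrow> nat. map \<sigma> (rev [1..<n+1])"
  let ?S = "{\<sigma>. \<sigma> permutes {1..n}}"
  have s: "set (rev [1..<n+1]) = {1..n}" by auto
  have inj: "inj_on ?f ?S"
  proof (rule inj_onI)
    fix \<sigma> \<tau> assume a: "\<sigma> \<in> ?S" "\<tau> \<in> ?S" "?f \<sigma> = ?f \<tau>"
    show "\<sigma> = \<tau>"
    proof
      fix x show "\<sigma> x = \<tau> x"
      proof (cases "x \<in> {1..n}")
        case True
        then show ?thesis using a(3) s by (metis map_eq_conv)
      next
        case False
        then show ?thesis using a(1,2) by (simp add: permutes_not_in)
      qed
    qed
  qed
  have "?f ` ?S \<subseteq> permutations_of_set {1..n}"
  proof clarify
    fix \<sigma> :: "nat \<Rightarrow> nat" assume \<sigma>: "\<sigma> permutes {1..n}"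
    have "set (?f \<sigma>) = {1..n}" unfolding set_map s using \<sigma> by (rule permutes_image)
    moreover have "distinct (?f \<sigma>)"
      unfolding distinct_map using permutes_inj[OF \<sigma>] by (auto simp: inj_on_def inj_def)
    ultimately show "?f \<sigma> \<in> permutations_of_set {1..n}" by (simp only: permutations_of_set_def) simp
  qed
  moreover have "card (?f ` ?S) = card (permutations_of_set {1..n})"
    unfolding card_image[OF inj] by (simp add: card_permutations)
  ultimately have "?f ` ?S = permutations_of_set {1..n}"
    by (intro card_subset_eq) auto
  with inj show ?thesis by (simp only: bij_betw_def)
qed

text \<open>A pair \<open>i > j\<close> with \<open>\<sigma> i < \<sigma> j\<close> is an ascending
  pair of the descending listing; the induction splits off its head
  \<open>\<sigma> (Suc n)\<close>.\<close>

lemma perm_sign_eq_koszul_sign: "perm_sign F n \<sigma> = koszul_sign (\<lambda>i. fst (F i)) (map \<sigma> (rev [1..<n+1]))"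
proof (induction n)
  case 0
  then show ?case by (simp add: perm_sign_def)
next
  case (Suc n)
  let ?g = "\<lambda>i j. if i > j \<and> \<sigma> i < \<sigma> j then fst (F (\<sigma> i)) * fst (F (\<sigma> j)) else 0"
  have ps: "perm_sign F n \<sigma> = (\<Sum>i\<in>{1..n}. \<Sum>j\<in>{1..n}. ?g i j)" for n
  proof -
    have "perm_sign F n \<sigma> = (\<Sum>z\<in>{1..n} \<times> {1..n}. ?g (fst z) (snd z))"
      unfolding perm_sign_def by (rule sum.mono_neutral_cong_left) auto
    then show ?thesis by (simp add: sum.cartesian_product case_prod_unfold)
  qed
  have r: "rev [1..<Suc n + 1] = Suc n # rev [1..<n + 1]" by simp
  have "perm_sign F (Suc n) \<sigma> = (\<Sum>i\<in>{1..n}. \<Sum>j\<in>{1..Suc n}. ?g i j) + (\<Sum>j\<in>{1..Suc n}. ?g (Suc n) j)"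
    unfolding ps by simp
  also have "(\<Sum>i\<in>{1..n}. \<Sum>j\<in>{1..Suc n}. ?g i j) = perm_sign F n \<sigma>"
    unfolding ps by (rule sum.cong[OF refl]) auto
  also have "(\<Sum>j\<in>{1..Suc n}. ?g (Suc n) j) =
      (\<Sum>j\<in>{1..n}. if \<sigma> (Suc n) < \<sigma> j then fst (F (\<sigma> (Suc n))) * fst (F (\<sigma> j)) else 0)"
    by simp
  also have "\<dots> = (\<Sum>j\<leftarrow>rev [1..<n+1]. if \<sigma> (Suc n) < \<sigma> j then fst (F (\<sigma> (Suc n))) * fst (F (\<sigma> j)) else 0)"
  proof -
    have "set (rev [1..<n+1]) = {1..n}"
      by (simp add: atLeastLessThanSuc_atLeastAtMost del: upt_Suc)
    then show ?thesis by (subst sum_list_distinct) (simp_all only: distinct_rev distinct_upt)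
  qed
  finally show ?case
    unfolding Suc r by (simp add: o_def del: upt_Suc)
qed

text \<open>Giving the inner bracket a label above all others makes it the leading argument, as the
  Jacobi identity demands.\<close>

lemma args_desc_insert_top:
  assumes "finite J" "\<And>j. j \<in> J \<Longrightarrow> j < N"
  shows "args_desc l (insert N J) = l N # args_desc l J"
proof -
  have "sorted_list_of_set (insert N J) = sorted_list_of_set J @ [N]"
  proof (rule sorted_distinct_set_unique)
    have gen: "sorted (sorted_list_of_set X)" "distinct (sorted_list_of_set X)" "set (sorted_list_of_set X) = X"
      if "finite X" for X :: "nat set" using that by simp_all
    have fin: "finite (insert N J)" using assms(1) by simp
    show "sorted (sorted_list_of_set (insert N J))" "distinct (sorted_list_of_set (insert N J))"
      using gen[OF fin] by blast+
    show "sorted (sorted_list_of_set J @ [N])" "distinct (sorted_list_of_set J @ [N])"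
      using assms gen[OF assms(1)] by (auto simp: sorted_append less_imp_le)
    show "set (sorted_list_of_set (insert N J)) = set (sorted_list_of_set J @ [N])"
      unfolding gen(3)[OF fin] using gen(3)[OF assms(1)] by simp
  qed
  then show ?thesis by (simp add: args_desc_def)
qed

lemma args_desc_cong: "finite I \<Longrightarrow> (\<And>i. i \<in> I \<Longrightarrow> l i = l' i) \<Longrightarrow> args_desc l I = args_desc l' I"
  by (simp add: args_desc_def)

lemma htuples_replicate:
  "vs \<in> htuples (replicate n L) \<longleftrightarrow> length vs = n \<and> (\<forall>v\<in>set vs. snd v \<in> L (fst v))"
  by (auto simp: htuples_def list_all2_conv_all_nth all_set_conv_all_nth)

context A_inf_pair
begin

abbreviation br :: "nat \<Rightarrow> ('o, 'v, 'w) family helem list \<Rightarrow> ('o, 'v, 'w) family" where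
  "br \<equiv> lbar A mA B mB \<Phi>"

text \<open>Orderings of an arbitrary index set replace permutations of \<open>{1..n}\<close>, so
  inner and outer brackets can keep the original labels of their arguments.\<close>

definition symmetrized :: "(nat \<Rightarrow> ('o, 'v, 'w) family helem) \<Rightarrow> nat set \<Rightarrow> ('o, 'v, 'w) family" where
  "symmetrized F I = (\<Sum>ws\<in>permutations_of_set I.
     Cscale B ((-1) powi koszul_sign (\<lambda>i. fst (F i)) ws) (operation (map F ws)))"

lemma symmetrized_cong:
  assumes "\<And>i. i \<in> I \<Longrightarrow> F i = G i"
  shows "symmetrized F I = symmetrized G I"
  unfolding symmetrized_def
proof (rule sum.cong[OF refl])
  fix ws assume "ws \<in> permutations_of_set I"
  then have *: "\<And>i. i \<in> set ws \<Longrightarrow> F i = G i" using assms by (simp add: permutations_of_set_def)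
  then have "koszul_sign (\<lambda>i. fst (F i)) ws = koszul_sign (\<lambda>i. fst (G i)) ws" by (intro koszul_sign_cong) simp
  moreover have "map F ws = map G ws" using * by simp
  ultimately show "Cscale B ((-1) powi koszul_sign (\<lambda>i. fst (F i)) ws) (operation (map F ws)) =
    Cscale B ((-1) powi koszul_sign (\<lambda>i. fst (G i)) ws) (operation (map G ws))" by (simp only:)
qed

text \<open>For \<open>n = 1\<close> there is one ordering and \<open>operation\<close> supplies
  both unary terms; for larger \<open>n\<close> it has no correction, and permutations are read as
  orderings.\<close>

lemma lbar_symmetrized:
  assumes "n \<ge> 1"
  defines "F \<equiv> \<lambda>ls j. susp 1 (ls ! (n - j))"
  shows "br n ls = Cscale B ((-1) powi (\<Sum>j=1..n. (int j - 1) * fst (F ls j))) (symmetrized (F ls) {1..n})"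
proof (cases "n = 1")
  case True
  have "permutations_of_set {1::nat} = {[1]}" by simp
  with True show ?thesis
    by (simp add: lbar_def symmetrized_def operation_def F_def Let_def)
next
  case False
  let ?f = "\<lambda>\<sigma>. map \<sigma> (rev [1..<n+1])"
  let ?F = "F ls"
  have "symmetrized ?F {1..n} = (\<Sum>\<sigma> | \<sigma> permutes {1..n}.
      Cscale B ((-1) powi perm_sign ?F n \<sigma>) (mcomp (map (\<lambda>i. ?F (\<sigma> i)) (rev [1..<n+1]))))"
    unfolding symmetrized_def sum.reindex_bij_betw[OF bij_betw_permutation_lists[of n], symmetric]
    using False by (intro sum.cong refl)
      (simp add: perm_sign_eq_koszul_sign operation_def o_def del: upt_Suc)
  then show ?thesis using False by (simp add: lbar_def Let_def F_def del: upt_Suc)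
qed

lemma symmetrized_image:
  assumes "strict_mono_on I e"
  shows "symmetrized F (e ` I) = symmetrized (\<lambda>i. F (e i)) I"
proof -
  have inj: "inj_on e I" using assms by (rule strict_mono_on_imp_inj_on)
  have "inj_on (map e) (permutations_of_set I)"
    by (rule inj_on_mapI, rule inj_on_subset[OF inj]) (auto simp: permutations_of_set_def)
  then show ?thesis
    unfolding symmetrized_def permutations_of_set_image_inj[OF inj]
  proof (subst sum.reindex)
    show "sum ((\<lambda>ws. Cscale B ((-1) powi koszul_sign (\<lambda>i. fst (F i)) ws) (operation (map F ws))) \<circ> map e) (permutations_of_set I) =
      (\<Sum>ws\<in>permutations_of_set I. Cscale B ((-1) powi koszul_sign (\<lambda>i. fst (F (e i))) ws) (operation (map (\<lambda>i. F (e i)) ws)))"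
    proof (rule sum.cong[OF refl])
      fix ws assume "ws \<in> permutations_of_set I"
      then have "koszul_sign (\<lambda>i. fst (F i)) (map e ws) = koszul_sign (\<lambda>i. fst (F (e i))) ws"
        by (subst koszul_sign_strict_mono[OF assms]) (simp_all add: permutations_of_set_def o_def)
      then show "((\<lambda>ws. Cscale B ((-1) powi koszul_sign (\<lambda>i. fst (F i)) ws) (operation (map F ws))) \<circ> map e) ws =
        Cscale B ((-1) powi koszul_sign (\<lambda>i. fst (F (e i))) ws) (operation (map (\<lambda>i. F (e i)) ws))"
        by (simp add: o_def)
    qed
  qed
qed

text \<open>The increasing enumeration of \<open>I\<close> preserves Koszul signs, and its
  \<open>j\<close>-th element has \<open>j - 1\<close> predecessors in \<open>I\<close>, so the
  prefactor of the bracket becomes \<open>rank_sum\<close>.\<close>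

lemma lbar_args_desc:
  assumes I: "finite I" "I \<noteq> {}"
  shows "br (card I) (args_desc l I) =
    Cscale B ((-1) powi rank_sum (\<lambda>i. fst (susp 1 (l i))) I) (symmetrized (\<lambda>i. susp 1 (l i)) I)"
proof -
  let ?k = "card I"
  let ?xs = "sorted_list_of_set I"
  \<comment> \<open>Arguments are numbered from \<open>1\<close>, list positions from
    \<open>0\<close>.\<close>
  define e where "e j = ?xs ! (j - 1)" for j
  have k: "?k \<ge> 1" using I by (simp add: Suc_le_eq card_gt_0_iff)
  have len: "length ?xs = ?k" and set: "set ?xs = I" using I by simp_all
  have sm: "strict_mono_on {1..?k} e"
  proof (rule strict_mono_onI)
    fix r s assume "r \<in> {1..?k}" "s \<in> {1..?k}" "r < s"
    then show "e r < e s"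
      unfolding e_def using sorted_wrt_nth_less[OF strict_sorted_list_of_set[of I], of "r - 1" "s - 1"] len by auto
  qed
  have img: "e ` {1..?k} = I"
  proof -
    have "e ` {1..?k} = (\<lambda>j. ?xs ! j) ` {0..<?k}"
    proof (intro set_eqI iffI)
      fix x assume "x \<in> (\<lambda>j. ?xs ! j) ` {0..<?k}"
      then obtain j where "j < ?k" "x = ?xs ! j" by auto
      then show "x \<in> e ` {1..?k}" by (intro image_eqI[of _ _ "Suc j"]) (auto simp: e_def)
    qed (auto simp: e_def)
    also have "\<dots> = I" using len set by (metis nth_image take_all_iff order_refl atLeast0LessThan lessThan_atLeast0)
    finally show ?thesis .
  qed
  have arg: "susp 1 (args_desc l I ! (?k - j)) = susp 1 (l (e j))" if "j \<in> {1..?k}" for j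
    using that len by (auto simp: args_desc_def rev_nth e_def)
  have rank: "card {i \<in> I. i < e j} = j - 1" if "j \<in> {1..?k}" for j
  proof -
    have lt: "e i < e j \<longleftrightarrow> i < j" if "i \<in> {1..?k}" for i
      using strict_mono_on_less[OF sm that \<open>j \<in> {1..?k}\<close>] .
    have "{i \<in> e ` {1..?k}. i < e j} = e ` {i \<in> {1..?k}. i < j}"
      using lt by blast
    also have "{i \<in> {1..?k}. i < j} = {1..<j}" using that by auto
    finally have "{i \<in> I. i < e j} = e ` {1..<j}" unfolding img .
    moreover have "inj_on e {1..<j}"
      using strict_mono_on_imp_inj_on[OF sm] by (rule inj_on_subset) (use that in auto)
    ultimately show ?thesis by (simp add: card_image)
  qed
  have "rank_sum d I = (\<Sum>j=1..?k. (int j - 1) * d (e j))" for d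
  proof -
    have "rank_sum d I = (\<Sum>j=1..?k. int (card {i \<in> I. i < e j}) * d (e j))"
      unfolding rank_sum_def
      using sum.reindex[OF strict_mono_on_imp_inj_on[OF sm], of "\<lambda>i. int (card {j \<in> I. j < i}) * d i"]
      by (simp only: img o_def)
    also have "\<dots> = (\<Sum>j=1..?k. (int j - 1) * d (e j))"
      using rank by (intro sum.cong refl) (simp add: of_nat_diff)
    finally show ?thesis .
  qed
  moreover have "(\<Sum>j=1..?k. (int j - 1) * fst (susp 1 (args_desc l I ! (?k - j)))) =
      (\<Sum>j=1..?k. (int j - 1) * fst (susp 1 (l (e j))))"
    using arg by (intro sum.cong refl) simp
  moreover have "symmetrized (\<lambda>j. susp 1 (args_desc l I ! (?k - j))) {1..?k} = symmetrized (\<lambda>i. susp 1 (l i)) I"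
  proof -
    have "symmetrized (\<lambda>j. susp 1 (args_desc l I ! (?k - j))) {1..?k} = symmetrized (\<lambda>j. susp 1 (l (e j))) {1..?k}"
      using arg by (rule symmetrized_cong)
    then show ?thesis using symmetrized_image[OF sm, of "\<lambda>i. susp 1 (l i)"] unfolding img by simp
  qed
  ultimately show ?thesis
    unfolding lbar_symmetrized[OF k] by simp
qed

end

section \<open>The generalised Jacobi identities\<close>

lemma (in vector_space) graded_multilinearI:
  assumes "\<And>vs. vs \<in> htuples (replicate n L) \<Longrightarrow> f vs \<in> M (deg_sum vs + d)"
    and "\<And>us e v w ws c c'. us @ (e, v) # ws \<in> htuples (replicate n L) \<Longrightarrow>
      us @ (e, w) # ws \<in> htuples (replicate n L) \<Longrightarrow>
      f (us @ (e, scale c v + scale c' w) # ws) = scale c (f (us @ (e, v) # ws)) + scale c' (f (us @ (e, w) # ws))"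
  shows "graded_multilinear scale scale (replicate n L) M d f"
  unfolding graded_multilinear_def
proof (intro conjI ballI allI impI)
  fix us e v w ws assume "us @ (e, v) # ws \<in> htuples (replicate n L)" "us @ (e, w) # ws \<in> htuples (replicate n L)"
  from assms(2)[OF this, of 1 1]
  show "f (us @ (e, v + w) # ws) = f (us @ (e, v) # ws) + f (us @ (e, w) # ws)"
    by (simp only: scale_one)
next
  fix us e v ws c assume "us @ (e, v) # ws \<in> htuples (replicate n L)"
  from assms(2)[OF this this, of c 0]
  show "f (us @ (e, scale c v) # ws) = scale c (f (us @ (e, v) # ws))"
    by (simp only: scale_zero_left add_0_right)
qed (rule assms(1))

context A_inf_pair
begin

section \<open>Degree, multilinearity and antisymmetry of the bracket\<close>

lemma cochain_susp: "snd x \<in> Cspace A B \<Phi> (fst x) \<Longrightarrow> cochain (susp 1 x)"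
  by (simp add: susp_def)

lemma deg_sum_permutation:
  assumes "ws \<in> permutations_of_set I"
  shows "deg_sum (map F ws) = (\<Sum>i\<in>I. fst (F i))"
  using assms by (auto simp: permutations_of_set_def sum_list_distinct o_def)

lemma symmetrized_Cspace:
  assumes "\<And>i. i \<in> I \<Longrightarrow> cochain (F i)"
  shows "symmetrized F I \<in> Cspace A B \<Phi> ((\<Sum>i\<in>I. fst (F i)) + 2)"
  unfolding symmetrized_def
proof (intro CB.subspace_sum CB.subspace_scale Cspace_subspace)
  fix ws assume ws: "ws \<in> permutations_of_set I"
  have "operation (map F ws) \<in> Cspace A B \<Phi> (deg_sum (map F ws) + 2)"
    using ws assms by (intro operation_Cspace) (auto simp: permutations_of_set_def)
  then show "operation (map F ws) \<in> Cspace A B \<Phi> ((\<Sum>i\<in>I. fst (F i)) + 2)"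
    unfolding deg_sum_permutation[OF ws] .
qed

text \<open>Each ordering contains \<open>a\<close> exactly once, and its Koszul sign depends on the
  degree \<open>d\<close> only, which the three terms share.\<close>

lemma symmetrized_slot_linear:
  assumes F: "\<And>i. i \<in> I \<Longrightarrow> i \<noteq> a \<Longrightarrow> cochain (F i)" and a: "a \<in> I" "finite I"
    and G: "cochain (d, G)" and G': "cochain (d, G')"
  shows "symmetrized (F(a := (d, Cscale B c G + Cscale B c' G'))) I =
    Cscale B c (symmetrized (F(a := (d, G))) I) + Cscale B c' (symmetrized (F(a := (d, G'))) I)"
  unfolding symmetrized_def CB.scale_sum_right sum.distrib[symmetric]
proof (rule sum.cong[OF refl])
  fix ws assume ws: "ws \<in> permutations_of_set I"
  then have "a \<in> set ws" using a by (simp add: permutations_of_set_def)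
  then obtain us vs where w: "ws = us @ a # vs" by (meson split_list)
  have na: "a \<notin> set us" "a \<notin> set vs" and sub: "set us \<union> set vs \<subseteq> I"
    using ws w by (auto simp: permutations_of_set_def)
  have m: "map (F(a := x)) ws = map F us @ x # map F vs" for x
    unfolding w using na by (auto simp: fun_upd_def)
  have e: "koszul_sign (\<lambda>i. fst ((F(a := (d, H))) i)) ws = koszul_sign (\<lambda>i. fst ((F(a := (d, G))) i)) ws" for H
    by (rule koszul_sign_cong) simp
  have "operation (map F us @ (d, Cscale B c G + Cscale B c' G') # map F vs) =
    Cscale B c (operation (map F us @ (d, G) # map F vs)) + Cscale B c' (operation (map F us @ (d, G') # map F vs))"
  proof (rule operation_slot_linear[OF _ G G'])
    fix H assume "H \<in> set (map F us) \<union> set (map F vs)"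
    then obtain i where "i \<in> set us \<union> set vs" "H = F i" by auto
    then show "cochain H" using F[of i] na sub by auto
  qed
  then show "Cscale B ((-1) powi koszul_sign (\<lambda>i. fst ((F(a := (d, Cscale B c G + Cscale B c' G'))) i)) ws)
      (operation (map (F(a := (d, Cscale B c G + Cscale B c' G'))) ws)) =
    Cscale B c (Cscale B ((-1) powi koszul_sign (\<lambda>i. fst ((F(a := (d, G))) i)) ws) (operation (map (F(a := (d, G))) ws))) +
    Cscale B c' (Cscale B ((-1) powi koszul_sign (\<lambda>i. fst ((F(a := (d, G'))) i)) ws) (operation (map (F(a := (d, G'))) ws)))"
    unfolding m e[of "Cscale B c G + Cscale B c' G'"] e[of G']
    by (simp only: CB.scale_right_distrib CB.scale_scale mult.commute)
qed

lemma lbar_multilinear: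
  assumes n: "n \<ge> 1"
  shows "graded_multilinear (Cscale B) (Cscale B) (replicate n (Cspace A B \<Phi>)) (Cspace A B \<Phi>) (2 - int n) (br n)"
proof (rule CB.graded_multilinearI)
  fix ls :: "('o, 'v, 'w) family helem list"
  assume ls: "ls \<in> htuples (replicate n (Cspace A B \<Phi>))"
  let ?F = "\<lambda>j. susp 1 (ls ! (n - j))"
  have len: "length ls = n" and mem: "\<And>x. x \<in> set ls \<Longrightarrow> snd x \<in> Cspace A B \<Phi> (fst x)"
    using ls by (auto simp: htuples_replicate)
  have "cochain (?F j)" if "j \<in> {1..n}" for j
    using that len by (intro cochain_susp mem nth_mem) auto
  then have "symmetrized ?F {1..n} \<in> Cspace A B \<Phi> ((\<Sum>j\<in>{1..n}. fst (?F j)) + 2)"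
    by (rule symmetrized_Cspace)
  \<comment> \<open>Desuspension lowers each of the \<open>n\<close> degrees by one;
    \<open>operation\<close> contributes the \<open>2\<close> in \<open>2 - int n\<close>.\<close>
  moreover have "(\<Sum>j\<in>{1..n}. fst (?F j)) = deg_sum ls - int n"
  proof -
    have "(\<Sum>j\<in>{1..n}. fst (?F j)) = (\<Sum>i\<in>{0..<n}. fst (ls ! i) - 1)"
      by (rule sum.reindex_bij_witness[where i = "\<lambda>i. n - i" and j = "\<lambda>j. n - j"]) (auto simp: susp_def)
    also have "\<dots> = deg_sum ls - int n"
      using len by (simp add: sum_list_sum_nth sum_subtractf)
    finally show ?thesis .
  qed
  then have "(\<Sum>j\<in>{1..n}. fst (?F j)) + 2 = deg_sum ls + (2 - int n)" by simp
  ultimately have "symmetrized ?F {1..n} \<in> Cspace A B \<Phi> (deg_sum ls + (2 - int n))"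
    by (simp only:)
  then show "br n ls \<in> Cspace A B \<Phi> (deg_sum ls + (2 - int n))"
    unfolding lbar_symmetrized[OF n] by (rule CB.subspace_scale[OF Cspace_subspace])
next
  fix us ws :: "('o, 'v, 'w) family helem list" and e v w c c'
  assume v: "us @ (e, v) # ws \<in> htuples (replicate n (Cspace A B \<Phi>))"
    and w: "us @ (e, w) # ws \<in> htuples (replicate n (Cspace A B \<Phi>))"
  let ?L = "\<lambda>x. us @ (e, x) # ws"
  \<comment> \<open>Arguments are numbered from the right, so list position \<open>length us\<close>
    carries label \<open>a\<close>. The \<open>0\<close> in the next line is a placeholder,
    overwritten at \<open>a\<close>.\<close>
  define a where "a = n - length us"
  define F where "F = (\<lambda>j. susp 1 (?L 0 ! (n - j)))"
  have len: "length us + 1 + length ws = n" using v by (simp add: htuples_replicate)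
  then have a: "a \<in> {1..n}" by (auto simp: a_def)
  have upd: "susp 1 (?L x ! (n - j)) = (F(a := (e - 1, x))) j" if "j \<in> {1..n}" for j x
  proof (cases "n - j = length us")
    case True
    then have "j = a" using that by (auto simp: a_def)
    with True show ?thesis by (simp add: susp_def)
  next
    case False
    then have "j \<noteq> a" using len by (auto simp: a_def)
    moreover have "?L x ! (n - j) = ?L 0 ! (n - j)"
      using False by (cases "n - j - length us") (auto simp: nth_append)
    ultimately show ?thesis by (simp add: F_def)
  qed
  have br: "br n (?L x) = Cscale B ((-1) powi (\<Sum>j=1..n. (int j - 1) * fst ((F(a := (e - 1, 0))) j)))
     (symmetrized (F(a := (e - 1, x))) {1..n})" for x
  proof -
    have "(\<Sum>j=1..n. (int j - 1) * fst (susp 1 (?L x ! (n - j)))) =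
      (\<Sum>j=1..n. (int j - 1) * fst ((F(a := (e - 1, 0))) j))"
      using upd[of _ x] by (intro sum.cong refl) simp
    moreover have "symmetrized (\<lambda>j. susp 1 (?L x ! (n - j))) {1..n} = symmetrized (F(a := (e - 1, x))) {1..n}"
      using upd[of _ x] by (rule symmetrized_cong)
    ultimately show ?thesis unfolding lbar_symmetrized[OF n] by simp
  qed
  have cF: "cochain (F i)" if "i \<in> {1..n}" "i \<noteq> a" for i
  proof -
    have "F i = susp 1 (?L v ! (n - i))" using upd[OF that(1), of v] that(2) by simp
    moreover have "?L v ! (n - i) \<in> set (?L v)" using that len by (intro nth_mem) auto
    ultimately show ?thesis using v by (auto simp only: htuples_replicate intro!: cochain_susp)
  qed
  have "symmetrized (F(a := (e - 1, Cscale B c v + Cscale B c' w))) {1..n} =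
    Cscale B c (symmetrized (F(a := (e - 1, v))) {1..n}) + Cscale B c' (symmetrized (F(a := (e - 1, w))) {1..n})"
    using v w by (intro symmetrized_slot_linear cF a) (auto simp: htuples_replicate)
  then show "br n (?L (Cscale B c v + Cscale B c' w)) = Cscale B c (br n (?L v)) + Cscale B c' (br n (?L w))"
    unfolding br by (simp only: CB.scale_right_distrib CB.scale_scale mult.commute)
qed

text \<open>Transposing letters is an involution on the orderings of \<open>I\<close>, so the two
  sums differ only by the Koszul sign of the exchanged pair.\<close>

lemma symmetrized_transpose:
  assumes I: "a \<in> I" "Suc a \<in> I"
  shows "symmetrized (\<lambda>i. F (transpose a (Suc a) i)) I =
    Cscale B ((-1) powi (fst (F a) * fst (F (Suc a)))) (symmetrized F I)"
proof -
  let ?t = "transpose a (Suc a)"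
  let ?d = "\<lambda>i. fst (F i)"
  have inj: "inj_on ?t S" for S by (rule inj_on_inverseI[of _ ?t]) simp
  have img: "?t ` I = I" using I by (auto simp: transpose_def image_iff)
  have reindex: "symmetrized F I = (\<Sum>ws\<in>permutations_of_set I. Cscale B ((-1) powi koszul_sign ?d (map ?t ws)) (operation (map F (map ?t ws))))"
    unfolding symmetrized_def
    by (rule sum.reindex_bij_witness[where i = "map ?t" and j = "map ?t"])
       (auto simp: permutations_of_set_def distinct_map img inj o_def map_idI)
  have "Cscale B ((-1) powi (?d a * ?d (Suc a))) (symmetrized F I) = symmetrized (\<lambda>i. F (?t i)) I"
    unfolding reindex unfolding symmetrized_def CB.scale_sum_right
  proof (rule sum.cong[OF refl])
    fix ws assume ws: "ws \<in> permutations_of_set I"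
    then have "a \<in> set ws" "Suc a \<in> set ws" "distinct ws" using I by (auto simp: permutations_of_set_def)
    with koszul_sign_transpose[of ws ?d a]
    have "even (koszul_sign ?d (map ?t ws) - koszul_sign (\<lambda>i. fst (F (?t i))) ws - ?d a * ?d (Suc a))"
      by (simp add: o_def)
    then have "even ((?d a * ?d (Suc a) + koszul_sign ?d (map ?t ws)) - koszul_sign (\<lambda>i. fst (F (?t i))) ws)"
      by presburger
    then have "((-1) :: 'k) powi (?d a * ?d (Suc a) + koszul_sign ?d (map ?t ws)) = (-1) powi koszul_sign (\<lambda>i. fst (F (?t i))) ws"
      by (rule ksign_cong)
    then show "Cscale B ((-1) powi (?d a * ?d (Suc a))) (Cscale B ((-1) powi koszul_sign ?d (map ?t ws)) (operation (map F (map ?t ws)))) =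
      Cscale B ((-1) powi koszul_sign (\<lambda>i. fst (F (?t i))) ws) (operation (map (\<lambda>i. F (?t i)) ws))"
      by (simp only: CB.scale_scale ksign_add[symmetric] map_map o_def)
  qed
  then show ?thesis by (rule sym)
qed

text \<open>With \<open>d\<close>, \<open>d'\<close> the degrees lowered by one, the exchange gives
  \<open>d * d'\<close> from the Koszul sign and \<open>d' - d\<close> from the prefactor. Modulo
  \<open>2\<close> their sum is \<open>(d + 1) * (d' + 1) + 1\<close>, which explains the extra
  minus sign.\<close>

lemma lbar_antisymmetric:
  assumes n: "n \<ge> 1" and len: "length us + 2 + length ws = n"
  shows "br n (us @ l' # l # ws) = Cscale B (- ((-1) powi (fst l * fst l'))) (br n (us @ l # l' # ws))"
proof -
  let ?L = "us @ l # l' # ws" and ?L' = "us @ l' # l # ws"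
  \<comment> \<open>In the original list \<open>l'\<close> carries the label \<open>a\<close> and
    \<open>l\<close>, standing to its left, the label \<open>Suc a\<close>.\<close>
  define a where "a = n - length us - 1"
  let ?t = "transpose a (Suc a)"
  let ?F = "\<lambda>j. susp 1 (?L ! (n - j))" and ?F' = "\<lambda>j. susp 1 (?L' ! (n - j))"
  have a: "a \<in> {1..n}" "Suc a \<in> {1..n}" using len by (auto simp: a_def)
  have idx: "n - a = Suc (length us)" "n - Suc a = length us" using len by (auto simp: a_def)
  have Fa: "?F a = susp 1 l'" "?F (Suc a) = susp 1 l" "?F' a = susp 1 l" "?F' (Suc a) = susp 1 l'"
    unfolding idx by (simp_all add: nth_append)
  have nth: "?L' ! i = ?L ! i" if "i \<noteq> length us" "i \<noteq> Suc (length us)" for i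
    using that by (cases "i - length us"; cases "i - length us - 1") (auto simp: nth_append)
  have F': "?F' j = ?F (?t j)" if "j \<in> {1..n}" for j
  proof -
    consider "j = a" | "j = Suc a" | "j \<noteq> a" "j \<noteq> Suc a" by blast
    then show ?thesis
    proof cases
      case 3
      then have "n - j \<noteq> length us" "n - j \<noteq> Suc (length us)" using that len by (auto simp: a_def)
      then have "?L' ! (n - j) = ?L ! (n - j)" by (rule nth)
      with 3 show ?thesis by (simp add: transpose_def)
    qed (simp_all only: Fa transpose_apply_first transpose_apply_second)
  qed
  have sym: "symmetrized ?F' {1..n} =
      Cscale B ((-1) powi (fst (susp 1 l') * fst (susp 1 l))) (symmetrized ?F {1..n})"
    using symmetrized_cong[of "{1..n}" ?F' "\<lambda>j. ?F (?t j)"] F' symmetrized_transpose[OF a, of ?F]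
    unfolding Fa by simp
  have split: "(\<Sum>j=1..n. f j) = (\<Sum>j\<in>{1..n} - {a, Suc a}. f j) + f a + f (Suc a)" for f :: "nat \<Rightarrow> int"
  proof -
    have "(\<Sum>j=1..n. f j) = (\<Sum>j\<in>{1..n} - {a, Suc a}. f j) + (\<Sum>j\<in>{a, Suc a}. f j)"
      by (rule sum.subset_diff) (use a in auto)
    then show ?thesis by simp
  qed
  have rest: "(\<Sum>j\<in>{1..n} - {a, Suc a}. (int j - 1) * fst (?F' j)) = (\<Sum>j\<in>{1..n} - {a, Suc a}. (int j - 1) * fst (?F j))"
    using F' by (intro sum.cong refl) (simp add: transpose_def)
  have "(\<Sum>j=1..n. (int j - 1) * fst (?F' j)) =
      (\<Sum>j=1..n. (int j - 1) * fst (?F j)) + fst (susp 1 l') - fst (susp 1 l)"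
    unfolding split[of "\<lambda>j. (int j - 1) * fst (?F' j)"] split[of "\<lambda>j. (int j - 1) * fst (?F j)"] rest Fa
    by (simp add: algebra_simps)
  then have "(\<Sum>j=1..n. (int j - 1) * fst (?F' j)) + fst (susp 1 l') * fst (susp 1 l)
      - (1 + fst l * fst l' + (\<Sum>j=1..n. (int j - 1) * fst (?F j))) = - 2 * fst l"
    by (simp add: susp_def) (simp add: algebra_simps)
  then have "(-1 :: 'k) powi ((\<Sum>j=1..n. (int j - 1) * fst (?F' j)) + fst (susp 1 l') * fst (susp 1 l)) =
    (-1) powi (1 + fst l * fst l' + (\<Sum>j=1..n. (int j - 1) * fst (?F j)))"
    by (intro ksign_cong) (simp only: even_mult_iff even_minus even_numeral simp_thms)
  moreover have "(-1 :: 'k) powi (1 + fst l * fst l' + x) = - ((-1) powi (fst l * fst l')) * (-1) powi x" for x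
    by (simp add: ksign_if)
  ultimately show ?thesis
    unfolding lbar_symmetrized[OF n] sym CB.scale_scale ksign_add[symmetric] by simp
qed

text \<open>Both brackets are expanded into orderings, the inner one through linearity of
  \<open>operation\<close> in its slot. By \<open>jacobi_sign_parity\<close> the exponent becomes a
  global constant, the Koszul sign of the merged ordering, and the exponent \<open>deg_sum\<close>
  of the letters \<open>us\<close> required by \<open>operation_relation\<close>.\<close>

lemma jacobi_term:
  assumes I: "I \<subseteq> {1..n}" "card I = k" "k \<ge> 1"
    and l: "\<And>i. i \<in> {1..n} \<Longrightarrow> snd (l i) \<in> Cspace A B \<Phi> (fst (l i))"
  defines "F \<equiv> \<lambda>i. susp 1 (l i)" and "J \<equiv> {1..n} - I"
  shows "Cscale B ((-1) powi int k) (Cscale B ((-1) powi jacobi_sign l n I)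
      (br (n - k + 1) (((\<Sum>i\<in>I. fst (l i)) + 2 - int k, br k (args_desc l I)) # args_desc l J))) =
    (\<Sum>(us, vs)\<in>{(us, vs). us @ vs \<in> permutations_of_set J}. \<Sum>ws\<in>permutations_of_set I.
      Cscale B ((-1) powi ((\<Sum>j=1..n. (int j - 1) * fst (F j)) + int n + koszul_sign (\<lambda>i. fst (F i)) (us @ ws @ vs)
          + deg_sum (map F us)))
        (operation (map F us @ (1 + deg_sum (map F ws), operation (map F ws)) # map F vs)))"
proof -
  let ?N = "Suc n"
  let ?d = "\<lambda>i. fst (F i)"
  let ?G = "br k (args_desc l I)"
  have fin: "finite I" "finite J" using I(1) by (auto simp: J_def intro: finite_subset)
  have ne: "I \<noteq> {}" using I by auto
  have lt: "j < ?N" if "j \<in> J" for j using that by (auto simp: J_def)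
  have NJ: "?N \<notin> J" by (auto simp: J_def)
  have cF: "cochain (F i)" if "i \<in> {1..n}" for i unfolding F_def using l[OF that] by (rule cochain_susp)
  define D where "D = (\<Sum>i\<in>I. ?d i) + 1"
  define l' where "l' = l(?N := ((\<Sum>i\<in>I. fst (l i)) + 2 - int k, ?G))"
  define F' where "F' = (\<lambda>i. susp 1 (l' i))"
  have F'J: "F' i = F i" if "i \<in> J" for i using lt[OF that] by (simp add: F'_def F_def l'_def)
  \<comment> \<open>Desuspending the inner bracket gives the degree sum of the \<open>l i\<close>
    plus \<open>1 - k\<close>; as \<open>card I = k\<close>, this is the sum of the lowered degrees
    plus one.\<close>
  have F'N: "F' ?N = (D, ?G)"
    using I(2) by (simp add: F'_def l'_def susp_def D_def F_def sum_subtractf)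
  have args: "args_desc l' (insert ?N J) = ((\<Sum>i\<in>I. fst (l i)) + 2 - int k, ?G) # args_desc l J"
  proof -
    have "args_desc l' (insert ?N J) = l' ?N # args_desc l' J"
      using fin(2) lt by (rule args_desc_insert_top)
    also have "args_desc l' J = args_desc l J"
      using fin(2) by (rule args_desc_cong) (use NJ in \<open>auto simp: l'_def\<close>)
    also have "l' ?N = ((\<Sum>i\<in>I. fst (l i)) + 2 - int k, ?G)" by (simp add: l'_def)
    finally show ?thesis .
  qed
  have cardJ: "card (insert ?N J) = n - k + 1"
    using fin NJ I by (simp add: J_def card_Diff_subset)
  have G: "?G = (\<Sum>ws\<in>permutations_of_set I. Cscale B ((-1) powi (rank_sum ?d I + koszul_sign ?d ws)) (operation (map F ws)))"
    using lbar_args_desc[OF fin(1) ne, of l] I(2)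
    by (simp add: F_def symmetrized_def CB.scale_sum_right ksign_add)
  have dI: "deg_sum (map F ws) = (\<Sum>i\<in>I. ?d i)" if "ws \<in> permutations_of_set I" for ws
    using that by (rule deg_sum_permutation)
  have op: "operation (map F us @ (D, ?G) # map F vs) = (\<Sum>ws\<in>permutations_of_set I.
      Cscale B ((-1) powi (rank_sum ?d I + koszul_sign ?d ws)) (operation (map F us @ (D, operation (map F ws)) # map F vs)))"
    if uv: "us @ vs \<in> permutations_of_set J" for us vs
    unfolding G
  proof (rule operation_slot_sum)
    fix H assume "H \<in> set (map F us) \<union> set (map F vs)"
    then obtain i where i: "i \<in> set us \<union> set vs" "H = F i" by auto
    moreover have "set us \<union> set vs = J" using uv by (simp add: permutations_of_set_def)
    ultimately have "i \<in> {1..n}" by (simp add: J_def)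
    then show "cochain H" unfolding i(2) by (rule cF)
  next
    fix ws assume ws: "ws \<in> permutations_of_set I"
    have "operation (map F ws) \<in> Cspace A B \<Phi> (deg_sum (map F ws) + 2)"
    proof (rule operation_Cspace)
      fix H assume "H \<in> set (map F ws)"
      then obtain i where "i \<in> I" "H = F i" using ws by (auto simp: permutations_of_set_def)
      then show "cochain H" using I(1) cF by blast
    qed
    then show "cochain (D, operation (map F ws))" unfolding dI[OF ws] D_def by (simp add: algebra_simps)
  qed
  \<comment> \<open>The top label forms ascending pairs with exactly the letters standing before it,
    those of \<open>us\<close>.\<close>
  have koszul_sign': "koszul_sign (\<lambda>i. fst (F' i)) (us @ ?N # vs) = koszul_sign ?d (us @ vs) + D * deg_sum (map F us)"
    if uv: "us @ vs \<in> permutations_of_set J" for us vs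
  proof -
    have *: "set us \<union> set vs = J" "distinct (us @ vs)" using uv by (auto simp: permutations_of_set_def)
    have dist: "distinct (us @ ?N # vs)" using * NJ by auto
    have 1: "koszul_sign (\<lambda>i. fst (F' i)) us = koszul_sign ?d us" "koszul_sign (\<lambda>i. fst (F' i)) vs = koszul_sign ?d vs"
      using * F'J by (auto intro!: koszul_sign_cong)
    have 2: "(\<Sum>u\<leftarrow>vs. if ?N < u then fst (F' ?N) * fst (F' u) else 0) = 0"
    proof -
      have "map (\<lambda>u. if ?N < u then fst (F' ?N) * fst (F' u) else 0) vs = map (\<lambda>u. 0) vs"
        using * lt by (intro map_cong refl) (metis UnI2 less_not_sym)
      then show ?thesis by (simp only: sum_list_0)
    qed
    have 3: "cross (\<lambda>i. fst (F' i)) (set us) (insert ?N (set vs)) = (\<Sum>u\<in>set us. ?d u * D) + cross ?d (set us) (set vs)"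
    proof -
      have "?N \<notin> set vs" using * NJ by auto
      then have "cross (\<lambda>i. fst (F' i)) (set us) (insert ?N (set vs)) =
        (\<Sum>u\<in>set us. (if u < ?N then fst (F' u) * fst (F' ?N) else 0) + (\<Sum>w\<in>set vs. if u < w then fst (F' u) * fst (F' w) else 0))"
        unfolding cross_def by (intro sum.cong refl) (subst sum.insert, simp_all)
      also have "\<dots> = (\<Sum>u\<in>set us. ?d u * D + (\<Sum>w\<in>set vs. if u < w then ?d u * ?d w else 0))"
      proof (rule sum.cong[OF refl])
        fix u assume u: "u \<in> set us"
        then have "u < ?N" "F' u = F u" using * lt F'J by auto
        moreover have "(\<Sum>w\<in>set vs. if u < w then fst (F' u) * fst (F' w) else 0) = (\<Sum>w\<in>set vs. if u < w then ?d u * ?d w else 0)"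
          using u * F'J by (intro sum.cong refl) auto
        ultimately show "(if u < ?N then fst (F' u) * fst (F' ?N) else 0) + (\<Sum>w\<in>set vs. if u < w then fst (F' u) * fst (F' w) else 0) =
          ?d u * D + (\<Sum>w\<in>set vs. if u < w then ?d u * ?d w else 0)"
          by (simp add: F'N)
      qed
      finally show ?thesis by (simp only: sum.distrib cross_def)
    qed
    have "deg_sum (map F us) = (\<Sum>u\<in>set us. ?d u)"
      using * by (simp add: sum_list_distinct o_def)
    then have 4: "(\<Sum>u\<in>set us. ?d u * D) = D * deg_sum (map F us)"
      by (simp only: sum_distrib_right mult.commute[of D])
    show ?thesis
      unfolding koszul_sign_append[OF dist] koszul_sign_append[OF *(2)] koszul_sign.simps 1 2 list.set 3 4 by simp
  qed
  have m': "map F' (us @ ?N # vs) = map F us @ (D, ?G) # map F vs"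
    if uv: "us @ vs \<in> permutations_of_set J" for us vs
    using uv F'J F'N by (auto simp: permutations_of_set_def)
  have "br (n - k + 1) (((\<Sum>i\<in>I. fst (l i)) + 2 - int k, ?G) # args_desc l J) =
    Cscale B ((-1) powi rank_sum (\<lambda>i. fst (F' i)) (insert ?N J)) (symmetrized F' (insert ?N J))"
    using lbar_args_desc[of "insert ?N J" l'] fin unfolding cardJ args F'_def by simp
  also have "symmetrized F' (insert ?N J) =
    (\<Sum>(us, vs)\<in>{(us, vs). us @ vs \<in> permutations_of_set J}.
      Cscale B ((-1) powi (koszul_sign ?d (us @ vs) + D * deg_sum (map F us))) (operation (map F us @ (D, ?G) # map F vs)))"
    unfolding symmetrized_def sum_permutations_insert[OF NJ fin(2)]
    by (rule sum.cong[OF refl]) (clarify, simp only: koszul_sign' m')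
  also have "\<dots> = (\<Sum>(us, vs)\<in>{(us, vs). us @ vs \<in> permutations_of_set J}. \<Sum>ws\<in>permutations_of_set I.
      Cscale B ((-1) powi (koszul_sign ?d (us @ vs) + D * deg_sum (map F us) + (rank_sum ?d I + koszul_sign ?d ws)))
       (operation (map F us @ (D, operation (map F ws)) # map F vs)))"
    by (rule sum.cong[OF refl]) (clarify, simp only: op CB.scale_sum_right CB.scale_scale ksign_add)
  finally have br: "br (n - k + 1) (((\<Sum>i\<in>I. fst (l i)) + 2 - int k, ?G) # args_desc l J) =
    Cscale B ((-1) powi rank_sum (\<lambda>i. fst (F' i)) (insert ?N J)) \<dots>" .
  have sign: "(-1 :: 'k) powi (int k + (jacobi_sign l n I + (rank_sum (\<lambda>i. fst (F' i)) (insert ?N J) +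
      (koszul_sign ?d (us @ vs) + D * deg_sum (map F us) + (rank_sum ?d I + koszul_sign ?d ws))))) =
    (-1) powi ((\<Sum>j=1..n. (int j - 1) * ?d j) + int n + koszul_sign ?d (us @ ws @ vs) + deg_sum (map F us))"
    if uv: "us @ vs \<in> permutations_of_set J" and ws: "ws \<in> permutations_of_set I" for us vs ws
  proof (rule ksign_cong)
    have *: "set us \<union> set vs = J" "distinct (us @ vs)" "set ws = I" "distinct ws"
      using uv ws by (auto simp: permutations_of_set_def)
    have part: "us @ ws @ vs \<in> permutations_of_set {1..n}"
      using * I(1) by (auto simp: permutations_of_set_def J_def)
    have d: "?d = (\<lambda>i. fst (l i) - 1)" by (simp add: F_def susp_def)
    have "deg_sum (map F us) = (\<Sum>u\<in>set us. ?d u)"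
      using * by (simp add: sum_list_distinct o_def)
    then have deg: "deg_sum (map F us) = (\<Sum>u\<in>set us. fst (l u) - 1)" unfolding d .
    have "even (int (card (set ws)) + jacobi_sign l n (set ws) +
       rank_sum (\<lambda>i. fst (F' i)) (insert ?N ({1..n} - set ws)) +
       (koszul_sign (\<lambda>i. fst (l i) - 1) (us @ vs) + D * deg_sum (map F us)) + rank_sum (\<lambda>i. fst (l i) - 1) (set ws) +
       koszul_sign (\<lambda>i. fst (l i) - 1) ws -
       ((\<Sum>j=1..n. (int j - 1) * (fst (l j) - 1)) + int n + koszul_sign (\<lambda>i. fst (l i) - 1) (us @ ws @ vs) + deg_sum (map F us)))"
    proof (rule jacobi_sign_parity[OF part _ _ _ deg])
      show "D = (\<Sum>i\<in>set ws. fst (l i) - 1) + 1" unfolding D_def d *(3) ..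
      show "fst (F' ?N) = D" by (simp add: F'N)
      show "fst (F' i) = fst (l i) - 1" if "i \<in> {1..n} - set ws" for i
        using F'J[of i] that *(3) by (simp add: J_def F_def susp_def)
    qed
    then show "even (int k + (jacobi_sign l n I + (rank_sum (\<lambda>i. fst (F' i)) (insert ?N J) +
        (koszul_sign ?d (us @ vs) + D * deg_sum (map F us) + (rank_sum ?d I + koszul_sign ?d ws)))) -
      ((\<Sum>j=1..n. (int j - 1) * ?d j) + int n + koszul_sign ?d (us @ ws @ vs) + deg_sum (map F us)))"
      unfolding *(3) d I(2) J_def by (simp only: add.assoc fun_cong[OF d])
  qed
  show ?thesis
    unfolding br case_prod_unfold CB.scale_sum_right CB.scale_scale ksign_add[symmetric]
  proof (intro sum.cong refl)
    fix z ws assume z: "z \<in> {z. fst z @ snd z \<in> permutations_of_set J}" and ws: "ws \<in> permutations_of_set I"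
    from z have z: "fst z @ snd z \<in> permutations_of_set J" by simp
    show "Cscale B ((-1) powi (int k + (jacobi_sign l n I + (rank_sum (\<lambda>i. fst (F' i)) (insert ?N J) +
        (koszul_sign ?d (fst z @ snd z) + D * deg_sum (map F (fst z)) + (rank_sum ?d I + koszul_sign ?d ws))))))
       (operation (map F (fst z) @ (D, operation (map F ws)) # map F (snd z))) =
      Cscale B ((-1) powi ((\<Sum>j=1..n. (int j - 1) * ?d j) + int n + koszul_sign ?d (fst z @ ws @ snd z) + deg_sum (map F (fst z))))
       (operation (map F (fst z) @ (1 + deg_sum (map F ws), operation (map F ws)) # map F (snd z)))"
      unfolding sign[OF z ws] unfolding dI[OF ws] D_def by (simp only: add.commute[of 1])
  qed
qed

text \<open>After regrouping by the merged ordering \<open>w\<close>, the global exponent and the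
  Koszul sign of \<open>w\<close> are common to all its cuts; what remains is
  \<open>operation_relation\<close> for the word listed by \<open>w\<close>.\<close>

lemma lbar_jacobi:
  assumes l: "\<And>i. i \<in> {1..n} \<Longrightarrow> snd (l i) \<in> Cspace A B \<Phi> (fst (l i))"
  shows "(\<Sum>k=1..n. Cscale B ((-1) powi int k)
           (\<Sum>I | I \<subseteq> {1..n} \<and> card I = k. Cscale B ((-1) powi jacobi_sign l n I)
              (br (n - k + 1)
                 (((\<Sum>i\<in>I. fst (l i)) + 2 - int k, br k (args_desc l I)) # args_desc l ({1..n} - I))))) = 0"
proof -
  let ?F = "\<lambda>i. susp 1 (l i)"
  let ?C = "(\<Sum>j=1..n. (int j - 1) * fst (?F j)) + int n"
  let ?X = "\<lambda>us ws vs. operation (map ?F us @ (1 + deg_sum (map ?F ws), operation (map ?F ws)) # map ?F vs)"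
  let ?g = "\<lambda>us ws vs. Cscale B ((-1) powi (?C + koszul_sign (\<lambda>i. fst (?F i)) (us @ ws @ vs) + deg_sum (map ?F us))) (?X us ws vs)"
  have "(\<Sum>k=1..n. Cscale B ((-1) powi int k)
           (\<Sum>I | I \<subseteq> {1..n} \<and> card I = k. Cscale B ((-1) powi jacobi_sign l n I)
              (br (n - k + 1)
                 (((\<Sum>i\<in>I. fst (l i)) + 2 - int k, br k (args_desc l I)) # args_desc l ({1..n} - I))))) =
    (\<Sum>k=1..n. \<Sum>I | I \<subseteq> {1..n} \<and> card I = k.
     \<Sum>(us, vs)\<in>{(us, vs). us @ vs \<in> permutations_of_set ({1..n} - I)}. \<Sum>ws\<in>permutations_of_set I. ?g us ws vs)"
    unfolding CB.scale_sum_right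
    by (intro sum.cong refl) (rule jacobi_term, use l in auto)
  also have "\<dots> = (\<Sum>w\<in>permutations_of_set {1..n}. \<Sum>(us, ws, vs)\<in>cuts w. ?g us ws vs)"
    by (rule sum_permutations_cuts)
  also have "\<dots> = 0"
  proof (rule sum.neutral, rule ballI)
    fix w assume w: "w \<in> permutations_of_set {1..n}"
    have "(\<Sum>(us, ws, vs)\<in>cuts w. ?g us ws vs) =
      Cscale B ((-1) powi (?C + koszul_sign (\<lambda>i. fst (?F i)) w))
        (\<Sum>(us, ws, vs)\<in>cuts w. Cscale B ((-1) powi deg_sum (map ?F us)) (?X us ws vs))"
      unfolding CB.scale_sum_right
    proof (rule sum.cong[OF refl], clarify)
      fix us ws vs assume "(us, ws, vs) \<in> cuts w"
      then have w: "us @ ws @ vs = w" by (simp add: cuts_def)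
      show "?g us ws vs = Cscale B ((-1) powi (?C + koszul_sign (\<lambda>i. fst (?F i)) w))
        (Cscale B ((-1) powi deg_sum (map ?F us)) (?X us ws vs))"
        unfolding w CB.scale_scale ksign_add[symmetric] ..
    qed
    also have "(\<Sum>(us, ws, vs)\<in>cuts w. Cscale B ((-1) powi deg_sum (map ?F us)) (?X us ws vs)) = 0"
      unfolding sum_cuts_map[of "\<lambda>us ws vs. Cscale B ((-1) powi deg_sum us) (operation (us @ (1 + deg_sum ws, operation ws) # vs))" ?F w, symmetric]
    proof (rule operation_relation)
      fix G assume "G \<in> set (map ?F w)"
      then show "cochain G" using w l by (auto simp: permutations_of_set_def intro!: cochain_susp)
    qed
    finally show "(\<Sum>(us, ws, vs)\<in>cuts w. ?g us ws vs) = 0" by (simp only: CB.scale_zero_right)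
  qed
  finally show ?thesis .
qed

theorem lbar_L_inf_algebra: "L_inf_algebra (Cscale B) (Cspace A B \<Phi>) br"
  unfolding L_inf_algebra_def
proof (intro conjI allI impI)
  show "graded_space (Cscale B) (Cspace A B \<Phi>)"
    unfolding graded_space_def using CB.vector_space_axioms Cspace_subspace by blast
  fix n :: nat assume n: "1 \<le> n"
  show "graded_multilinear (Cscale B) (Cscale B) (replicate n (Cspace A B \<Phi>)) (Cspace A B \<Phi>) (2 - int n) (br n)"
    using n by (rule lbar_multilinear)
  show "br n (us @ l' # l # ws) = Cscale B (- ((-1) powi (fst l * fst l'))) (br n (us @ l # l' # ws))"
    if "us @ l # l' # ws \<in> htuples (replicate n (Cspace A B \<Phi>))" for us l l' ws
    using that by (intro lbar_antisymmetric[OF n]) (simp add: htuples_replicate)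
qed (rule lbar_jacobi, simp)

text \<open>As \<open>F\<close> has shifted degree \<open>0\<close>, the unary term is
  \<open>m_B(F)\<close> minus the precomposition of \<open>F\<close>, and the higher terms are
  \<open>m_B(F,...,F)\<close>. The two equations differ by moving one term to the other
  side.\<close>

lemma maurer_cartan_iff_A_inf_morphism:
  "maurer_cartan (Cspace A B \<Phi>) (lbar_divided A mA B mB \<Phi>) (obj_seqs A) F \<longleftrightarrow> A_inf_morphism A mA B mB \<Phi> F"
proof -
  let ?D = "\<lambda>n. lbar_divided A mA B mB \<Phi> n F"
  let ?M = "\<lambda>n. mcomp (replicate n (0, F))"
  have D1: "?D 1 = ?M 1 - precomp F"
    by (simp add: lbar_divided_def lbar_def susp_def Let_def)
  \<comment> \<open>If \<open>n!\<close> vanishes in the field this is the definition; otherwise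
    \<open>lbar_replicate\<close> cancels it.\<close>
  have D2: "?D n = ?M n" if "n \<ge> 2" for n
  proof (cases "(of_nat (fact n) :: 'k) = 0")
    case False
    then show ?thesis
      unfolding lbar_divided_def lbar_replicate[OF SB.vector_space_axioms that] by (simp add: susp_def)
  qed (simp add: lbar_divided_def susp_def)
  \<comment> \<open>There are \<open>length xs - 1\<close> inputs, too few for \<open>n\<close>
    nonempty pieces; this bounds the support of the sum.\<close>
  have M0: "?M n xs = 0" if "xs \<in> obj_seqs A" "length xs \<le> n" for n xs
  proof
    fix vs
    show "?M n xs vs = 0 vs"
    proof (cases "composable A xs vs")
      case True
      then have len: "length xs = Suc (length vs)"
        by (auto simp: composable_def obj_seqs_def htuples_def factors_def dest: list_all2_lengthD)
      have "compositions (length vs) n = {}"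
      proof -
        have "length ns \<le> sum_list ns" if "0 \<notin> set ns" for ns :: "nat list"
          using that by (induction ns) auto
        then show ?thesis using len that(2) by (fastforce simp: compositions_def)
      qed
      then show ?thesis by (simp add: multi_comp_def)
    qed (simp add: multi_comp_def)
  qed
  have "finite {n. 1 \<le> n \<and> ?D n xs \<noteq> 0} \<and>
      ((\<Sum>n | 1 \<le> n \<and> ?D n xs \<noteq> 0. ?D n xs) = 0 \<longleftrightarrow> precomp F xs = (\<Sum>r\<in>{1..<length xs}. ?M r xs))"
    if xs: "xs \<in> obj_seqs A" for xs
  proof -
    have len: "2 \<le> length xs" using xs by (simp add: obj_seqs_def)
    have sub: "{n. 1 \<le> n \<and> ?D n xs \<noteq> 0} \<subseteq> {1..<length xs}"
    proof clarify
      fix n assume n: "1 \<le> n" "?D n xs \<noteq> 0"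
      show "n \<in> {1..<length xs}"
      proof (rule ccontr)
        assume "n \<notin> {1..<length xs}"
        then have "n \<ge> length xs" using n by auto
        then show False using n(2) D2[of n] M0[OF xs, of n] len by simp
      qed
    qed
    then have fin: "finite {n. 1 \<le> n \<and> ?D n xs \<noteq> 0}" by (rule finite_subset) simp
    have "(\<Sum>n | 1 \<le> n \<and> ?D n xs \<noteq> 0. ?D n xs) = (\<Sum>n\<in>{1..<length xs}. ?D n xs)"
      by (rule sum.mono_neutral_left) (use sub in auto)
    also have "{1..<length xs} = insert 1 {2..<length xs}" using len by auto
    also have "(\<Sum>n\<in>insert 1 {2..<length xs}. ?D n xs) = ?D 1 xs + (\<Sum>n\<in>{2..<length xs}. ?M n xs)"
      using D2 by simp
    also have "\<dots> = (?M 1 xs + (\<Sum>n\<in>{2..<length xs}. ?M n xs)) - precomp F xs"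
      unfolding D1 by (simp add: algebra_simps)
    also have "?M 1 xs + (\<Sum>n\<in>{2..<length xs}. ?M n xs) = (\<Sum>n\<in>insert 1 {2..<length xs}. ?M n xs)"
      by simp
    also have "insert 1 {2..<length xs} = {1..<length xs}" using len by auto
    finally have "(\<Sum>n | 1 \<le> n \<and> ?D n xs \<noteq> 0. ?D n xs) = (\<Sum>r\<in>{1..<length xs}. ?M r xs) - precomp F xs" .
    then have "(\<Sum>n | 1 \<le> n \<and> ?D n xs \<noteq> 0. ?D n xs) = 0 \<longleftrightarrow>
        precomp F xs = (\<Sum>r\<in>{1..<length xs}. ?M r xs)"
      by (simp only: right_minus_eq) (rule eq_commute)
    with fin show ?thesis by (rule conjI)
  qed
  then show ?thesis
    unfolding maurer_cartan_def A_inf_morphism_def by (auto simp: shift_def)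
qed

end

theorem proposition4p6:
  fixes A :: "('k::field, 'o, 'v::ab_group_add) quiver"
    and B :: "('k, 'p, 'w::ab_group_add) quiver"
    and mA :: "('o, 'v, 'v) family"
    and mB :: "('p, 'w, 'w) family"
    and \<Phi> :: "'o \<Rightarrow> 'p"
  assumes "CHAR('k) \<noteq> 2" and "CHAR('k) \<noteq> 3"
    and "A_inf_category A mA"
    and "A_inf_category B mB"
    and "\<Phi> \<in> Obj A \<rightarrow> Obj B"
  shows "L_inf_algebra (Cscale B) (Cspace A B \<Phi>) (lbar A mA B mB \<Phi>) \<and>
    bij_betw (susp (-1))
      {(0, F) | F. A_inf_morphism A mA B mB \<Phi> F}
      {(1, f) | f. maurer_cartan (Cspace A B \<Phi>) (lbar_divided A mA B mB \<Phi>) (obj_seqs A) f}"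
proof
  interpret A_inf_pair A B \<Phi> mA mB
    using assms by unfold_locales (simp_all add: A_inf_category_def shift_def)
  show "L_inf_algebra (Cscale B) (Cspace A B \<Phi>) (lbar A mA B mB \<Phi>)"
    by (rule lbar_L_inf_algebra)
  show "bij_betw (susp (-1))
      {(0, F) | F. A_inf_morphism A mA B mB \<Phi> F}
      {(1, f) | f. maurer_cartan (Cspace A B \<Phi>) (lbar_divided A mA B mB \<Phi>) (obj_seqs A) f}"
    \<comment> \<open>\<open>susp (-1)\<close> leaves the family as it is and raises its degree from
      \<open>0\<close> to \<open>1\<close>, so once the two conditions coincide nothing but the
      pairing with degrees remains.\<close>
    unfolding maurer_cartan_iff_A_inf_morphism bij_betw_def
    by (auto simp: inj_on_def susp_def image_iff)
qed

end
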